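(* Let $\mathcal{E}$ be a category with finite limits. There is an isomorphism of categories between the category $\mathbf{Comon}(\mathbf{Poly}_{\mathcal{E}})$ of $\triangleleft$-comonoids and comonoid homomorphisms in $\mathbf{Poly}_{\mathcal{E}}$ and a category whose objects are categories internal to $\mathcal{E}$ with exponentiable source morphism and whose morphisms are internal cofunctors.
   Context: For $f\colon B\to A$ in $\mathcal{E}$, $\Delta_f\colon\mathcal{E}/A\to\mathcal{E}/B$ denotes pullback along $f$; $f$ is exponentiable if $\Delta_f$ has a right adjoint $\Pi_f$. A polynomial in $\mathcal{E}$ is an exponentiable morphism $p\colon P_*\to P$. A morphism of polynomials $\phi\colon p\to q$ is a pair $\phi_1\colon P\to Q$, $\phi^\sharp\colon P\times_Q Q_*\to P_*$ with $p\circ\phi^\sharp$ the projection to $P$, up to isomorphism of the choice of pullback. Composition is $(\psi\circ\phi)_1=\psi_1\circ\phi_1$, $(\psi\circ\phi)^\sharp=\phi^\sharp\circ(P\times_Q\psi^\sharp)$ (using $P\times_R R_*\cong P\times_Q(Q\times_R R_* )$). This gives the category $\mathbf{Poly}_{\mathcal{E}}$. It is monoidal under $(y,\triangleleft)$, where $y=\mathrm{id}_1$ and $p\triangleleft q$ is the composite of projections $(\Pi_p(Q\times P_* )\times_P P_* )\times_Q Q_*\to\Pi_p(Q\times P_* )\times_P P_*\to\Pi_p(Q\times P_* )$, with $\Pi_p(Q\times P_* )\times_P P_*\to Q$ the counit of $\Delta_p\dashv\Pi_p$ followed by projection. In terms of generalized elements, positions are pairs $(x\colon X\to P,\ f\colon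 X\times_PP_*\to Q)$ and a direction at $(x,f)$ is a pair $(y,z)$ with $y$ in $P_*$ over $x$ and $z$ in $Q_*$ over $f(y)$. On morphisms, $\phi\triangleleft\psi$ sends $(x,f)$ to $(\phi_1x,\psi_1\circ f\circ\phi^\sharp(x,-))$ and a direction $(y',z')$ there to $(\phi^\sharp(x,y'),\psi^\sharp(f(\phi^\sharp(x,y')),z'))$; associators and unitors are canonical. A $\triangleleft$-comonoid is a polynomial $c\colon C_*\to C$ with $\epsilon\colon c\to y$ and $\delta\colon c\to c\triangleleft c$ satisfying the counit and coassociativity equations in this monoidal category; a comonoid homomorphism is a morphism of polynomials commuting with counits and comultiplications. A category $\mathbf{C}$ internal to $\mathcal{E}$ consists of $s,t\colon C_1\to C_0$, $i\colon C_0\to C_1$ with $si=\mathrm{id}=ti$, and $k\colon C_1\times_{t,C_0,s}C_1\to C_1$ with $sk=s\pi_1$, $tk=t\pi_2$, satisfying the unit and associativity laws. An internal cofunctor $\phi\colon\mathbf{C}\to\mathbf{C}'$ consists of $\phi_1\colon C_0\to C'_0$ and $\phi^\sharp\colon C_0\times_{C'_0}C'_1\to C_1$ (pullback of $s'$ along $\phi_1$; data taken up to isomorphism of the choice of pullback) with $s\circ\phi^\sharp$ the projection to $C_0$, such that (in generalized elements) $$\phi^\sharp(x,i'(\phi_1x))=i(x),\qquad \phi_1\bigl(t(\phi^\sharp(x,y))\bigr)=t'(y),\qquad \phi^\sharp(x,k'(y,z))=k\bigl(\phi^\sharp(x,y),\ \phi^\sharp(t(\phi^\sharp(x,y)),z)\bigr).$$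 Identities and composites of internal cofunctors are those of the underlying morphisms of polynomials $s\to s'$. *)

theory Defs
  imports Main
begin

section \<open>Categories, functors, adjunctions\<close>

record ('o, 'm) cat =
  Obj :: "'o set"
  Arr :: "'m set"
  Dom :: "'m \<Rightarrow> 'o"
  Cod :: "'m \<Rightarrow> 'o"
  Ident :: "'o \<Rightarrow> 'm"
  Comp :: "'m \<Rightarrow> 'm \<Rightarrow> 'm"  (infixr "\<cdot>\<index>" 70)

definition hom :: "('o, 'm, 'z) cat_scheme \<Rightarrow> 'o \<Rightarrow> 'o \<Rightarrow> 'm set" where
  "hom C a b = {f \<in> Arr C. Dom C f = a \<and> Cod C f = b}"

text \<open>Composition is written in applicative order: \<open>g \<cdot> f\<close> means \<open>f\<close> first.\<close>

locale category =
  fixes C :: "('o, 'm, 'z) cat_scheme" (structure)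
  assumes Dom_in: "f \<in> Arr C \<Longrightarrow> Dom C f \<in> Obj C"
    and Cod_in: "f \<in> Arr C \<Longrightarrow> Cod C f \<in> Obj C"
    and Ident_in: "a \<in> Obj C \<Longrightarrow> Ident C a \<in> hom C a a"
    and Comp_in: "f \<in> hom C a b \<Longrightarrow> g \<in> hom C b c \<Longrightarrow> g \<cdot> f \<in> hom C a c"
    and Comp_Ident: "f \<in> hom C a b \<Longrightarrow> f \<cdot> Ident C a = f"
    and Ident_Comp: "f \<in> hom C a b \<Longrightarrow> Ident C b \<cdot> f = f"
    and Comp_assoc: "f \<in> hom C a b \<Longrightarrow> g \<in> hom C b c \<Longrightarrow> h \<in> hom C c d \<Longrightarrow>
          (h \<cdot> g) \<cdot> f = h \<cdot> (g \<cdot> f)"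

record ('o, 'm, 'p, 'n) func =
  fobj :: "'o \<Rightarrow> 'p"
  farr :: "'m \<Rightarrow> 'n"

definition is_functor ::
  "('o, 'm, 'y) cat_scheme \<Rightarrow> ('p, 'n, 'z) cat_scheme \<Rightarrow> ('o, 'm, 'p, 'n) func \<Rightarrow> bool" where
  "is_functor C D F \<longleftrightarrow> category C \<and> category D \<and>
     (\<forall>a\<in>Obj C. fobj F a \<in> Obj D) \<and>
     (\<forall>f\<in>Arr C. farr F f \<in> hom D (fobj F (Dom C f)) (fobj F (Cod C f))) \<and>
     (\<forall>a\<in>Obj C. farr F (Ident C a) = Ident D (fobj F a)) \<and>
     (\<forall>f\<in>Arr C. \<forall>g\<in>Arr C. Dom C g = Cod C f \<longrightarrow>
        farr F (g \<cdot>\<^bsub>C\<^esub> f) = farr F g \<cdot>\<^bsub>D\<^esub> farr F f)"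

definition isomorphic_categories ::
  "('o, 'm, 'y) cat_scheme \<Rightarrow> ('p, 'n, 'z) cat_scheme \<Rightarrow> bool" where
  "isomorphic_categories C D \<longleftrightarrow> (\<exists>F G. is_functor C D F \<and> is_functor D C G \<and>
     (\<forall>a\<in>Obj C. fobj G (fobj F a) = a) \<and> (\<forall>f\<in>Arr C. farr G (farr F f) = f) \<and>
     (\<forall>b\<in>Obj D. fobj F (fobj G b) = b) \<and> (\<forall>g\<in>Arr D. farr F (farr G g) = g))"

text \<open>\<open>F : C \<rightarrow> D\<close> is left adjoint to \<open>G\<close>, with unit \<open>\<eta>\<close> and counit \<open>\<epsilon>\<close>.\<close>

definition adjunction ::
  "('o, 'm) cat \<Rightarrow> ('p, 'n) cat \<Rightarrow> ('o, 'm, 'p, 'n) func \<Rightarrow> ('p, 'n, 'o, 'm) func \<Rightarrow>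
   ('o \<Rightarrow> 'm) \<Rightarrow> ('p \<Rightarrow> 'n) \<Rightarrow> bool" where
  "adjunction C D F G \<eta> \<epsilon> \<longleftrightarrow> is_functor C D F \<and> is_functor D C G \<and>
     (\<forall>a\<in>Obj C. \<eta> a \<in> hom C a (fobj G (fobj F a))) \<and>
     (\<forall>f\<in>Arr C. farr G (farr F f) \<cdot>\<^bsub>C\<^esub> \<eta> (Dom C f) = \<eta> (Cod C f) \<cdot>\<^bsub>C\<^esub> f) \<and>
     (\<forall>b\<in>Obj D. \<epsilon> b \<in> hom D (fobj F (fobj G b)) b) \<and>
     (\<forall>g\<in>Arr D. g \<cdot>\<^bsub>D\<^esub> \<epsilon> (Dom D g) = \<epsilon> (Cod D g) \<cdot>\<^bsub>D\<^esub> farr F (farr G g)) \<and>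
     (\<forall>a\<in>Obj C. \<epsilon> (fobj F a) \<cdot>\<^bsub>D\<^esub> farr F (\<eta> a) = Ident D (fobj F a)) \<and>
     (\<forall>b\<in>Obj D. farr G (\<epsilon> b) \<cdot>\<^bsub>C\<^esub> \<eta> (fobj G b) = Ident C (fobj G b))"


section \<open>Limits\<close>

definition is_cone ::
  "('i, 'j) cat \<Rightarrow> ('o, 'a) cat \<Rightarrow> ('i, 'j, 'o, 'a) func \<Rightarrow> 'o \<Rightarrow> ('i \<Rightarrow> 'a) \<Rightarrow> bool" where
  "is_cone J E D a \<pi> \<longleftrightarrow> a \<in> Obj E \<and> (\<forall>j\<in>Obj J. \<pi> j \<in> hom E a (fobj D j)) \<and>
     (\<forall>f\<in>Arr J. farr D f \<cdot>\<^bsub>E\<^esub> \<pi> (Dom J f) = \<pi> (Cod J f))"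

definition is_limit ::
  "('i, 'j) cat \<Rightarrow> ('o, 'a) cat \<Rightarrow> ('i, 'j, 'o, 'a) func \<Rightarrow> 'o \<Rightarrow> ('i \<Rightarrow> 'a) \<Rightarrow> bool" where
  "is_limit J E D a \<pi> \<longleftrightarrow> is_cone J E D a \<pi> \<and>
     (\<forall>b \<sigma>. is_cone J E D b \<sigma> \<longrightarrow>
        (\<exists>!u. u \<in> hom E b a \<and> (\<forall>j\<in>Obj J. \<pi> j \<cdot>\<^bsub>E\<^esub> u = \<sigma> j)))"

text \<open>Every finite category is isomorphic to one whose objects and arrows are natural numbers,
  so index categories of this type suffice.\<close>

definition has_finite_limits :: "('o, 'a) cat \<Rightarrow> bool" where
  "has_finite_limits E \<longleftrightarrow> (\<forall>(J :: (nat, nat) cat) D.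
     finite (Obj J) \<and> finite (Arr J) \<and> is_functor J E D \<longrightarrow> (\<exists>a \<pi>. is_limit J E D a \<pi>))"

text \<open>From here on terminal objects, products, pullbacks and the adjunctions
  \<open>\<Delta>\<^sub>f \<stileturn> \<Pi>\<^sub>f\<close> are chosen once and for all by Hilbert choice. A datum
  which is only given ``up to isomorphism of the choice of pullback'' is represented by its
  unique representative on the chosen pullback.\<close>

context
  fixes E :: "('o, 'a) cat" (structure)
begin

definition is_terminal :: "'o \<Rightarrow> bool" where
  "is_terminal a \<longleftrightarrow> a \<in> Obj E \<and> (\<forall>b\<in>Obj E. \<exists>!f. f \<in> hom E b a)"

definition terminal :: 'o where
  "terminal = (SOME a. is_terminal a)"

definition bang :: "'o \<Rightarrow> 'a" where
  "bang a = (THE f. f \<in> hom E a terminal)"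

definition is_product :: "'o \<Rightarrow> 'o \<Rightarrow> 'a \<Rightarrow> 'a \<Rightarrow> bool" where
  "is_product a b h k \<longleftrightarrow> h \<in> hom E (Dom E h) a \<and> k \<in> hom E (Dom E h) b \<and>
     (\<forall>c x y. x \<in> hom E c a \<and> y \<in> hom E c b \<longrightarrow>
        (\<exists>!u. u \<in> hom E c (Dom E h) \<and> h \<cdot> u = x \<and> k \<cdot> u = y))"

definition product :: "'o \<Rightarrow> 'o \<Rightarrow> 'a \<times> 'a" where
  "product a b = (SOME (h, k). is_product a b h k)"

definition pr1 :: "'o \<Rightarrow> 'o \<Rightarrow> 'a" where "pr1 a b = fst (product a b)"
definition pr2 :: "'o \<Rightarrow> 'o \<Rightarrow> 'a" where "pr2 a b = snd (product a b)"

definition pr_pair :: "'o \<Rightarrow> 'o \<Rightarrow> 'a \<Rightarrow> 'a \<Rightarrow> 'a" where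
  "pr_pair a b x y =
     (THE u. u \<in> hom E (Dom E x) (Dom E (pr1 a b)) \<and> pr1 a b \<cdot> u = x \<and> pr2 a b \<cdot> u = y)"

definition is_pullback :: "'a \<Rightarrow> 'a \<Rightarrow> 'a \<Rightarrow> 'a \<Rightarrow> bool" where
  "is_pullback f g h k \<longleftrightarrow>
     h \<in> hom E (Dom E h) (Dom E f) \<and> k \<in> hom E (Dom E h) (Dom E g) \<and> f \<cdot> h = g \<cdot> k \<and>
     (\<forall>c x y. x \<in> hom E c (Dom E f) \<and> y \<in> hom E c (Dom E g) \<and> f \<cdot> x = g \<cdot> y \<longrightarrow>
        (\<exists>!u. u \<in> hom E c (Dom E h) \<and> h \<cdot> u = x \<and> k \<cdot> u = y))"

definition pullback :: "'a \<Rightarrow> 'a \<Rightarrow> 'a \<times> 'a" where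
  "pullback f g = (SOME (h, k). is_pullback f g h k)"

definition pb1 :: "'a \<Rightarrow> 'a \<Rightarrow> 'a" where "pb1 f g = fst (pullback f g)"
definition pb2 :: "'a \<Rightarrow> 'a \<Rightarrow> 'a" where "pb2 f g = snd (pullback f g)"
definition pb_obj :: "'a \<Rightarrow> 'a \<Rightarrow> 'o" where "pb_obj f g = Dom E (pb1 f g)"

text \<open>The map into the pullback of \<open>f\<close> and \<open>g\<close> with components \<open>x\<close> and \<open>y\<close>.\<close>

definition pb_pair :: "'a \<Rightarrow> 'a \<Rightarrow> 'a \<Rightarrow> 'a \<Rightarrow> 'a" where
  "pb_pair f g x y =
     (THE u. u \<in> hom E (Dom E x) (pb_obj f g) \<and> pb1 f g \<cdot> u = x \<and> pb2 f g \<cdot> u = y)"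


section \<open>Slices and exponentiable morphisms\<close>

text \<open>An arrow from \<open>x\<close> to \<open>x'\<close> in the slice over \<open>A\<close> is a triple \<open>(x, x', h)\<close> with
  \<open>x' \<cdot> h = x\<close>.\<close>

definition slice :: "'o \<Rightarrow> ('a, 'a \<times> 'a \<times> 'a) cat" where
  "slice A = \<lparr>
     Obj = {x \<in> Arr E. Cod E x = A},
     Arr = {(x, x', h). x \<in> Arr E \<and> Cod E x = A \<and> x' \<in> Arr E \<and> Cod E x' = A \<and>
              h \<in> hom E (Dom E x) (Dom E x') \<and> x' \<cdot> h = x},
     Dom = (\<lambda>(x, x', h). x),
     Cod = (\<lambda>(x, x', h). x'),
     Ident = (\<lambda>x. (x, x, Ident E (Dom E x))),
     Comp = (\<lambda>(y, y', k) (x, x', h). (x, y', k \<cdot> h))\<rparr>"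

definition slice_map :: "'a \<times> 'a \<times> 'a \<Rightarrow> 'a" where
  "slice_map = (\<lambda>(x, x', h). h)"

text \<open>Pullback along \<open>f : B \<rightarrow> A\<close>, from the slice over \<open>A\<close> to the slice over \<open>B\<close>.\<close>

definition Delta :: "'a \<Rightarrow> ('a, 'a \<times> 'a \<times> 'a, 'a, 'a \<times> 'a \<times> 'a) func" where
  "Delta f = \<lparr>
     fobj = (\<lambda>x. pb2 x f),
     farr = (\<lambda>(x, x', h). (pb2 x f, pb2 x' f, pb_pair x' f (h \<cdot> pb1 x f) (pb2 x f)))\<rparr>"

definition has_Pi ::
  "'a \<Rightarrow> ('a, 'a \<times> 'a \<times> 'a, 'a, 'a \<times> 'a \<times> 'a) func \<Rightarrow>
   ('a \<Rightarrow> 'a \<times> 'a \<times> 'a) \<Rightarrow> ('a \<Rightarrow> 'a \<times> 'a \<times> 'a) \<Rightarrow> bool" where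
  "has_Pi f G \<eta> \<epsilon> \<longleftrightarrow> adjunction (slice (Cod E f)) (slice (Dom E f)) (Delta f) G \<eta> \<epsilon>"

definition exponentiable :: "'a \<Rightarrow> bool" where
  "exponentiable f \<longleftrightarrow> f \<in> Arr E \<and> (\<exists>G \<eta> \<epsilon>. has_Pi f G \<eta> \<epsilon>)"

definition Pi_data ::
  "'a \<Rightarrow> ('a, 'a \<times> 'a \<times> 'a, 'a, 'a \<times> 'a \<times> 'a) func \<times>
        ('a \<Rightarrow> 'a \<times> 'a \<times> 'a) \<times> ('a \<Rightarrow> 'a \<times> 'a \<times> 'a)" where
  "Pi_data f = (SOME (G, \<eta>, \<epsilon>). has_Pi f G \<eta> \<epsilon>)"

definition Pi_functor :: "'a \<Rightarrow> ('a, 'a \<times> 'a \<times> 'a, 'a, 'a \<times> 'a \<times> 'a) func" where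
  "Pi_functor f = fst (Pi_data f)"
definition Pi_unit :: "'a \<Rightarrow> 'a \<Rightarrow> 'a \<times> 'a \<times> 'a" where
  "Pi_unit f = fst (snd (Pi_data f))"
definition Pi_counit :: "'a \<Rightarrow> 'a \<Rightarrow> 'a \<times> 'a \<times> 'a" where
  "Pi_counit f = snd (snd (Pi_data f))"

end


section \<open>Monoidal structures and comonoids\<close>

text \<open>The data of a monoidal category that enter the notion of a comonoid; the components of
  \<open>assoc\<close>, \<open>lunit\<close>, \<open>runit\<close> go
  \<open>(a \<otimes> b) \<otimes> c \<rightarrow> a \<otimes> (b \<otimes> c)\<close>, \<open>I \<otimes> a \<rightarrow> a\<close> and \<open>a \<otimes> I \<rightarrow> a\<close>.\<close>

record ('o, 'm) moncat = "('o, 'm) cat" +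
  tens_obj :: "'o \<Rightarrow> 'o \<Rightarrow> 'o"
  tens_arr :: "'m \<Rightarrow> 'm \<Rightarrow> 'm"
  tens_unit :: 'o
  assoc :: "'o \<Rightarrow> 'o \<Rightarrow> 'o \<Rightarrow> 'm"
  lunit :: "'o \<Rightarrow> 'm"
  runit :: "'o \<Rightarrow> 'm"

record ('o, 'm) comonoid =
  cobj :: 'o
  counit :: 'm
  comult :: 'm

definition is_comonoid :: "('o, 'm) moncat \<Rightarrow> ('o, 'm) comonoid \<Rightarrow> bool" where
  "is_comonoid M c \<longleftrightarrow>
     (let a = cobj c; \<epsilon> = counit c; \<delta> = comult c; I = Ident M a in
      a \<in> Obj M \<and> \<epsilon> \<in> hom M a (tens_unit M) \<and> \<delta> \<in> hom M a (tens_obj M a a) \<and>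
      lunit M a \<cdot>\<^bsub>M\<^esub> tens_arr M \<epsilon> I \<cdot>\<^bsub>M\<^esub> \<delta> = I \<and>
      runit M a \<cdot>\<^bsub>M\<^esub> tens_arr M I \<epsilon> \<cdot>\<^bsub>M\<^esub> \<delta> = I \<and>
      assoc M a a a \<cdot>\<^bsub>M\<^esub> tens_arr M \<delta> I \<cdot>\<^bsub>M\<^esub> \<delta> = tens_arr M I \<delta> \<cdot>\<^bsub>M\<^esub> \<delta>)"

definition is_comonoid_hom ::
  "('o, 'm) moncat \<Rightarrow> ('o, 'm) comonoid \<Rightarrow> ('o, 'm) comonoid \<Rightarrow> 'm \<Rightarrow> bool" where
  "is_comonoid_hom M c d f \<longleftrightarrow> f \<in> hom M (cobj c) (cobj d) \<and>
     counit d \<cdot>\<^bsub>M\<^esub> f = counit c \<and>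
     comult d \<cdot>\<^bsub>M\<^esub> f = tens_arr M f f \<cdot>\<^bsub>M\<^esub> comult c"

text \<open>An arrow of \<open>Comon\<close> is a triple \<open>(source, target, underlying arrow)\<close>.\<close>

definition Comon ::
  "('o, 'm) moncat \<Rightarrow> (('o, 'm) comonoid, ('o, 'm) comonoid \<times> ('o, 'm) comonoid \<times> 'm) cat" where
  "Comon M = \<lparr>
     Obj = {c. is_comonoid M c},
     Arr = {(c, d, f). is_comonoid M c \<and> is_comonoid M d \<and> is_comonoid_hom M c d f},
     Dom = (\<lambda>(c, d, f). c),
     Cod = (\<lambda>(c, d, f). d),
     Ident = (\<lambda>c. (c, c, Ident M (cobj c))),
     Comp = (\<lambda>(d, e, g) (c, d', f). (c, e, g \<cdot>\<^bsub>M\<^esub> f))\<rparr>"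


section \<open>Polynomials\<close>

text \<open>A polynomial is an arrow \<open>p : P\<^sub>* \<rightarrow> P\<close>, so \<open>P\<close> is \<open>Cod E p\<close> and \<open>P\<^sub>*\<close> is \<open>Dom E p\<close>.
  A morphism \<open>\<phi> : p \<rightarrow> q\<close> records its ends, \<open>\<phi>\<^sub>1\<close> as \<open>on_pos\<close> and \<open>\<phi>\<^sup>\<sharp>\<close> as \<open>on_dir\<close>.\<close>

record 'a pmor =
  pm_dom :: 'a
  pm_cod :: 'a
  on_pos :: 'a
  on_dir :: 'a

context
  fixes E :: "('o, 'a) cat" (structure)
begin

definition is_pmor :: "'a \<Rightarrow> 'a \<Rightarrow> 'a pmor \<Rightarrow> bool" where
  "is_pmor p q \<phi> \<longleftrightarrow> pm_dom \<phi> = p \<and> pm_cod \<phi> = q \<and>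
     on_pos \<phi> \<in> hom E (Cod E p) (Cod E q) \<and>
     on_dir \<phi> \<in> hom E (pb_obj E (on_pos \<phi>) q) (Dom E p) \<and>
     p \<cdot> on_dir \<phi> = pb1 E (on_pos \<phi>) q"

definition pmor_id :: "'a \<Rightarrow> 'a pmor" where
  "pmor_id p = \<lparr>pm_dom = p, pm_cod = p,
     on_pos = Ident E (Cod E p), on_dir = pb2 E (Ident E (Cod E p)) p\<rparr>"

definition pmor_comp :: "'a pmor \<Rightarrow> 'a pmor \<Rightarrow> 'a pmor" where
  "pmor_comp \<psi> \<phi> =
     (let q = pm_dom \<psi>; r = pm_cod \<psi>;
          n = on_pos \<psi> \<cdot> on_pos \<phi>;
          x = pb1 E n r; z = pb2 E n r;
          y = on_dir \<psi> \<cdot> pb_pair E (on_pos \<psi>) r (on_pos \<phi> \<cdot> x) z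
      in \<lparr>pm_dom = pm_dom \<phi>, pm_cod = r, on_pos = n,
          on_dir = on_dir \<phi> \<cdot> pb_pair E (on_pos \<phi>) q x y\<rparr>)"


subsection \<open>Composition product\<close>

text \<open>\<open>pos p q\<close> is \<open>\<Pi>\<^sub>p(Q \<times> P\<^sub>*)\<close> as an object over \<open>P\<close>, and
  \<open>ev p q : \<Pi>\<^sub>p(Q \<times> P\<^sub>*) \<times>\<^sub>P P\<^sub>* \<rightarrow> Q\<close> is the counit followed by the projection.\<close>

definition pos :: "'a \<Rightarrow> 'a \<Rightarrow> 'a" where
  "pos p q = fobj (Pi_functor E p) (pr2 E (Cod E q) (Dom E p))"

definition ev :: "'a \<Rightarrow> 'a \<Rightarrow> 'a" where
  "ev p q = pr1 E (Cod E q) (Dom E p) \<cdot>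
     slice_map (Pi_counit E p (pr2 E (Cod E q) (Dom E p)))"

definition ptens :: "'a \<Rightarrow> 'a \<Rightarrow> 'a" where
  "ptens p q = pb1 E (pos p q) p \<cdot> pb1 E (ev p q) q"

text \<open>Generalized elements. For \<open>x : X \<rightarrow> P\<close> and \<open>f : X \<times>\<^sub>P P\<^sub>* \<rightarrow> Q\<close>, the position
  \<open>(x, f)\<close> is \<open>mk_pos p q x f : X \<rightarrow> \<Pi>\<^sub>p(Q \<times> P\<^sub>*)\<close>, the adjoint transpose of
  \<open>\<langle>f, \<pi>\<^sub>2\<rangle> : X \<times>\<^sub>P P\<^sub>* \<rightarrow> Q \<times> P\<^sub>*\<close>. Given a position \<open>u\<close> with function part \<open>f\<close> and
  \<open>y\<close> in \<open>P\<^sub>*\<close> over it, \<open>app_pos p q u y\<close> is \<open>f(y)\<close>, and \<open>mk_dir p q u y z\<close> is the direction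
  \<open>(y, z)\<close> at \<open>u\<close>; \<open>dir1\<close> and \<open>dir2\<close> recover \<open>y\<close> and \<open>z\<close>.\<close>

definition mk_pos :: "'a \<Rightarrow> 'a \<Rightarrow> 'a \<Rightarrow> 'a \<Rightarrow> 'a" where
  "mk_pos p q x f =
     slice_map (farr (Pi_functor E p)
       (pb2 E x p, pr2 E (Cod E q) (Dom E p), pr_pair E (Cod E q) (Dom E p) f (pb2 E x p)))
     \<cdot> slice_map (Pi_unit E p x)"

definition app_pos :: "'a \<Rightarrow> 'a \<Rightarrow> 'a \<Rightarrow> 'a \<Rightarrow> 'a" where
  "app_pos p q u y = ev p q \<cdot> pb_pair E (pos p q) p u y"

definition mk_dir :: "'a \<Rightarrow> 'a \<Rightarrow> 'a \<Rightarrow> 'a \<Rightarrow> 'a \<Rightarrow> 'a" where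
  "mk_dir p q u y z = pb_pair E (ev p q) q (pb_pair E (pos p q) p u y) z"

definition dir1 :: "'a \<Rightarrow> 'a \<Rightarrow> 'a \<Rightarrow> 'a" where
  "dir1 p q w = pb2 E (pos p q) p \<cdot> pb1 E (ev p q) q \<cdot> w"

definition dir2 :: "'a \<Rightarrow> 'a \<Rightarrow> 'a \<Rightarrow> 'a" where
  "dir2 p q w = pb2 E (ev p q) q \<cdot> w"

text \<open>On the generic position \<open>(x, f)\<close> of \<open>p \<triangleleft> q\<close>, the function part of the image is
  \<open>y' \<mapsto> \<psi>\<^sub>1 (f (\<phi>\<^sup>\<sharp> (x, y')))\<close>.\<close>

definition ptens_pos :: "'a pmor \<Rightarrow> 'a pmor \<Rightarrow> 'a" where
  "ptens_pos \<phi> \<psi> =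
     (let p = pm_dom \<phi>; p' = pm_cod \<phi>; q = pm_dom \<psi>; q' = pm_cod \<psi>;
          x' = on_pos \<phi> \<cdot> pos p q;
          u = pb1 E x' p'; y' = pb2 E x' p';
          y = on_dir \<phi> \<cdot> pb_pair E (on_pos \<phi>) p' (pos p q \<cdot> u) y'
      in mk_pos p' q' x' (on_pos \<psi> \<cdot> app_pos p q u y))"

definition ptens_dir :: "'a pmor \<Rightarrow> 'a pmor \<Rightarrow> 'a" where
  "ptens_dir \<phi> \<psi> =
     (let p = pm_dom \<phi>; p' = pm_cod \<phi>; q = pm_dom \<psi>; q' = pm_cod \<psi>;
          n = ptens_pos \<phi> \<psi>;
          u = pb1 E n (ptens p' q'); w' = pb2 E n (ptens p' q');
          y = on_dir \<phi> \<cdot> pb_pair E (on_pos \<phi>) p' (pos p q \<cdot> u) (dir1 p' q' w');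
          z = on_dir \<psi> \<cdot> pb_pair E (on_pos \<psi>) q' (app_pos p q u y) (dir2 p' q' w')
      in mk_dir p q u y z)"

definition ptens_mor :: "'a pmor \<Rightarrow> 'a pmor \<Rightarrow> 'a pmor" where
  "ptens_mor \<phi> \<psi> = \<lparr>pm_dom = ptens (pm_dom \<phi>) (pm_dom \<psi>), pm_cod = ptens (pm_cod \<phi>) (pm_cod \<psi>),
     on_pos = ptens_pos \<phi> \<psi>, on_dir = ptens_dir \<phi> \<psi>\<rparr>"

definition yon :: 'a where
  "yon = Ident E (terminal E)"

text \<open>Left unitor: \<open>(\<star>, f) \<mapsto> f(\<star>)\<close> on positions, \<open>z \<mapsto> (\<star>, z)\<close> on directions.
  Right unitor: \<open>(x, f) \<mapsto> x\<close> on positions, \<open>y \<mapsto> (y, \<star>)\<close> on directions.\<close>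

definition plunit :: "'a \<Rightarrow> 'a pmor" where
  "plunit p =
     (let D = Dom E (pos yon p);
          n = app_pos yon p (Ident E D) (bang E D)
      in \<lparr>pm_dom = ptens yon p, pm_cod = p, on_pos = n,
          on_dir = mk_dir yon p (pb1 E n p) (bang E (pb_obj E n p)) (pb2 E n p)\<rparr>)"

definition prunit :: "'a \<Rightarrow> 'a pmor" where
  "prunit p =
     (let n = pos p yon
      in \<lparr>pm_dom = ptens p yon, pm_cod = p, on_pos = n,
          on_dir = mk_dir p yon (pb1 E n p) (pb2 E n p) (bang E (pb_obj E n p))\<rparr>)"

text \<open>Associator: a position \<open>((x, f), g)\<close> of \<open>(p \<triangleleft> q) \<triangleleft> r\<close> goes to
  \<open>(x, \<lambda>y. (f y, \<lambda>z. g (y, z)))\<close>, and a direction \<open>(y, (z, w))\<close> there to \<open>((y, z), w)\<close>.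
  Below, \<open>e : D \<rightarrow> \<Pi>\<^sub>p(Q \<times> P\<^sub>*)\<close> is the generic \<open>(x, f)\<close>; \<open>u\<close>, \<open>y\<close> are the projections of
  \<open>D \<times>\<^sub>P P\<^sub>*\<close>; and \<open>v\<close>, \<open>z\<close> those of \<open>(D \<times>\<^sub>P P\<^sub>*) \<times>\<^sub>Q Q\<^sub>*\<close>.\<close>

definition passoc_pos :: "'a \<Rightarrow> 'a \<Rightarrow> 'a \<Rightarrow> 'a" where
  "passoc_pos p q r =
     (let e = pos (ptens p q) r;
          x = pos p q \<cdot> e;
          u = pb1 E x p; y = pb2 E x p;
          fy = app_pos p q (e \<cdot> u) y;
          v = pb1 E fy q; z = pb2 E fy q;
          gyz = app_pos (ptens p q) r (u \<cdot> v) (mk_dir p q (e \<cdot> u \<cdot> v) (y \<cdot> v) z)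
      in mk_pos p (ptens q r) x (mk_pos q r fy gyz))"

definition passoc_dir :: "'a \<Rightarrow> 'a \<Rightarrow> 'a \<Rightarrow> 'a" where
  "passoc_dir p q r =
     (let n = passoc_pos p q r; t = ptens p (ptens q r);
          u = pb1 E n t; d = pb2 E n t;
          y = dir1 p (ptens q r) d;
          z = dir1 q r (dir2 p (ptens q r) d);
          w = dir2 q r (dir2 p (ptens q r) d)
      in mk_dir (ptens p q) r u (mk_dir p q (pos (ptens p q) r \<cdot> u) y z) w)"

definition passoc :: "'a \<Rightarrow> 'a \<Rightarrow> 'a \<Rightarrow> 'a pmor" where
  "passoc p q r = \<lparr>pm_dom = ptens (ptens p q) r, pm_cod = ptens p (ptens q r),
     on_pos = passoc_pos p q r, on_dir = passoc_dir p q r\<rparr>"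

definition Poly :: "('a, 'a pmor) moncat" where
  "Poly = \<lparr>
     Obj = {p. exponentiable E p},
     Arr = {\<phi>. exponentiable E (pm_dom \<phi>) \<and> exponentiable E (pm_cod \<phi>) \<and>
              is_pmor (pm_dom \<phi>) (pm_cod \<phi>) \<phi>},
     Dom = pm_dom, Cod = pm_cod, Ident = pmor_id, Comp = pmor_comp,
     tens_obj = ptens, tens_arr = ptens_mor, tens_unit = yon,
     assoc = passoc, lunit = plunit, runit = prunit\<rparr>"

end


section \<open>Internal categories and cofunctors\<close>

text \<open>\<open>C\<^sub>0\<close> is \<open>Cod E (isrc C)\<close> and \<open>C\<^sub>1\<close> is \<open>Dom E (isrc C)\<close>. The composition \<open>k\<close> is in
  diagrammatic order.\<close>

record 'a icat =
  isrc :: 'a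
  itgt :: 'a
  iid :: 'a
  icomp :: 'a

context
  fixes E :: "('o, 'a) cat" (structure)
begin

definition iob :: "'a icat \<Rightarrow> 'o" where "iob C = Cod E (isrc C)"
definition imor :: "'a icat \<Rightarrow> 'o" where "imor C = Dom E (isrc C)"

text \<open>\<open>k(f, g)\<close> for generalized elements \<open>f\<close>, \<open>g\<close> of \<open>C\<^sub>1\<close> with \<open>t f = s g\<close>.\<close>

definition kap :: "'a icat \<Rightarrow> 'a \<Rightarrow> 'a \<Rightarrow> 'a" where
  "kap C f g = icomp C \<cdot> pb_pair E (itgt C) (isrc C) f g"

definition is_icat :: "'a icat \<Rightarrow> bool" where
  "is_icat C \<longleftrightarrow>
     (let s = isrc C; t = itgt C; i = iid C; k = icomp C in
      s \<in> hom E (imor C) (iob C) \<and> t \<in> hom E (imor C) (iob C) \<and>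
      i \<in> hom E (iob C) (imor C) \<and> s \<cdot> i = Ident E (iob C) \<and> t \<cdot> i = Ident E (iob C) \<and>
      k \<in> hom E (pb_obj E t s) (imor C) \<and>
      s \<cdot> k = s \<cdot> pb1 E t s \<and> t \<cdot> k = t \<cdot> pb2 E t s \<and>
      (\<forall>X. \<forall>f\<in>hom E X (imor C).
         kap C (i \<cdot> s \<cdot> f) f = f \<and> kap C f (i \<cdot> t \<cdot> f) = f) \<and>
      (\<forall>X. \<forall>f\<in>hom E X (imor C). \<forall>g\<in>hom E X (imor C). \<forall>h\<in>hom E X (imor C).
         t \<cdot> f = s \<cdot> g \<and> t \<cdot> g = s \<cdot> h \<longrightarrow> kap C (kap C f g) h = kap C f (kap C g h)))"

text \<open>A cofunctor \<open>C \<rightarrow> D\<close> is given by its underlying morphism of polynomials from the source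
  morphism of \<open>C\<close> to that of \<open>D\<close>; \<open>lift x y\<close> is \<open>\<phi>\<^sup>\<sharp>(x, y)\<close>.\<close>

definition is_cofunctor :: "'a icat \<Rightarrow> 'a icat \<Rightarrow> 'a pmor \<Rightarrow> bool" where
  "is_cofunctor C D \<phi> \<longleftrightarrow> is_pmor E (isrc C) (isrc D) \<phi> \<and>
     (let lift = (\<lambda>x y. on_dir \<phi> \<cdot> pb_pair E (on_pos \<phi>) (isrc D) x y) in
      (\<forall>X. \<forall>x\<in>hom E X (iob C).
         lift x (iid D \<cdot> on_pos \<phi> \<cdot> x) = iid C \<cdot> x) \<and>
      (\<forall>X. \<forall>x\<in>hom E X (iob C). \<forall>y\<in>hom E X (imor D).
         on_pos \<phi> \<cdot> x = isrc D \<cdot> y \<longrightarrow>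
         on_pos \<phi> \<cdot> itgt C \<cdot> lift x y = itgt D \<cdot> y) \<and>
      (\<forall>X. \<forall>x\<in>hom E X (iob C). \<forall>y\<in>hom E X (imor D). \<forall>z\<in>hom E X (imor D).
         on_pos \<phi> \<cdot> x = isrc D \<cdot> y \<and> itgt D \<cdot> y = isrc D \<cdot> z \<longrightarrow>
         lift x (kap D y z) = kap C (lift x y) (lift (itgt C \<cdot> lift x y) z)))"

text \<open>Internal categories with exponentiable source morphism, and cofunctors. An arrow is a triple
  \<open>(source, target, underlying morphism of polynomials)\<close>.\<close>

definition Cofun :: "('a icat, 'a icat \<times> 'a icat \<times> 'a pmor) cat" where
  "Cofun = \<lparr>
     Obj = {C. is_icat C \<and> exponentiable E (isrc C)},
     Arr = {(C, D, \<phi>). is_icat C \<and> exponentiable E (isrc C) \<and>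
              is_icat D \<and> exponentiable E (isrc D) \<and> is_cofunctor C D \<phi>},
     Dom = (\<lambda>(C, D, \<phi>). C),
     Cod = (\<lambda>(C, D, \<phi>). D),
     Ident = (\<lambda>C. (C, C, pmor_id E (isrc C))),
     Comp = (\<lambda>(D, D', \<psi>) (C, C', \<phi>). (C, D', pmor_comp E \<psi> \<phi>))\<rparr>"

end

end

theory Submission
  imports Defs
begin

text \<open>Everything is computed on generalized elements. A position of \<open>p \<triangleleft> q\<close> is determined by its
  base and the values of \<open>app_pos\<close> on it, a direction by \<open>dir1\<close> and \<open>dir2\<close>, and a morphism of
  polynomials by \<open>on_pos\<close> and its action \<open>lift\<close> on directions, so each equation between morphisms
  of polynomials becomes a family of equations between elements. The right counit law forces
  the base part of \<open>\<delta>\<^sub>1\<close> to be the identity; the function part of \<open>\<delta>\<^sub>1\<close> is then the target map \<open>t\<close>,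
  \<open>\<epsilon>\<^sup>\<sharp>\<close> is the identity map \<open>i\<close>, and \<open>\<delta>\<^sup>\<sharp>\<close> is the composition \<open>k\<close>. The left counit law says \<open>t i = id\<close>
  together with the left unit law, the rest of the right counit law is the right unit law, and
  coassociativity says \<open>t k = t \<pi>\<^sub>2\<close> together with associativity. In the same way a comonoid
  homomorphism is a cofunctor, with the same underlying morphism of polynomials. The comonoid
  laws also require \<open>p \<triangleleft> q\<close> to be exponentiable, which follows from the stability of
  exponentiable morphisms under composition and pullback.\<close>

text \<open>An isomorphism, not just an equivalence, is within reach because all data live on chosen
  limits and are determined there by their action on generalized elements (\<open>pos_ext\<close>,
  \<open>mk_dir_eta\<close>, \<open>pmor_ext\<close>); both round trips therefore return the very
  same records, and arrows keep their underlying morphism of polynomials. The shape of the argument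
  comes from typing. \<open>kap E C f g\<close> has the expected ends only if
  \<open>t \<cdot> f = s \<cdot> g\<close>, and \<open>lift\<close> behaves only over matching base
  points, so the direction half of a law cannot be evaluated before its position half is known.
  Hence \<open>t \<cdot> i = id\<close> precedes the left unit law,
  \<open>t \<cdot> k = t \<cdot> \<pi>\<^sub>2\<close> precedes associativity, and preservation of
  targets precedes preservation of composites; the map \<open>t\<close> itself is well typed only
  once the base part of \<open>\<delta>\<^sub>1\<close> is the identity. The other obstacle is base
  change of an exponentiable morphism: the sections over a pulled back fibre are cut out, by one
  more pullback, from the sections that \<open>p\<close> itself classifies.\<close>

lemma hom_iff: "f \<in> hom C a b \<longleftrightarrow> f \<in> Arr C \<and> Dom C f = a \<and> Cod C f = b"
  by (auto simp: hom_def)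

section \<open>Calculus of composites in a category\<close>

context category
begin

lemma comp_arr [simp]: "f \<in> Arr C \<Longrightarrow> g \<in> Arr C \<Longrightarrow> Dom C g = Cod C f \<Longrightarrow> g \<cdot> f \<in> Arr C"
  and dom_comp [simp]: "f \<in> Arr C \<Longrightarrow> g \<in> Arr C \<Longrightarrow> Dom C g = Cod C f \<Longrightarrow> Dom C (g \<cdot> f) = Dom C f"
  and cod_comp [simp]: "f \<in> Arr C \<Longrightarrow> g \<in> Arr C \<Longrightarrow> Dom C g = Cod C f \<Longrightarrow> Cod C (g \<cdot> f) = Cod C g"
  using Comp_in[of f "Dom C f" "Cod C f" g "Cod C g"] by (auto simp: hom_iff)

lemma comp_assoc [simp]:
  "f \<in> Arr C \<Longrightarrow> g \<in> Arr C \<Longrightarrow> h \<in> Arr C \<Longrightarrow> Dom C g = Cod C f \<Longrightarrow> Dom C h = Cod C g \<Longrightarrow>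
     (h \<cdot> g) \<cdot> f = h \<cdot> (g \<cdot> f)"
  using Comp_assoc[of f "Dom C f" "Cod C f" g "Cod C g" h "Cod C h"] by (auto simp: hom_iff)

lemma dom_obj [simp]: "f \<in> Arr C \<Longrightarrow> Dom C f \<in> Obj C"
  and cod_obj [simp]: "f \<in> Arr C \<Longrightarrow> Cod C f \<in> Obj C"
  by (rule Dom_in Cod_in, assumption)+

lemma ident_arr [simp]: "a \<in> Obj C \<Longrightarrow> Ident C a \<in> Arr C"
  and dom_ident [simp]: "a \<in> Obj C \<Longrightarrow> Dom C (Ident C a) = a"
  and cod_ident [simp]: "a \<in> Obj C \<Longrightarrow> Cod C (Ident C a) = a"
  using Ident_in[of a] by (auto simp: hom_iff)

lemma comp_ident [simp]: "f \<in> Arr C \<Longrightarrow> Dom C f = a \<Longrightarrow> f \<cdot> Ident C a = f"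
  and ident_comp [simp]: "f \<in> Arr C \<Longrightarrow> Cod C f = a \<Longrightarrow> Ident C a \<cdot> f = f"
  using Comp_Ident[of f a "Cod C f"] Ident_Comp[of f "Dom C f" a] by (auto simp: hom_iff)

text \<open>Composites are normalised to the right, so a rule \<open>g \<cdot> f = k\<close> no
  longer matches once a further arrow \<open>h\<close> stands behind \<open>f\<close>. This gives
  the form of the rule that still matches.\<close>

lemma comp_reassoc:
  assumes "g \<cdot> f = k" "f \<in> Arr C" "g \<in> Arr C" "Dom C g = Cod C f" "h \<in> Arr C" "Cod C h = Dom C f"
  shows "g \<cdot> f \<cdot> h = k \<cdot> h"
  using assms comp_assoc[of h f g] by simp

end

subsection \<open>Adjunctions and universal arrows\<close>

text \<open>The hom-set bijection, recovered from unit and counit: naturality of \<epsilon> and the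
  first triangle identity show that the transpose solves the equation, naturality of \<eta> and the
  second one show that it is the only solution.\<close>

lemma adjunction_transpose:
  assumes adj: "adjunction C D F G \<eta> \<epsilon>"
    and a: "a \<in> Obj C" and b: "b \<in> Obj D" and h: "h \<in> hom D (fobj F a) b"
  shows "farr G h \<cdot>\<^bsub>C\<^esub> \<eta> a \<in> hom C a (fobj G b)"
    and "\<epsilon> b \<cdot>\<^bsub>D\<^esub> farr F (farr G h \<cdot>\<^bsub>C\<^esub> \<eta> a) = h"
    and "k \<in> hom C a (fobj G b) \<Longrightarrow> \<epsilon> b \<cdot>\<^bsub>D\<^esub> farr F k = h \<Longrightarrow> k = farr G h \<cdot>\<^bsub>C\<^esub> \<eta> a"
proof -
  interpret C: category C using adj by (simp add: adjunction_def is_functor_def)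
  interpret D: category D using adj by (simp add: adjunction_def is_functor_def)
  note adj' = adj[unfolded adjunction_def is_functor_def hom_iff]
  have F [simp]: "farr F f \<in> Arr D" "Dom D (farr F f) = fobj F (Dom C f)"
    "Cod D (farr F f) = fobj F (Cod C f)" if "f \<in> Arr C" for f
    using adj' that by blast+
  have Fobj [simp]: "fobj F a \<in> Obj D" if "a \<in> Obj C" for a
    using adj' that by blast
  have G [simp]: "farr G f \<in> Arr C" "Dom C (farr G f) = fobj G (Dom D f)"
    "Cod C (farr G f) = fobj G (Cod D f)" if "f \<in> Arr D" for f
    using adj' that by blast+
  have Gobj [simp]: "fobj G a \<in> Obj C" if "a \<in> Obj D" for a
    using adj' that by blast
  have Fcomp: "farr F (g \<cdot>\<^bsub>C\<^esub> f) = farr F g \<cdot>\<^bsub>D\<^esub> farr F f"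
    if "f \<in> Arr C" "g \<in> Arr C" "Dom C g = Cod C f" for f g
    using adj' that by blast
  have Gcomp: "farr G (g \<cdot>\<^bsub>D\<^esub> f) = farr G g \<cdot>\<^bsub>C\<^esub> farr G f"
    if "f \<in> Arr D" "g \<in> Arr D" "Dom D g = Cod D f" for f g
    using adj' that by blast
  have eta [simp]: "\<eta> a \<in> Arr C" "Dom C (\<eta> a) = a" "Cod C (\<eta> a) = fobj G (fobj F a)"
    if "a \<in> Obj C" for a
    using adj' that by blast+
  have eps [simp]: "\<epsilon> a \<in> Arr D" "Dom D (\<epsilon> a) = fobj F (fobj G a)" "Cod D (\<epsilon> a) = a"
    if "a \<in> Obj D" for a
    using adj' that by blast+
  have eta_nat: "farr G (farr F f) \<cdot>\<^bsub>C\<^esub> \<eta> (Dom C f) = \<eta> (Cod C f) \<cdot>\<^bsub>C\<^esub> f" if "f \<in> Arr C" for f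
    using adj' that by blast
  have eps_nat: "g \<cdot>\<^bsub>D\<^esub> \<epsilon> (Dom D g) = \<epsilon> (Cod D g) \<cdot>\<^bsub>D\<^esub> farr F (farr G g)" if "g \<in> Arr D" for g
    using adj' that by blast
  have tri1: "\<epsilon> (fobj F a) \<cdot>\<^bsub>D\<^esub> farr F (\<eta> a) = Ident D (fobj F a)" if "a \<in> Obj C" for a
    using adj' that by blast
  have tri2: "farr G (\<epsilon> b) \<cdot>\<^bsub>C\<^esub> \<eta> (fobj G b) = Ident C (fobj G b)" if "b \<in> Obj D" for b
    using adj' that by blast
  have h' [simp]: "h \<in> Arr D" "Dom D h = fobj F a" "Cod D h = b"
    using h by (auto simp: hom_iff)
  note [simp] = a b
  show "farr G h \<cdot>\<^bsub>C\<^esub> \<eta> a \<in> hom C a (fobj G b)"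
    by (simp add: hom_iff)
  have "\<epsilon> b \<cdot>\<^bsub>D\<^esub> farr F (farr G h \<cdot>\<^bsub>C\<^esub> \<eta> a) = (\<epsilon> b \<cdot>\<^bsub>D\<^esub> farr F (farr G h)) \<cdot>\<^bsub>D\<^esub> farr F (\<eta> a)"
    by (simp add: Fcomp)
  also have "\<epsilon> b \<cdot>\<^bsub>D\<^esub> farr F (farr G h) = h \<cdot>\<^bsub>D\<^esub> \<epsilon> (fobj F a)"
    using eps_nat[of h] by simp
  finally show "\<epsilon> b \<cdot>\<^bsub>D\<^esub> farr F (farr G h \<cdot>\<^bsub>C\<^esub> \<eta> a) = h"
    by (simp add: tri1)
  assume k: "k \<in> hom C a (fobj G b)" and e: "\<epsilon> b \<cdot>\<^bsub>D\<^esub> farr F k = h"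
  have k' [simp]: "k \<in> Arr C" "Dom C k = a" "Cod C k = fobj G b"
    using k by (auto simp: hom_iff)
  have "k = (farr G (\<epsilon> b) \<cdot>\<^bsub>C\<^esub> \<eta> (fobj G b)) \<cdot>\<^bsub>C\<^esub> k"
    by (simp add: tri2)
  also have "\<dots> = farr G (\<epsilon> b) \<cdot>\<^bsub>C\<^esub> (farr G (farr F k) \<cdot>\<^bsub>C\<^esub> \<eta> a)"
    using eta_nat[of k] by simp
  also have "\<dots> = farr G (\<epsilon> b \<cdot>\<^bsub>D\<^esub> farr F k) \<cdot>\<^bsub>C\<^esub> \<eta> a"
    by (simp add: Gcomp)
  finally show "k = farr G h \<cdot>\<^bsub>C\<^esub> \<eta> a"
    by (simp add: e)
qed

text \<open>Exponentiability asks for a whole adjunction, whereas constructions of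
  \<open>\<Pi>\<close> produce one universal arrow at a time. The chosen arrows assemble into a
  right adjoint because functoriality, naturality of the unit and the triangle identity in
  \<open>C\<close> are all equations between maps into some \<open>g b\<close>, which
  \<open>uniq\<close> lets one test after applying \<open>F\<close> and composing with
  \<open>e b\<close>.\<close>

lemma adjunction_from_universal_arrows:
  fixes C :: "('o, 'm) cat" and D :: "('p, 'n) cat"
  assumes F: "is_functor C D F"
    and univ: "\<And>b. b \<in> Obj D \<Longrightarrow> \<exists>g e. g \<in> Obj C \<and> e \<in> hom D (fobj F g) b \<and>
      (\<forall>a\<in>Obj C. \<forall>h\<in>hom D (fobj F a) b. \<exists>!k. k \<in> hom C a g \<and> e \<cdot>\<^bsub>D\<^esub> farr F k = h)"
  shows "\<exists>G \<eta> \<epsilon>. adjunction C D F G \<eta> \<epsilon>"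
proof -
  interpret C: category C using F by (simp add: is_functor_def)
  interpret D: category D using F by (simp add: is_functor_def)
  note F' = F[unfolded is_functor_def hom_iff]
  have F1 [simp]: "farr F f \<in> Arr D" "Dom D (farr F f) = fobj F (Dom C f)"
    "Cod D (farr F f) = fobj F (Cod C f)" if "f \<in> Arr C" for f
    using F' that by blast+
  have Fobj [simp]: "fobj F a \<in> Obj D" if "a \<in> Obj C" for a
    using F' that by blast
  have Fcomp: "farr F (g \<cdot>\<^bsub>C\<^esub> f) = farr F g \<cdot>\<^bsub>D\<^esub> farr F f"
    if "f \<in> Arr C" "g \<in> Arr C" "Dom C g = Cod C f" for f g
    using F' that by blast
  have Fid: "farr F (Ident C a) = Ident D (fobj F a)" if "a \<in> Obj C" for a
    using F' that by blast
  from univ obtain g e where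
    ge: "\<And>b. b \<in> Obj D \<Longrightarrow> g b \<in> Obj C \<and> e b \<in> hom D (fobj F (g b)) b \<and>
      (\<forall>a\<in>Obj C. \<forall>h\<in>hom D (fobj F a) b. \<exists>!k. k \<in> hom C a (g b) \<and> e b \<cdot>\<^bsub>D\<^esub> farr F k = h)"
    by metis
  have g [simp]: "g b \<in> Obj C" if "b \<in> Obj D" for b
    using ge that by blast
  have e [simp]: "e b \<in> Arr D" "Dom D (e b) = fobj F (g b)" "Cod D (e b) = b" if "b \<in> Obj D" for b
    using ge that unfolding hom_iff by blast+
  define tr where "tr b h = (\<lambda>a. THE k. k \<in> hom C a (g b) \<and> e b \<cdot>\<^bsub>D\<^esub> farr F k = h)" for b h
  have tr: "tr b h a \<in> hom C a (g b) \<and> e b \<cdot>\<^bsub>D\<^esub> farr F (tr b h a) = h"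
    if "a \<in> Obj C" "b \<in> Obj D" "h \<in> Arr D" "Dom D h = fobj F a" "Cod D h = b" for a b h
  proof -
    have "h \<in> hom D (fobj F a) b" using that by (simp add: hom_iff)
    then have "\<exists>!k. k \<in> hom C a (g b) \<and> e b \<cdot>\<^bsub>D\<^esub> farr F k = h"
      using ge that by blast
    from theI'[OF this] show ?thesis unfolding tr_def .
  qed
  have uniq: "k = k'" if "k \<in> Arr C" "k' \<in> Arr C" "Dom C k = Dom C k'" "Cod C k = g b" "Cod C k' = g b"
    "e b \<cdot>\<^bsub>D\<^esub> farr F k = e b \<cdot>\<^bsub>D\<^esub> farr F k'" "b \<in> Obj D" for k k' b
  proof -
    have "e b \<cdot>\<^bsub>D\<^esub> farr F k' \<in> hom D (fobj F (Dom C k)) b"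
      using that by (simp add: hom_iff)
    then have "\<exists>!l. l \<in> hom C (Dom C k) (g b) \<and> e b \<cdot>\<^bsub>D\<^esub> farr F l = e b \<cdot>\<^bsub>D\<^esub> farr F k'"
      using ge that by simp
    moreover have "k \<in> hom C (Dom C k) (g b)" "k' \<in> hom C (Dom C k) (g b)"
      using that by (auto simp: hom_iff)
    ultimately show ?thesis using that(6) by metis
  qed
  \<comment> \<open>On arrows the adjoint is the transpose of \<open>m\<close> after the counit, and
    the unit is the transpose of the identity. Each is characterised by a single equation,
    \<open>eGa\<close> and \<open>eeta\<close>.\<close>
  define Ga where "Ga m = tr (Cod D m) (m \<cdot>\<^bsub>D\<^esub> e (Dom D m)) (g (Dom D m))" for m
  define \<eta> where "\<eta> a = tr (fobj F a) (Ident D (fobj F a)) a" for a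
  define G where "G = \<lparr>fobj = g, farr = Ga\<rparr>"
  have Ga [simp]: "Ga m \<in> Arr C" "Dom C (Ga m) = g (Dom D m)" "Cod C (Ga m) = g (Cod D m)"
    and eGa: "e (Cod D m) \<cdot>\<^bsub>D\<^esub> farr F (Ga m) = m \<cdot>\<^bsub>D\<^esub> e (Dom D m)" if "m \<in> Arr D" for m
    using tr[of "g (Dom D m)" "Cod D m" "m \<cdot>\<^bsub>D\<^esub> e (Dom D m)"] that
    by (auto simp: Ga_def hom_iff)
  have eta [simp]: "\<eta> a \<in> Arr C" "Dom C (\<eta> a) = a" "Cod C (\<eta> a) = g (fobj F a)"
    and eeta: "e (fobj F a) \<cdot>\<^bsub>D\<^esub> farr F (\<eta> a) = Ident D (fobj F a)" if "a \<in> Obj C" for a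
    using tr[of a "fobj F a" "Ident D (fobj F a)"] that
    by (auto simp: \<eta>_def hom_iff)
  have eGa': "e (Cod D m) \<cdot>\<^bsub>D\<^esub> farr F (Ga m) \<cdot>\<^bsub>D\<^esub> h = m \<cdot>\<^bsub>D\<^esub> e (Dom D m) \<cdot>\<^bsub>D\<^esub> h"
    if "m \<in> Arr D" "h \<in> Arr D" "Cod D h = fobj F (g (Dom D m))" for m h
    using that eGa[of m] D.comp_assoc[of h "farr F (Ga m)" "e (Cod D m)"]
      D.comp_assoc[of h "e (Dom D m)" m] by simp
  have eeta': "e (fobj F a) \<cdot>\<^bsub>D\<^esub> farr F (\<eta> a) \<cdot>\<^bsub>D\<^esub> h = h"
    if "a \<in> Obj C" "h \<in> Arr D" "Cod D h = fobj F a" for a h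
    using that eeta[of a] D.comp_assoc[of h "farr F (\<eta> a)" "e (fobj F a)"] by simp
  have G: "is_functor D C G"
    unfolding is_functor_def G_def
  proof (intro conjI ballI impI, simp_all add: C.category_axioms D.category_axioms hom_iff)
    fix a assume "a \<in> Obj D"
    then show "Ga (Ident D a) = Ident C (g a)"
      by (intro uniq[of _ _ a]) (use eGa[of "Ident D a"] in \<open>simp_all add: Fid\<close>)
  next
    fix m m' assume "m \<in> Arr D" "m' \<in> Arr D" "Dom D m' = Cod D m"
    then show "Ga (m' \<cdot>\<^bsub>D\<^esub> m) = Ga m' \<cdot>\<^bsub>C\<^esub> Ga m"
      by (intro uniq[of _ _ "Cod D m'"])
        (use eGa[of "m' \<cdot>\<^bsub>D\<^esub> m"] eGa[of m] in \<open>simp_all add: Fcomp eGa'\<close>)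
  qed
  have "adjunction C D F G \<eta> e"
    unfolding adjunction_def
  proof (intro conjI ballI F G, simp_all add: G_def hom_iff eGa eeta)
    fix f assume "f \<in> Arr C"
    then show "Ga (farr F f) \<cdot>\<^bsub>C\<^esub> \<eta> (Dom C f) = \<eta> (Cod C f) \<cdot>\<^bsub>C\<^esub> f"
      by (intro uniq[of _ _ "fobj F (Cod C f)"])
        (use eGa'[of "farr F f"] in \<open>simp_all add: Fcomp eeta eeta'\<close>)
  next
    fix b assume "b \<in> Obj D"
    then show "Ga (e b) \<cdot>\<^bsub>C\<^esub> \<eta> (g b) = Ident C (g b)"
      by (intro uniq[of _ _ b]) (use eGa'[of "e b"] in \<open>simp_all add: Fid Fcomp eeta\<close>)
  qed
  then show ?thesis by blast
qed

locale fin_category = category E for E :: "('o, 'a) cat" (structure) +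
  assumes fin_lim: "has_finite_limits E"
begin

subsection \<open>Limits\<close>

lemma terminal_exists: "\<exists>a. is_terminal E a"
proof -
  \<comment> \<open>The empty index category: every functor record is a diagram on it, so
    \<open>undefined\<close> serves, and a limit of it is a terminal object.\<close>
  define J :: "(nat, nat) cat" where
    "J = \<lparr>Obj = {}, Arr = {}, Dom = (\<lambda>x. x), Cod = (\<lambda>x. x), Ident = (\<lambda>x. x), Comp = (\<lambda>x y. x)\<rparr>"
  have "category J"
    by unfold_locales (auto simp: J_def hom_def)
  then have "is_functor J E undefined"
    using category_axioms by (auto simp: is_functor_def J_def)
  moreover have "finite (Obj J)" "finite (Arr J)"
    by (simp_all add: J_def)
  ultimately obtain a \<pi> where "is_limit J E undefined a \<pi>"
    using fin_lim unfolding has_finite_limits_def by blast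
  then have "is_terminal E a"
    unfolding is_limit_def is_terminal_def is_cone_def by (auto simp: J_def)
  then show ?thesis ..
qed

lemma is_terminal: "is_terminal E (terminal E)"
  unfolding terminal_def using terminal_exists by (rule someI_ex)

lemma terminal_obj [simp]: "terminal E \<in> Obj E"
  using is_terminal by (simp add: is_terminal_def)

lemma bang_unique: "b \<in> Obj E \<Longrightarrow> \<exists>!f. f \<in> hom E b (terminal E)"
  using is_terminal by (auto simp: is_terminal_def)

lemma bang_hom: "b \<in> Obj E \<Longrightarrow> bang E b \<in> hom E b (terminal E)"
  unfolding bang_def by (rule theI'[OF bang_unique])

lemma bang_arr [simp]: "b \<in> Obj E \<Longrightarrow> bang E b \<in> Arr E"
  and dom_bang [simp]: "b \<in> Obj E \<Longrightarrow> Dom E (bang E b) = b"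
  and cod_bang [simp]: "b \<in> Obj E \<Longrightarrow> Cod E (bang E b) = terminal E"
  using bang_hom by (auto simp: hom_iff)

lemma bang_eq: "f \<in> Arr E \<Longrightarrow> Cod E f = terminal E \<Longrightarrow> f = bang E (Dom E f)"
  using bang_unique[of "Dom E f"] bang_hom[of "Dom E f"] by (auto simp: hom_iff)

lemma bang_comp [simp]: "h \<in> Arr E \<Longrightarrow> Cod E h = b \<Longrightarrow> bang E b \<cdot> h = bang E (Dom E h)"
  using bang_eq[of "bang E b \<cdot> h"] by auto

lemma pullback_exists:
  assumes f: "f \<in> Arr E" and g: "g \<in> Arr E" and fg: "Cod E f = Cod E g"
  shows "\<exists>h k. is_pullback E f g h k"
proof -
  \<comment> \<open>The cospan. The numbers 0, 1, 2 are the objects and their own identities, 3 goes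
    from 0 to 2 and 4 from 1 to 2. In a composite \<open>x\<close> after \<open>y\<close> at most
    one factor is not an identity, which explains the case distinction in
    \<open>Comp\<close>.\<close>
  define J :: "(nat, nat) cat" where
    "J = \<lparr>Obj = {0,1,2}, Arr = {0,1,2,3,4},
       Dom = (\<lambda>x. if x = 3 then 0 else if x = 4 then 1 else x),
       Cod = (\<lambda>x. if x = 3 then 2 else if x = 4 then 2 else x), Ident = (\<lambda>x. x),
       Comp = (\<lambda>x y. if x < 3 then y else x)\<rparr>"
  define D :: "(nat, nat, 'o, 'a) func" where
    "D = \<lparr>fobj = (\<lambda>x. if x = 0 then Dom E f else if x = 1 then Dom E g else Cod E f),
       farr = (\<lambda>x. if x = 0 then Ident E (Dom E f) else if x = 1 then Ident E (Dom E g)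
          else if x = 2 then Ident E (Cod E f) else if x = 3 then f else g)\<rparr>"
  have J: "category J"
    by unfold_locales (auto simp: J_def hom_def split: if_splits)
  have D: "is_functor J E D"
    unfolding is_functor_def using J category_axioms f g fg
    by (simp add: J_def D_def hom_iff)
  have fin: "finite (Obj J)" "finite (Arr J)"
    by (simp_all add: J_def)
  obtain a \<pi> where lim: "is_limit J E D a \<pi>"
    using fin_lim D fin unfolding has_finite_limits_def by blast
  \<comment> \<open>The leg to the object 2 is forced to be \<open>f \<cdot> x\<close>, so a
    commuting pair \<open>x\<close>, \<open>y\<close> is the same as a cone.\<close>
  define cone where "cone c x y = (\<lambda>j::nat. if j = 0 then x else if j = 1 then y else f \<cdot> x)"
    for c :: 'o and x y :: 'a
  have cone: "is_cone J E D c (cone c x y)"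
    if "x \<in> hom E c (Dom E f)" "y \<in> hom E c (Dom E g)" "f \<cdot> x = g \<cdot> y" for c x y
    unfolding is_cone_def using that f g fg
    by (auto simp: J_def D_def hom_iff cone_def)
  have pi: "is_cone J E D a \<pi>"
    using lim by (simp add: is_limit_def)
  have a: "a \<in> Obj E"
    using pi by (auto simp: is_cone_def)
  have pi0: "\<pi> 0 \<in> hom E a (Dom E f)" and pi1: "\<pi> 1 \<in> hom E a (Dom E g)"
    and pi2: "f \<cdot> \<pi> 0 = \<pi> 2" "g \<cdot> \<pi> 1 = \<pi> 2"
    using pi unfolding is_cone_def J_def D_def by auto
  have "is_pullback E f g (\<pi> 0) (\<pi> 1)"
    unfolding is_pullback_def
  proof (intro conjI allI impI)
    show "\<pi> 0 \<in> hom E (Dom E (\<pi> 0)) (Dom E f)" "\<pi> 1 \<in> hom E (Dom E (\<pi> 0)) (Dom E g)"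
      "f \<cdot> \<pi> 0 = g \<cdot> \<pi> 1"
      using pi0 pi1 pi2 by (auto simp: hom_iff)
    fix c x y
    assume xy: "x \<in> hom E c (Dom E f) \<and> y \<in> hom E c (Dom E g) \<and> f \<cdot> x = g \<cdot> y"
    then have "\<exists>!u. u \<in> hom E c a \<and> (\<forall>j\<in>Obj J. \<pi> j \<cdot> u = cone c x y j)"
      using lim cone[of x c y] unfolding is_limit_def by blast
    moreover have "(\<forall>j\<in>Obj J. \<pi> j \<cdot> u = cone c x y j) \<longleftrightarrow> \<pi> 0 \<cdot> u = x \<and> \<pi> 1 \<cdot> u = y"
      if "u \<in> hom E c a" for u
      using pi0 pi1 pi2(1)[symmetric] that f by (auto simp: J_def cone_def hom_iff)
    moreover have "Dom E (\<pi> 0) = a"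
      using pi0 by (simp add: hom_iff)
    ultimately show "\<exists>!u. u \<in> hom E c (Dom E (\<pi> 0)) \<and> \<pi> 0 \<cdot> u = x \<and> \<pi> 1 \<cdot> u = y"
      by (metis (no_types, lifting))
  qed
  then show ?thesis by blast
qed

context
  fixes f g :: 'a
  assumes fg [simp]: "f \<in> Arr E" "g \<in> Arr E" "Cod E f = Cod E g"
begin

lemma is_pullback: "is_pullback E f g (pb1 E f g) (pb2 E f g)"
proof -
  have "\<exists>p. case p of (h, k) \<Rightarrow> is_pullback E f g h k"
    using pullback_exists[OF fg] by auto
  then have "case pullback E f g of (h, k) \<Rightarrow> is_pullback E f g h k"
    unfolding pullback_def by (rule someI_ex)
  then show ?thesis
    by (simp add: pb1_def pb2_def split: prod.splits)
qed

text \<open>\<open>pb_square\<close> is oriented towards the first projection, which fixes a normal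
  form for the common base of the two components.\<close>

lemma pb1_arr [simp]: "pb1 E f g \<in> Arr E"
  and dom_pb1 [simp]: "Dom E (pb1 E f g) = pb_obj E f g"
  and cod_pb1 [simp]: "Cod E (pb1 E f g) = Dom E f"
  and pb2_arr [simp]: "pb2 E f g \<in> Arr E"
  and dom_pb2 [simp]: "Dom E (pb2 E f g) = pb_obj E f g"
  and cod_pb2 [simp]: "Cod E (pb2 E f g) = Dom E g"
  and pb_square [simp]: "g \<cdot> pb2 E f g = f \<cdot> pb1 E f g"
  using is_pullback by (auto simp: is_pullback_def hom_iff pb_obj_def)

lemma pb_obj_obj [simp]: "pb_obj E f g \<in> Obj E"
  using dom_obj[OF pb1_arr] by simp

lemma pb_square' [simp]:
  "h \<in> Arr E \<Longrightarrow> Cod E h = pb_obj E f g \<Longrightarrow> g \<cdot> pb2 E f g \<cdot> h = f \<cdot> pb1 E f g \<cdot> h"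
  using comp_assoc[of h "pb2 E f g" g] comp_assoc[of h "pb1 E f g" f] by simp

lemma pb_univ:
  assumes "x \<in> Arr E" "y \<in> Arr E" "Cod E x = Dom E f" "Cod E y = Dom E g" "Dom E y = Dom E x"
    "f \<cdot> x = g \<cdot> y"
  shows "\<exists>!u. u \<in> hom E (Dom E x) (pb_obj E f g) \<and> pb1 E f g \<cdot> u = x \<and> pb2 E f g \<cdot> u = y"
proof -
  have "x \<in> hom E (Dom E x) (Dom E f)" "y \<in> hom E (Dom E x) (Dom E g)"
    using assms by (auto simp: hom_iff)
  then show ?thesis
    using is_pullback assms(6) unfolding is_pullback_def pb_obj_def by blast
qed

lemma pb_pair_hom:
  assumes "x \<in> Arr E" "y \<in> Arr E" "Cod E x = Dom E f" "Cod E y = Dom E g" "Dom E y = Dom E x"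
    "f \<cdot> x = g \<cdot> y"
  shows pb_pair_arr [simp]: "pb_pair E f g x y \<in> Arr E"
    and dom_pb_pair [simp]: "Dom E (pb_pair E f g x y) = Dom E x"
    and cod_pb_pair [simp]: "Cod E (pb_pair E f g x y) = pb_obj E f g"
    and pb1_pair [simp]: "pb1 E f g \<cdot> pb_pair E f g x y = x"
    and pb2_pair [simp]: "pb2 E f g \<cdot> pb_pair E f g x y = y"
proof -
  from theI'[OF pb_univ[OF assms]] show "pb_pair E f g x y \<in> Arr E"
    "Dom E (pb_pair E f g x y) = Dom E x" "Cod E (pb_pair E f g x y) = pb_obj E f g"
    "pb1 E f g \<cdot> pb_pair E f g x y = x" "pb2 E f g \<cdot> pb_pair E f g x y = y"
    unfolding pb_pair_def hom_iff by auto
qed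

lemma pb_ext:
  assumes "u \<in> Arr E" "v \<in> Arr E" "Cod E u = pb_obj E f g" "Cod E v = pb_obj E f g"
    "Dom E u = Dom E v" "pb1 E f g \<cdot> u = pb1 E f g \<cdot> v" "pb2 E f g \<cdot> u = pb2 E f g \<cdot> v"
  shows "u = v"
proof -
  have "\<exists>!w. w \<in> hom E (Dom E u) (pb_obj E f g) \<and> pb1 E f g \<cdot> w = pb1 E f g \<cdot> u \<and>
      pb2 E f g \<cdot> w = pb2 E f g \<cdot> u"
    using pb_univ[of "pb1 E f g \<cdot> u" "pb2 E f g \<cdot> u"] assms by simp
  moreover have "u \<in> hom E (Dom E u) (pb_obj E f g)" "v \<in> hom E (Dom E u) (pb_obj E f g)"
    using assms by (auto simp: hom_iff)
  ultimately show ?thesis using assms(6,7) by metis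
qed

lemma pb_pair_comp [simp]:
  assumes "x \<in> Arr E" "y \<in> Arr E" "Cod E x = Dom E f" "Cod E y = Dom E g" "Dom E y = Dom E x"
    "f \<cdot> x = g \<cdot> y" "h \<in> Arr E" "Cod E h = Dom E x"
  shows "pb_pair E f g x y \<cdot> h = pb_pair E f g (x \<cdot> h) (y \<cdot> h)"
proof -
  have 1: "f \<cdot> x \<cdot> h = g \<cdot> y \<cdot> h"
    using assms comp_assoc[of h x f] comp_assoc[of h y g] by simp
  show ?thesis
    by (rule pb_ext) (use assms 1 comp_assoc[of h "pb_pair E f g x y" "pb1 E f g"]
        comp_assoc[of h "pb_pair E f g x y" "pb2 E f g"] in simp_all)
qed

text \<open>The first component is a variable tied down by a premise, so that the rule still applies
  after the simplifier has rewritten \<open>pb1 E f g \<cdot> u\<close> to something else.\<close>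

lemma pb_pair_eta [simp]:
  assumes "u \<in> Arr E" "Cod E u = pb_obj E f g" "pb1 E f g \<cdot> u = x"
  shows "pb_pair E f g x (pb2 E f g \<cdot> u) = u"
  unfolding assms(3)[symmetric] by (rule pb_ext) (use assms(1,2) in simp_all)

lemma pb_pair_eta_id [simp]: "pb_pair E f g (pb1 E f g) (pb2 E f g) = Ident E (pb_obj E f g)"
  by (rule pb_ext) simp_all

end

text \<open>A product is a pullback over the terminal object, where the commutation condition is
  automatic.\<close>

lemma product_exists:
  assumes a: "a \<in> Obj E" and b: "b \<in> Obj E"
  shows "\<exists>h k. is_product E a b h k"
proof -
  have "is_pullback E (bang E a) (bang E b) (pb1 E (bang E a) (bang E b)) (pb2 E (bang E a) (bang E b))"
    using assms by (intro is_pullback) auto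
  then have "is_product E a b (pb1 E (bang E a) (bang E b)) (pb2 E (bang E a) (bang E b))"
    using assms unfolding is_product_def is_pullback_def by (auto simp: hom_iff)
  then show ?thesis by blast
qed

context
  fixes a b :: 'o
  assumes ab [simp]: "a \<in> Obj E" "b \<in> Obj E"
begin

lemma is_product: "is_product E a b (pr1 E a b) (pr2 E a b)"
proof -
  have "\<exists>p. case p of (h, k) \<Rightarrow> is_product E a b h k"
    using product_exists[OF ab] by auto
  then have "case product E a b of (h, k) \<Rightarrow> is_product E a b h k"
    unfolding product_def by (rule someI_ex)
  then show ?thesis
    by (simp add: pr1_def pr2_def split: prod.splits)
qed

lemma pr1_arr [simp]: "pr1 E a b \<in> Arr E"
  and cod_pr1 [simp]: "Cod E (pr1 E a b) = a"
  and pr2_arr [simp]: "pr2 E a b \<in> Arr E"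
  and dom_pr2 [simp]: "Dom E (pr2 E a b) = Dom E (pr1 E a b)"
  and cod_pr2 [simp]: "Cod E (pr2 E a b) = b"
  using is_product by (auto simp: is_product_def hom_iff)

lemma pr_univ:
  assumes "x \<in> Arr E" "y \<in> Arr E" "Cod E x = a" "Cod E y = b" "Dom E y = Dom E x"
  shows "\<exists>!u. u \<in> hom E (Dom E x) (Dom E (pr1 E a b)) \<and> pr1 E a b \<cdot> u = x \<and> pr2 E a b \<cdot> u = y"
proof -
  have "x \<in> hom E (Dom E x) a" "y \<in> hom E (Dom E x) b"
    using assms by (auto simp: hom_iff)
  then show ?thesis
    using is_product unfolding is_product_def by blast
qed

lemma pr_pair_hom:
  assumes "x \<in> Arr E" "y \<in> Arr E" "Cod E x = a" "Cod E y = b" "Dom E y = Dom E x"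
  shows pr_pair_arr [simp]: "pr_pair E a b x y \<in> Arr E"
    and dom_pr_pair [simp]: "Dom E (pr_pair E a b x y) = Dom E x"
    and cod_pr_pair [simp]: "Cod E (pr_pair E a b x y) = Dom E (pr1 E a b)"
    and pr1_pair [simp]: "pr1 E a b \<cdot> pr_pair E a b x y = x"
    and pr2_pair [simp]: "pr2 E a b \<cdot> pr_pair E a b x y = y"
proof -
  from theI'[OF pr_univ[OF assms]] show "pr_pair E a b x y \<in> Arr E"
    "Dom E (pr_pair E a b x y) = Dom E x" "Cod E (pr_pair E a b x y) = Dom E (pr1 E a b)"
    "pr1 E a b \<cdot> pr_pair E a b x y = x" "pr2 E a b \<cdot> pr_pair E a b x y = y"
    unfolding pr_pair_def hom_iff by auto
qed

lemma pr_ext: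
  assumes "u \<in> Arr E" "v \<in> Arr E" "Cod E u = Dom E (pr1 E a b)" "Cod E v = Dom E (pr1 E a b)"
    "Dom E u = Dom E v" "pr1 E a b \<cdot> u = pr1 E a b \<cdot> v" "pr2 E a b \<cdot> u = pr2 E a b \<cdot> v"
  shows "u = v"
proof -
  have "\<exists>!w. w \<in> hom E (Dom E u) (Dom E (pr1 E a b)) \<and> pr1 E a b \<cdot> w = pr1 E a b \<cdot> u \<and>
      pr2 E a b \<cdot> w = pr2 E a b \<cdot> u"
    using pr_univ[of "pr1 E a b \<cdot> u" "pr2 E a b \<cdot> u"] assms by simp
  moreover have "u \<in> hom E (Dom E u) (Dom E (pr1 E a b))" "v \<in> hom E (Dom E u) (Dom E (pr1 E a b))"
    using assms by (auto simp: hom_iff)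
  ultimately show ?thesis using assms(6,7) by metis
qed

end

section \<open>Slice categories and the pullback functor\<close>

lemma slice_hom_iff:
  "m \<in> hom (slice E A) x x' \<longleftrightarrow> (\<exists>h. m = (x, x', h) \<and> x \<in> Arr E \<and> Cod E x = A \<and> x' \<in> Arr E \<and>
     Cod E x' = A \<and> h \<in> hom E (Dom E x) (Dom E x') \<and> x' \<cdot> h = x)"
  by (auto simp: slice_def hom_iff)

lemma slice_category: "category (slice E A)"
proof (unfold_locales, unfold slice_hom_iff)
  fix m assume "m \<in> Arr (slice E A)"
  then show "Dom (slice E A) m \<in> Obj (slice E A)" "Cod (slice E A) m \<in> Obj (slice E A)"
    by (auto simp: slice_def)
next
  fix x assume "x \<in> Obj (slice E A)"
  then show "\<exists>h. Ident (slice E A) x = (x, x, h) \<and> x \<in> Arr E \<and> Cod E x = A \<and> x \<in> Arr E \<and>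
      Cod E x = A \<and> h \<in> hom E (Dom E x) (Dom E x) \<and> x \<cdot> h = x"
    by (simp add: slice_def hom_iff)
next
  fix x x' x'' m m'
  assume "\<exists>h. m = (x, x', h) \<and> x \<in> Arr E \<and> Cod E x = A \<and> x' \<in> Arr E \<and> Cod E x' = A \<and>
      h \<in> hom E (Dom E x) (Dom E x') \<and> x' \<cdot> h = x"
    and "\<exists>h. m' = (x', x'', h) \<and> x' \<in> Arr E \<and> Cod E x' = A \<and> x'' \<in> Arr E \<and> Cod E x'' = A \<and>
      h \<in> hom E (Dom E x') (Dom E x'') \<and> x'' \<cdot> h = x'"
  then obtain h h' where m: "m = (x, x', h)" "m' = (x', x'', h')"
    and h: "x \<in> Arr E" "Cod E x = A" "x' \<in> Arr E" "Cod E x' = A" "x'' \<in> Arr E" "Cod E x'' = A"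
      "h \<in> Arr E" "Dom E h = Dom E x" "Cod E h = Dom E x'" "x' \<cdot> h = x"
      "h' \<in> Arr E" "Dom E h' = Dom E x'" "Cod E h' = Dom E x''" "x'' \<cdot> h' = x'"
    unfolding hom_iff by blast
  have "x'' \<cdot> h' \<cdot> h = x"
    using comp_assoc[of h h' x''] h by simp
  then show "\<exists>h. m' \<cdot>\<^bsub>slice E A\<^esub> m = (x, x'', h) \<and> x \<in> Arr E \<and> Cod E x = A \<and>
      x'' \<in> Arr E \<and> Cod E x'' = A \<and> h \<in> hom E (Dom E x) (Dom E x'') \<and> x'' \<cdot> h = x"
    using h by (simp add: slice_def hom_iff m)
qed (elim exE conjE; simp add: slice_def hom_iff)+

lemma Delta_functor:
  assumes f [simp]: "f \<in> Arr E"
  shows "is_functor (slice E (Cod E f)) (slice E (Dom E f)) (Delta E f)"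
  unfolding is_functor_def
proof (intro conjI ballI impI slice_category)
  fix x assume "x \<in> Obj (slice E (Cod E f))"
  then show "fobj (Delta E f) x \<in> Obj (slice E (Dom E f))"
    "farr (Delta E f) (Ident (slice E (Cod E f)) x) = Ident (slice E (Dom E f)) (fobj (Delta E f) x)"
    by (auto simp: slice_def Delta_def)
next
  fix m assume "m \<in> Arr (slice E (Cod E f))"
  then obtain x x' h where m: "m = (x, x', h)" and
    x [simp]: "x \<in> Arr E" "Cod E x = Cod E f" "x' \<in> Arr E" "Cod E x' = Cod E f"
      "h \<in> Arr E" "Dom E h = Dom E x" "Cod E h = Dom E x'" "x' \<cdot> h = x"
    by (cases m) (simp add: slice_def hom_iff)
  have [simp]: "x' \<cdot> h \<cdot> pb1 E x f = x \<cdot> pb1 E x f"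
    by (rule comp_reassoc) simp_all
  show "farr (Delta E f) m \<in> hom (slice E (Dom E f))
      (fobj (Delta E f) (Dom (slice E (Cod E f)) m)) (fobj (Delta E f) (Cod (slice E (Cod E f)) m))"
    by (auto simp: slice_def hom_iff Delta_def m)
  fix m' assume "m' \<in> Arr (slice E (Cod E f))"
    and "Dom (slice E (Cod E f)) m' = Cod (slice E (Cod E f)) m"
  then obtain x'' h' where m': "m' = (x', x'', h')" and
    x' [simp]: "x'' \<in> Arr E" "Cod E x'' = Cod E f"
      "h' \<in> Arr E" "Dom E h' = Dom E x'" "Cod E h' = Dom E x''" "x'' \<cdot> h' = x'"
    by (cases m') (simp add: slice_def hom_iff m)
  have [simp]: "x'' \<cdot> h' \<cdot> pb1 E x' f = x' \<cdot> pb1 E x' f"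
    by (rule comp_reassoc) simp_all
  show "farr (Delta E f) (m' \<cdot>\<^bsub>slice E (Cod E f)\<^esub> m) =
      farr (Delta E f) m' \<cdot>\<^bsub>slice E (Dom E f)\<^esub> farr (Delta E f) m"
    by (simp add: slice_def Delta_def m m')
qed

text \<open>The working form of exponentiability, free of slice triples: \<open>g\<close> is
  \<open>\<Pi>\<^sub>p y\<close>, \<open>e\<close> is the counit at \<open>y\<close>, and
  \<open>k\<close> is the transpose of \<open>h\<close>.\<close>

definition is_Pi :: "'a \<Rightarrow> 'a \<Rightarrow> 'a \<Rightarrow> 'a \<Rightarrow> bool" where
  "is_Pi p y g e \<longleftrightarrow> g \<in> Arr E \<and> Cod E g = Cod E p \<and> e \<in> hom E (pb_obj E g p) (Dom E y) \<and>
     y \<cdot> e = pb2 E g p \<and>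
     (\<forall>x h. x \<in> Arr E \<and> Cod E x = Cod E p \<and> h \<in> hom E (pb_obj E x p) (Dom E y) \<and> y \<cdot> h = pb2 E x p \<longrightarrow>
        (\<exists>!k. k \<in> hom E (Dom E x) (Dom E g) \<and> g \<cdot> k = x \<and>
           e \<cdot> pb_pair E g p (k \<cdot> pb1 E x p) (pb2 E x p) = h))"

subsection \<open>Exponentiable morphisms\<close>

lemma is_Pi_arr:
  assumes "is_Pi p y g e"
  shows "g \<in> Arr E" "Cod E g = Cod E p" "e \<in> Arr E" "Dom E e = pb_obj E g p" "Cod E e = Dom E y"
    "y \<cdot> e = pb2 E g p"
  using assms by (auto simp: is_Pi_def hom_iff)

lemma is_Pi_app:
  assumes "is_Pi p y g e" "y \<in> Arr E" "p \<in> Arr E" "Cod E y = Dom E p"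
    "z \<in> Arr E" "Cod E z = pb_obj E g p"
  shows "y \<cdot> e \<cdot> z = pb2 E g p \<cdot> z"
  by (rule comp_reassoc) (use assms is_Pi_arr[OF assms(1)] in auto)

text \<open>Among the generalized elements is the generic one, given by the two projections of the
  pullback of \<open>g \<cdot> u\<close> along \<open>p\<close>. Agreement there says that
  \<open>u\<close> and \<open>v\<close> are transposes of the same map.\<close>

lemma is_Pi_ext:
  assumes pi: "is_Pi p y g e" and [simp]: "p \<in> Arr E" "y \<in> Arr E" "Cod E y = Dom E p"
    and u [simp]: "u \<in> Arr E" "v \<in> Arr E" "Cod E u = Dom E g" "Cod E v = Dom E g" "Dom E v = Dom E u"
    and gu: "g \<cdot> v = g \<cdot> u"
    and app: "\<And>h b. \<lbrakk>h \<in> Arr E; b \<in> Arr E; Cod E h = Dom E u; Cod E b = Dom E p; Dom E b = Dom E h;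
       g \<cdot> u \<cdot> h = p \<cdot> b; g \<cdot> v \<cdot> h = p \<cdot> b\<rbrakk> \<Longrightarrow>
       e \<cdot> pb_pair E g p (u \<cdot> h) b = e \<cdot> pb_pair E g p (v \<cdot> h) b"
  shows "u = v"
proof -
  note [simp] = is_Pi_arr[OF pi] is_Pi_app[OF pi]
  let ?x = "g \<cdot> u"
  have 1: "g \<cdot> v \<cdot> pb1 E ?x p = g \<cdot> u \<cdot> pb1 E ?x p"
    using comp_reassoc[OF gu, of "pb1 E ?x p"] by simp
  have 2: "p \<cdot> pb2 E ?x p = g \<cdot> u \<cdot> pb1 E ?x p"
    by simp
  have eq: "e \<cdot> pb_pair E g p (u \<cdot> pb1 E ?x p) (pb2 E ?x p) = e \<cdot> pb_pair E g p (v \<cdot> pb1 E ?x p) (pb2 E ?x p)"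
    by (rule app) (simp_all add: 1 2)
  have "\<exists>!k. k \<in> hom E (Dom E ?x) (Dom E g) \<and> g \<cdot> k = ?x \<and>
      e \<cdot> pb_pair E g p (k \<cdot> pb1 E ?x p) (pb2 E ?x p) = e \<cdot> pb_pair E g p (u \<cdot> pb1 E ?x p) (pb2 E ?x p)"
  proof -
    have "?x \<in> Arr E" "Cod E ?x = Cod E p"
      "e \<cdot> pb_pair E g p (u \<cdot> pb1 E ?x p) (pb2 E ?x p) \<in> hom E (pb_obj E ?x p) (Dom E y)"
      "y \<cdot> e \<cdot> pb_pair E g p (u \<cdot> pb1 E ?x p) (pb2 E ?x p) = pb2 E ?x p"
      by (simp_all add: hom_iff)
    with pi show ?thesis unfolding is_Pi_def by blast
  qed
  moreover have "u \<in> hom E (Dom E ?x) (Dom E g)" "v \<in> hom E (Dom E ?x) (Dom E g)"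
    by (simp_all add: hom_iff)
  ultimately show ?thesis
    using gu eq by metis
qed

text \<open>The transpose equation speaks only of the generic element; composing with
  \<open>pb_pair E x p z b\<close> carries it to an arbitrary element \<open>(z, b)\<close>.\<close>

lemma Pi_app_comp:
  assumes [simp]: "p \<in> Arr E" "g \<in> Arr E" "x \<in> Arr E" "h \<in> Arr E" "e \<in> Arr E" "k \<in> Arr E"
      "Cod E g = Cod E p" "Cod E x = Cod E p" "Dom E e = pb_obj E g p"
      "Dom E k = Dom E x" "Cod E k = Dom E g" "g \<cdot> k = x"
    and eq: "e \<cdot> pb_pair E g p (k \<cdot> pb1 E x p) (pb2 E x p) = h"
    and z [simp]: "z \<in> Arr E" "b \<in> Arr E" "Cod E z = Dom E x" "Cod E b = Dom E p" "Dom E b = Dom E z"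
      "x \<cdot> z = p \<cdot> b"
  shows "e \<cdot> pb_pair E g p (k \<cdot> z) b = h \<cdot> pb_pair E x p z b"
proof -
  have [simp]: "g \<cdot> k \<cdot> pb1 E x p = x \<cdot> pb1 E x p" "g \<cdot> k \<cdot> z = p \<cdot> b"
    using comp_reassoc[of g k x "pb1 E x p"] comp_reassoc[of g k x z] by simp_all
  show ?thesis
    unfolding eq[symmetric] by simp
qed

lemma is_Pi_transpose:
  assumes pi: "is_Pi p y g e" and [simp]: "p \<in> Arr E" "y \<in> Arr E" "Cod E y = Dom E p"
    and x: "x \<in> Arr E" "Cod E x = Cod E p"
    and h: "h \<in> Arr E" "Dom E h = pb_obj E x p" "Cod E h = Dom E y" "y \<cdot> h = pb2 E x p"
  obtains k where "k \<in> Arr E" "Dom E k = Dom E x" "Cod E k = Dom E g" "g \<cdot> k = x"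
    "\<And>z b. \<lbrakk>z \<in> Arr E; b \<in> Arr E; Cod E z = Dom E x; Cod E b = Dom E p; Dom E b = Dom E z;
       x \<cdot> z = p \<cdot> b\<rbrakk> \<Longrightarrow> e \<cdot> pb_pair E g p (k \<cdot> z) b = h \<cdot> pb_pair E x p z b"
proof -
  have "\<exists>!k. k \<in> hom E (Dom E x) (Dom E g) \<and> g \<cdot> k = x \<and>
           e \<cdot> pb_pair E g p (k \<cdot> pb1 E x p) (pb2 E x p) = h"
    using pi x h unfolding is_Pi_def by (simp add: hom_iff)
  then obtain k where k: "k \<in> Arr E" "Dom E k = Dom E x" "Cod E k = Dom E g" "g \<cdot> k = x"
    "e \<cdot> pb_pair E g p (k \<cdot> pb1 E x p) (pb2 E x p) = h"
    unfolding hom_iff by blast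
  show thesis
    by (rule that[OF k(1-4)], rule Pi_app_comp) (use k x h is_Pi_arr[OF pi] in auto)
qed

text \<open>Uniqueness of transposes is asked for as extensionality on generalized elements. In this
  form it can be obtained for a composite or a base change by applying \<open>is_Pi_ext\<close> to
  the objects from which it is built.\<close>

lemma is_PiI:
  assumes [simp]: "p \<in> Arr E" "y \<in> Arr E" "Cod E y = Dom E p"
    and g [simp]: "g \<in> Arr E" "Cod E g = Cod E p"
    and e [simp]: "e \<in> Arr E" "Dom E e = pb_obj E g p" "Cod E e = Dom E y" "y \<cdot> e = pb2 E g p"
    and transpose: "\<And>x h. \<lbrakk>x \<in> Arr E; Cod E x = Cod E p; h \<in> Arr E; Dom E h = pb_obj E x p;
       Cod E h = Dom E y; y \<cdot> h = pb2 E x p\<rbrakk> \<Longrightarrow> \<exists>k. k \<in> Arr E \<and> Dom E k = Dom E x \<and>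
       Cod E k = Dom E g \<and> g \<cdot> k = x \<and> e \<cdot> pb_pair E g p (k \<cdot> pb1 E x p) (pb2 E x p) = h"
    and ext: "\<And>u v. \<lbrakk>u \<in> Arr E; v \<in> Arr E; Cod E u = Dom E g; Cod E v = Dom E g; Dom E v = Dom E u;
       g \<cdot> v = g \<cdot> u;
       \<And>h b. \<lbrakk>h \<in> Arr E; b \<in> Arr E; Cod E h = Dom E u; Cod E b = Dom E p; Dom E b = Dom E h;
         g \<cdot> u \<cdot> h = p \<cdot> b; g \<cdot> v \<cdot> h = p \<cdot> b\<rbrakk> \<Longrightarrow>
         e \<cdot> pb_pair E g p (u \<cdot> h) b = e \<cdot> pb_pair E g p (v \<cdot> h) b\<rbrakk> \<Longrightarrow> u = v"
  shows "is_Pi p y g e"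
  unfolding is_Pi_def
proof (intro conjI allI impI)
  fix x h
  assume "x \<in> Arr E \<and> Cod E x = Cod E p \<and> h \<in> hom E (pb_obj E x p) (Dom E y) \<and> y \<cdot> h = pb2 E x p"
  then have x [simp]: "x \<in> Arr E" "Cod E x = Cod E p"
    and h [simp]: "h \<in> Arr E" "Dom E h = pb_obj E x p" "Cod E h = Dom E y" "y \<cdot> h = pb2 E x p"
    by (auto simp: hom_iff)
  obtain k where k: "k \<in> Arr E" "Dom E k = Dom E x" "Cod E k = Dom E g" "g \<cdot> k = x"
      "e \<cdot> pb_pair E g p (k \<cdot> pb1 E x p) (pb2 E x p) = h"
    using transpose[OF x h] by blast
  show "\<exists>!k. k \<in> hom E (Dom E x) (Dom E g) \<and> g \<cdot> k = x \<and>
      e \<cdot> pb_pair E g p (k \<cdot> pb1 E x p) (pb2 E x p) = h"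
  proof (rule ex1I[of _ k], use k in \<open>simp add: hom_iff\<close>)
    fix l
    assume "l \<in> hom E (Dom E x) (Dom E g) \<and> g \<cdot> l = x \<and>
      e \<cdot> pb_pair E g p (l \<cdot> pb1 E x p) (pb2 E x p) = h"
    then have l: "l \<in> Arr E" "Dom E l = Dom E x" "Cod E l = Dom E g" "g \<cdot> l = x"
      "e \<cdot> pb_pair E g p (l \<cdot> pb1 E x p) (pb2 E x p) = h"
      by (auto simp: hom_iff)
    show "l = k"
    proof (rule ext)
      fix z b
      assume z: "z \<in> Arr E" "b \<in> Arr E" "Cod E z = Dom E l" "Cod E b = Dom E p" "Dom E b = Dom E z"
        "g \<cdot> l \<cdot> z = p \<cdot> b"
      then have "x \<cdot> z = p \<cdot> b"
        using comp_reassoc[OF l(4), of z] l by simp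
      with z l k show "e \<cdot> pb_pair E g p (l \<cdot> z) b = e \<cdot> pb_pair E g p (k \<cdot> z) b"
        using Pi_app_comp[of p g x h e l z b] Pi_app_comp[of p g x h e k z b] by simp
    qed (use k l in simp_all)
  qed
qed (simp_all add: hom_iff)

context
  fixes p G \<eta> \<epsilon>
  assumes p [simp]: "p \<in> Arr E" and pi: "has_Pi E p G \<eta> \<epsilon>"
begin

text \<open>Reads the transposition of the adjunction through the slice triples. The transpose is
  kept as an explicit formula because \<open>mk_pos\<close> is defined by an instance of it.\<close>

lemma has_Pi_transpose:
  assumes y [simp]: "y \<in> Arr E" "Cod E y = Dom E p"
  defines "g \<equiv> fobj G y" and "e \<equiv> slice_map (\<epsilon> y)"
  shows "g \<in> Arr E" "Cod E g = Cod E p"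
    and "e \<in> hom E (pb_obj E g p) (Dom E y)" "y \<cdot> e = pb2 E g p"
    and "\<And>x h k. \<lbrakk>x \<in> Arr E; Cod E x = Cod E p; h \<in> hom E (pb_obj E x p) (Dom E y); y \<cdot> h = pb2 E x p;
       k = slice_map (farr G (pb2 E x p, y, h)) \<cdot> slice_map (\<eta> x)\<rbrakk> \<Longrightarrow>
       k \<in> hom E (Dom E x) (Dom E g) \<and> g \<cdot> k = x \<and>
       e \<cdot> pb_pair E g p (k \<cdot> pb1 E x p) (pb2 E x p) = h \<and>
       (\<forall>l. l \<in> hom E (Dom E x) (Dom E g) \<and> g \<cdot> l = x \<and>
          e \<cdot> pb_pair E g p (l \<cdot> pb1 E x p) (pb2 E x p) = h \<longrightarrow> l = k)"
proof -
  let ?A = "slice E (Cod E p)" and ?B = "slice E (Dom E p)"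
  have adj: "adjunction ?A ?B (Delta E p) G \<eta> \<epsilon>"
    using pi by (simp add: has_Pi_def)
  note adj' = adj[unfolded adjunction_def is_functor_def]
  have yB: "y \<in> Obj ?B"
    by (simp add: slice_def)
  then have "g \<in> Obj ?A"
    using adj' unfolding g_def by blast
  then show g [simp]: "g \<in> Arr E" "Cod E g = Cod E p"
    by (auto simp: slice_def)
  have "\<epsilon> y \<in> hom ?B (fobj (Delta E p) (fobj G y)) y"
    using adj' yB by blast
  then have eps: "\<epsilon> y = (pb2 E g p, y, e)"
    and "e \<in> hom E (pb_obj E g p) (Dom E y) \<and> y \<cdot> e = pb2 E g p"
    by (auto simp: slice_hom_iff Delta_def g_def[symmetric] e_def slice_map_def)
  then show e: "e \<in> hom E (pb_obj E g p) (Dom E y)" "y \<cdot> e = pb2 E g p"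
    by auto
  fix x h k
  assume x [simp]: "x \<in> Arr E" "Cod E x = Cod E p"
    and h: "h \<in> hom E (pb_obj E x p) (Dom E y)" "y \<cdot> h = pb2 E x p"
    and k: "k = slice_map (farr G (pb2 E x p, y, h)) \<cdot> slice_map (\<eta> x)"
  have [simp]: "h \<in> Arr E" "Dom E h = pb_obj E x p" "Cod E h = Dom E y"
    using h by (auto simp: hom_iff)
  have xA: "x \<in> Obj ?A"
    by (simp add: slice_def)
  have H: "(pb2 E x p, y, h) \<in> hom ?B (fobj (Delta E p) x) y"
    using h by (simp add: slice_hom_iff Delta_def)
  note tr = adjunction_transpose[OF adj xA yB H]
  have "\<eta> x \<in> hom ?A x (fobj G (fobj (Delta E p) x))"
    using adj' xA by blast
  moreover have "farr G (pb2 E x p, y, h) \<in> hom ?A (fobj G (fobj (Delta E p) x)) g"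
  proof -
    have "farr G m \<in> hom ?A (fobj G (Dom ?B m)) (fobj G (Cod ?B m))" if "m \<in> Arr ?B" for m
      using adj' that by blast
    from this[of "(pb2 E x p, y, h)"] show ?thesis
      using H by (simp add: hom_iff g_def)
  qed
  ultimately have K: "farr G (pb2 E x p, y, h) \<cdot>\<^bsub>?A\<^esub> \<eta> x = (x, g, k)"
    unfolding slice_hom_iff by (auto simp: k slice_def slice_map_def)
  have e_iff: "e \<cdot> pb_pair E g p (l \<cdot> pb1 E x p) (pb2 E x p) = h \<longleftrightarrow>
      \<epsilon> y \<cdot>\<^bsub>?B\<^esub> farr (Delta E p) (x, g, l) = (pb2 E x p, y, h)" for l
    by (simp add: eps Delta_def slice_def)
  have l_iff: "l \<in> hom E (Dom E x) (Dom E g) \<and> g \<cdot> l = x \<longleftrightarrow> (x, g, l) \<in> hom ?A x g" for l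
    by (auto simp: slice_hom_iff)
  show "k \<in> hom E (Dom E x) (Dom E g) \<and> g \<cdot> k = x \<and>
       e \<cdot> pb_pair E g p (k \<cdot> pb1 E x p) (pb2 E x p) = h \<and>
       (\<forall>l. l \<in> hom E (Dom E x) (Dom E g) \<and> g \<cdot> l = x \<and>
          e \<cdot> pb_pair E g p (l \<cdot> pb1 E x p) (pb2 E x p) = h \<longrightarrow> l = k)"
    using tr(1,2) tr(3)[of "(x, g, _)"] unfolding K g_def[symmetric] e_iff
    by (metis l_iff Pair_inject)
qed

lemma has_Pi_is_Pi:
  assumes "y \<in> Arr E" "Cod E y = Dom E p"
  shows "is_Pi p y (fobj G y) (slice_map (\<epsilon> y))"
proof -
  note * = has_Pi_transpose[OF assms]
  show ?thesis
    unfolding is_Pi_def using *(1-4) *(5)[OF _ _ _ _ refl] by metis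
qed

end

lemma exponentiable_arr [simp]: "exponentiable E p \<Longrightarrow> p \<in> Arr E"
  by (simp add: exponentiable_def)

lemma exponentiable_has_Pi:
  assumes "exponentiable E p"
  shows "has_Pi E p (Pi_functor E p) (Pi_unit E p) (Pi_counit E p)"
proof -
  have "\<exists>d. case d of (G, \<eta>, \<epsilon>) \<Rightarrow> has_Pi E p G \<eta> \<epsilon>"
    using assms by (auto simp: exponentiable_def)
  then have "case Pi_data E p of (G, \<eta>, \<epsilon>) \<Rightarrow> has_Pi E p G \<eta> \<epsilon>"
    unfolding Pi_data_def by (rule someI_ex)
  then show ?thesis
    by (simp add: Pi_functor_def Pi_unit_def Pi_counit_def split: prod.splits)
qed

lemma exponentiable_is_Pi:
  assumes "exponentiable E p" "y \<in> Arr E" "Cod E y = Dom E p"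
  obtains g e where "is_Pi p y g e"
  using has_Pi_is_Pi[OF exponentiable_arr exponentiable_has_Pi] assms by blast

text \<open>Wrapped in slice triples, an \<open>is_Pi\<close> datum for \<open>y\<close> is a
  universal arrow from \<open>Delta E p\<close> to \<open>y\<close>, and universal arrows suffice
  for an adjunction.\<close>

lemma exponentiableI:
  assumes p [simp]: "p \<in> Arr E"
    and Pi: "\<And>y. y \<in> Arr E \<Longrightarrow> Cod E y = Dom E p \<Longrightarrow> \<exists>g e. is_Pi p y g e"
  shows "exponentiable E p"
  unfolding exponentiable_def has_Pi_def
proof (intro conjI p adjunction_from_universal_arrows Delta_functor)
  let ?A = "slice E (Cod E p)" and ?B = "slice E (Dom E p)"
  fix y assume "y \<in> Obj ?B"
  then have y [simp]: "y \<in> Arr E" "Cod E y = Dom E p"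
    by (auto simp: slice_def)
  obtain g e where pi: "is_Pi p y g e"
    using Pi[OF y] by blast
  show "\<exists>g e. g \<in> Obj ?A \<and> e \<in> hom ?B (fobj (Delta E p) g) y \<and>
      (\<forall>x\<in>Obj ?A. \<forall>h\<in>hom ?B (fobj (Delta E p) x) y.
         \<exists>!k. k \<in> hom ?A x g \<and> e \<cdot>\<^bsub>?B\<^esub> farr (Delta E p) k = h)"
  proof (intro exI[of _ g] exI[of _ "(pb2 E g p, y, e)"] conjI ballI)
    show "g \<in> Obj ?A"
      using is_Pi_arr[OF pi] by (simp add: slice_def)
    show "(pb2 E g p, y, e) \<in> hom ?B (fobj (Delta E p) g) y"
      unfolding slice_hom_iff using is_Pi_arr[OF pi] by (simp add: Delta_def hom_iff)
    fix x H assume "x \<in> Obj ?A" and H: "H \<in> hom ?B (fobj (Delta E p) x) y"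
    then have x [simp]: "x \<in> Arr E" "Cod E x = Cod E p"
      by (auto simp: slice_def)
    from H obtain h where H: "H = (pb2 E x p, y, h)"
      and h: "h \<in> hom E (pb_obj E x p) (Dom E y)" "y \<cdot> h = pb2 E x p"
      by (auto simp: slice_hom_iff Delta_def)
    have ex1: "\<exists>!k. k \<in> hom E (Dom E x) (Dom E g) \<and> g \<cdot> k = x \<and>
           e \<cdot> pb_pair E g p (k \<cdot> pb1 E x p) (pb2 E x p) = h"
      using pi h x unfolding is_Pi_def by blast
    have *: "(x, g, k) \<in> hom ?A x g \<and>
        (pb2 E g p, y, e) \<cdot>\<^bsub>?B\<^esub> farr (Delta E p) (x, g, k) = H \<longleftrightarrow>
        k \<in> hom E (Dom E x) (Dom E g) \<and> g \<cdot> k = x \<and>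
           e \<cdot> pb_pair E g p (k \<cdot> pb1 E x p) (pb2 E x p) = h" for k
      using is_Pi_arr[OF pi] unfolding H by (auto simp: slice_hom_iff Delta_def) (simp_all add: slice_def)
    have **: "\<exists>k. K = (x, g, k)" if "K \<in> hom ?A x g" for K
      using that by (auto simp: slice_hom_iff)
    from ex1 show "\<exists>!k. k \<in> hom ?A x g \<and> (pb2 E g p, y, e) \<cdot>\<^bsub>?B\<^esub> farr (Delta E p) k = H"
      unfolding *[symmetric] using ** by (metis (no_types, lifting))
  qed
qed

section \<open>Identities, composites and base changes of exponentiable morphisms\<close>

lemma exponentiable_ident:
  assumes [simp]: "a \<in> Obj E"
  shows "exponentiable E (Ident E a)"
proof (intro exponentiableI exI)
  let ?p = "Ident E a"
  show "?p \<in> Arr E" by simp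
  fix y assume [simp]: "y \<in> Arr E" and "Cod E y = Dom E ?p"
  then have [simp]: "Cod E y = a" by simp
  have pb2_ident: "pb2 E x ?p = x \<cdot> pb1 E x ?p" if "x \<in> Arr E" "Cod E x = a" for x
    using that pb_square[of x ?p] by (simp del: pb_square)
  show "is_Pi ?p y y (pb1 E y ?p)"
  proof (rule is_PiI)
    fix x h
    assume [simp]: "x \<in> Arr E" "Cod E x = Cod E ?p" "h \<in> Arr E" "Dom E h = pb_obj E x ?p" "Cod E h = Dom E y"
      and h: "y \<cdot> h = pb2 E x ?p"
    then have [simp]: "Cod E x = a" by simp
    \<comment> \<open>The pairing of the identity with \<open>x\<close> is the inverse of
      \<open>pb1 E x ?p\<close>; precomposing with it turns \<open>h\<close> into a map out of
      \<open>Dom E x\<close>.\<close>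
    let ?k = "h \<cdot> pb_pair E x ?p (Ident E (Dom E x)) x"
    have 1: "y \<cdot> ?k = x"
      using comp_reassoc[OF h, of "pb_pair E x ?p (Ident E (Dom E x)) x"] by simp
    have 2: "pb_pair E x ?p (pb1 E x ?p) (x \<cdot> pb1 E x ?p) = Ident E (pb_obj E x ?p)"
      using pb_pair_eta_id[of x ?p] by (simp add: pb2_ident)
    have 3: "y \<cdot> h \<cdot> pb_pair E x ?p (pb1 E x ?p) (x \<cdot> pb1 E x ?p) = x \<cdot> pb1 E x ?p"
      using h by (simp add: 2 pb2_ident)
    show "\<exists>k. k \<in> Arr E \<and> Dom E k = Dom E x \<and> Cod E k = Dom E y \<and> y \<cdot> k = x \<and>
         pb1 E y ?p \<cdot> pb_pair E y ?p (k \<cdot> pb1 E x ?p) (pb2 E x ?p) = h"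
      using h by (intro exI[of _ ?k]) (simp add: 1, simp add: pb2_ident 2 3)
  next
    fix u v
    assume [simp]: "u \<in> Arr E" "v \<in> Arr E" "Cod E u = Dom E y" "Cod E v = Dom E y" "Dom E v = Dom E u"
      "y \<cdot> v = y \<cdot> u"
      and *: "\<And>h b. \<lbrakk>h \<in> Arr E; b \<in> Arr E; Cod E h = Dom E u; Cod E b = Dom E ?p; Dom E b = Dom E h;
         y \<cdot> u \<cdot> h = ?p \<cdot> b; y \<cdot> v \<cdot> h = ?p \<cdot> b\<rbrakk> \<Longrightarrow>
         pb1 E y ?p \<cdot> pb_pair E y ?p (u \<cdot> h) b = pb1 E y ?p \<cdot> pb_pair E y ?p (v \<cdot> h) b"
    show "u = v"
      using *[of "Ident E (Dom E u)" "y \<cdot> u"] by simp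
  qed (simp_all add: pb2_ident)
qed

text \<open>Right adjoints compose: \<open>g2\<close> is \<open>\<Pi>\<close> along
  \<open>f2\<close> of \<open>\<Pi>\<close> along \<open>f1\<close> of \<open>y\<close>. Evaluation
  at \<open>b\<close> means evaluating at \<open>f1 \<cdot> b\<close> first and the result at
  \<open>b\<close>, which is the formula for \<open>?e\<close>.\<close>

lemma exponentiable_comp:
  assumes f1: "exponentiable E f1" and f2: "exponentiable E f2" and f12 [simp]: "Dom E f2 = Cod E f1"
  shows "exponentiable E (f2 \<cdot> f1)"
proof (intro exponentiableI)
  let ?p = "f2 \<cdot> f1"
  note [simp] = exponentiable_arr[OF f1] exponentiable_arr[OF f2]
  show "?p \<in> Arr E" by simp
  fix y assume y [simp]: "y \<in> Arr E" and "Cod E y = Dom E ?p"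
  then have y' [simp]: "Cod E y = Dom E f1" by simp
  obtain g1 e1 where pi1: "is_Pi f1 y g1 e1"
    using exponentiable_is_Pi[OF f1 y y'] .
  note [simp] = is_Pi_arr[OF pi1] is_Pi_app[OF pi1]
  obtain g2 e2 where pi2: "is_Pi f2 g1 g2 e2"
    by (rule exponentiable_is_Pi[OF f2, of g1]) auto
  note [simp] = is_Pi_arr[OF pi2] is_Pi_app[OF pi2]
  have sq [simp]: "f2 \<cdot> f1 \<cdot> pb2 E x ?p = x \<cdot> pb1 E x ?p" if "x \<in> Arr E" "Cod E x = Cod E f2" for x
    using that comp_assoc[of "pb2 E x ?p" f1 f2] pb_square[of x ?p] by (simp del: pb_square)
  let ?e = "e1 \<cdot> pb_pair E g1 f1
    (e2 \<cdot> pb_pair E g2 f2 (pb1 E g2 ?p) (f1 \<cdot> pb2 E g2 ?p)) (pb2 E g2 ?p)"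
  have app: "?e \<cdot> pb_pair E g2 ?p u b = e1 \<cdot> pb_pair E g1 f1 (e2 \<cdot> pb_pair E g2 f2 u (f1 \<cdot> b)) b"
    if [simp]: "u \<in> Arr E" "b \<in> Arr E" "Cod E u = Dom E g2" "Cod E b = Dom E f1" "Dom E b = Dom E u"
      "g2 \<cdot> u = f2 \<cdot> f1 \<cdot> b" for u b
    by simp
  have "is_Pi ?p y g2 ?e"
  proof (rule is_PiI)
    fix x h
    assume [simp]: "x \<in> Arr E" "Cod E x = Cod E ?p" "h \<in> Arr E" "Dom E h = pb_obj E x ?p"
        "Cod E h = Dom E y"
      and h [simp]: "y \<cdot> h = pb2 E x ?p"
    then have [simp]: "Cod E x = Cod E f2" by simp
    let ?x1 = "pb2 E x f2"
    \<comment> \<open>The comparison from the iterated pullback, along \<open>f2\<close> and then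
      \<open>f1\<close>, to the pullback along the composite. It allows \<open>h\<close> to be
      transposed along \<open>f1\<close> first and along \<open>f2\<close> second.\<close>
    let ?a = "pb_pair E x ?p (pb1 E x f2 \<cdot> pb1 E ?x1 f1) (pb2 E ?x1 f1)"
    have [simp]: "y \<cdot> h \<cdot> z = pb2 E x ?p \<cdot> z" if "z \<in> Arr E" "Cod E z = pb_obj E x ?p" for z
      by (rule comp_reassoc) (use that in auto)
    obtain k1 where k1 [simp]: "k1 \<in> Arr E" "Dom E k1 = Dom E ?x1" "Cod E k1 = Dom E g1" "g1 \<cdot> k1 = ?x1"
      and k1_app: "\<And>z b. \<lbrakk>z \<in> Arr E; b \<in> Arr E; Cod E z = Dom E ?x1; Cod E b = Dom E f1; Dom E b = Dom E z;
         ?x1 \<cdot> z = f1 \<cdot> b\<rbrakk> \<Longrightarrow> e1 \<cdot> pb_pair E g1 f1 (k1 \<cdot> z) b = h \<cdot> ?a \<cdot> pb_pair E ?x1 f1 z b"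
      by (rule is_Pi_transpose[OF pi1, of ?x1 "h \<cdot> ?a"]) auto
    obtain k2 where k2 [simp]: "k2 \<in> Arr E" "Dom E k2 = Dom E x" "Cod E k2 = Dom E g2" "g2 \<cdot> k2 = x"
      and k2_app: "\<And>z b. \<lbrakk>z \<in> Arr E; b \<in> Arr E; Cod E z = Dom E x; Cod E b = Dom E f2; Dom E b = Dom E z;
         x \<cdot> z = f2 \<cdot> b\<rbrakk> \<Longrightarrow> e2 \<cdot> pb_pair E g2 f2 (k2 \<cdot> z) b = k1 \<cdot> pb_pair E x f2 z b"
      by (rule is_Pi_transpose[OF pi2, of x k1]) auto
    have [simp]: "g2 \<cdot> k2 \<cdot> pb1 E x ?p = x \<cdot> pb1 E x ?p"
      using comp_reassoc[OF k2(4), of "pb1 E x ?p"] by simp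
    show "\<exists>k. k \<in> Arr E \<and> Dom E k = Dom E x \<and> Cod E k = Dom E g2 \<and> g2 \<cdot> k = x \<and>
         ?e \<cdot> pb_pair E g2 ?p (k \<cdot> pb1 E x ?p) (pb2 E x ?p) = h"
      by (intro exI[of _ k2] conjI k2, subst app) (simp_all add: k1_app k2_app)
  next
    fix u v
    assume [simp]: "u \<in> Arr E" "v \<in> Arr E" "Cod E u = Dom E g2" "Cod E v = Dom E g2" "Dom E v = Dom E u"
      and gv: "g2 \<cdot> v = g2 \<cdot> u"
      and *: "\<And>h b. \<lbrakk>h \<in> Arr E; b \<in> Arr E; Cod E h = Dom E u; Cod E b = Dom E ?p; Dom E b = Dom E h;
         g2 \<cdot> u \<cdot> h = ?p \<cdot> b; g2 \<cdot> v \<cdot> h = ?p \<cdot> b\<rbrakk> \<Longrightarrow>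
         ?e \<cdot> pb_pair E g2 ?p (u \<cdot> h) b = ?e \<cdot> pb_pair E g2 ?p (v \<cdot> h) b"
    show "u = v"
    proof (rule is_Pi_ext[OF pi2])
      fix h b
      assume [simp]: "h \<in> Arr E" "b \<in> Arr E" "Cod E h = Dom E u" "Cod E b = Dom E f2" "Dom E b = Dom E h"
        "g2 \<cdot> u \<cdot> h = f2 \<cdot> b" "g2 \<cdot> v \<cdot> h = f2 \<cdot> b"
      show "e2 \<cdot> pb_pair E g2 f2 (u \<cdot> h) b = e2 \<cdot> pb_pair E g2 f2 (v \<cdot> h) b"
      proof (rule is_Pi_ext[OF pi1])
        fix l c
        assume [simp]: "l \<in> Arr E" "c \<in> Arr E" "Cod E l = Dom E (e2 \<cdot> pb_pair E g2 f2 (u \<cdot> h) b)"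
            "Cod E c = Dom E f1" "Dom E c = Dom E l"
          and 1: "g1 \<cdot> (e2 \<cdot> pb_pair E g2 f2 (u \<cdot> h) b) \<cdot> l = f1 \<cdot> c"
        have [simp]: "Cod E l = Dom E h"
          using \<open>Cod E l = _\<close> by simp
        have [simp]: "g2 \<cdot> u \<cdot> h \<cdot> l = f2 \<cdot> b \<cdot> l" "g2 \<cdot> v \<cdot> h \<cdot> l = f2 \<cdot> b \<cdot> l"
          using comp_reassoc[of g2 "u \<cdot> h" "f2 \<cdot> b" l] comp_reassoc[of g2 "v \<cdot> h" "f2 \<cdot> b" l] by simp_all
        \<comment> \<open>\<open>g1\<close> applied to the inner value returns the argument at which
          it was taken. Hence the \<open>f2\<close>-argument is determined by \<open>c\<close>, and
          the hypothesis about the composite applies at \<open>c\<close>.\<close>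
        have bl [simp]: "b \<cdot> l = f1 \<cdot> c"
          using 1 by simp
        show "e1 \<cdot> pb_pair E g1 f1 ((e2 \<cdot> pb_pair E g2 f2 (u \<cdot> h) b) \<cdot> l) c =
          e1 \<cdot> pb_pair E g1 f1 ((e2 \<cdot> pb_pair E g2 f2 (v \<cdot> h) b) \<cdot> l) c"
          using *[of "h \<cdot> l" c] by simp
      qed auto
    qed (use gv in auto)
  qed auto
  then show "\<exists>g e. is_Pi ?p y g e" by blast
qed

text \<open>A section of \<open>y\<close> over the fibre of \<open>?p\<close> at a point a of
  \<open>Dom E f\<close> is a section of \<open>?q \<cdot> y\<close> over the fibre of
  \<open>p\<close> at the image of a under \<open>f\<close>, subject to the condition that its
  component in \<open>Dom E f\<close> is constantly a. Now \<open>g1\<close> classifies sections of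
  \<open>?q \<cdot> y\<close> and \<open>g2\<close> classifies families in \<open>Dom E f\<close>,
  both over fibres of \<open>p\<close>. The condition compares two maps into \<open>g2\<close>, and
  the pullback of \<open>m1\<close> and \<open>m2\<close> imposes it.\<close>

lemma exponentiable_pb1:
  assumes p: "exponentiable E p" and f [simp]: "f \<in> Arr E" and fp [simp]: "Cod E f = Cod E p"
  shows "exponentiable E (pb1 E f p)"
proof (intro exponentiableI)
  let ?p = "pb1 E f p" and ?q = "pb2 E f p"
  note [simp] = exponentiable_arr[OF p]
  show "?p \<in> Arr E" by simp
  fix y assume y [simp]: "y \<in> Arr E" and "Cod E y = Dom E ?p"
  then have y' [simp]: "Cod E y = pb_obj E f p" by simp
  let ?a = "Dom E f" and ?b = "Dom E p"
  let ?w1 = "pr1 E ?a ?b" and ?w2 = "pr2 E ?a ?b"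
  obtain g1 e1 where pi1: "is_Pi p (?q \<cdot> y) g1 e1"
    by (rule exponentiable_is_Pi[OF p, of "?q \<cdot> y"]) auto
  have [simp]: "g1 \<in> Arr E" "Cod E g1 = Cod E p" "e1 \<in> Arr E" "Dom E e1 = pb_obj E g1 p"
    "Cod E e1 = Dom E y" "?q \<cdot> y \<cdot> e1 = pb2 E g1 p"
    using is_Pi_arr[OF pi1] by auto
  have [simp]: "?q \<cdot> y \<cdot> e1 \<cdot> z = pb2 E g1 p \<cdot> z" if "z \<in> Arr E" "Cod E z = pb_obj E g1 p" for z
    using is_Pi_app[OF pi1] that by simp
  obtain g2 e2 where pi2: "is_Pi p ?w2 g2 e2"
    by (rule exponentiable_is_Pi[OF p, of ?w2]) auto
  note [simp] = is_Pi_arr[OF pi2] is_Pi_app[OF pi2]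
  \<comment> \<open>\<open>m1\<close> sends a section to the family of its components in
    \<open>Dom E f\<close>.\<close>
  obtain m1 where m1 [simp]: "m1 \<in> Arr E" "Dom E m1 = Dom E g1" "Cod E m1 = Dom E g2" "g2 \<cdot> m1 = g1"
    and m1_app: "\<And>z b. \<lbrakk>z \<in> Arr E; b \<in> Arr E; Cod E z = Dom E g1; Cod E b = Dom E p; Dom E b = Dom E z;
       g1 \<cdot> z = p \<cdot> b\<rbrakk> \<Longrightarrow> e2 \<cdot> pb_pair E g2 p (m1 \<cdot> z) b =
         pr_pair E ?a ?b (?p \<cdot> y \<cdot> e1) (pb2 E g1 p) \<cdot> pb_pair E g1 p z b"
    by (rule is_Pi_transpose[OF pi2, of g1 "pr_pair E ?a ?b (?p \<cdot> y \<cdot> e1) (pb2 E g1 p)"]) auto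
  \<comment> \<open>\<open>m2\<close> sends a point of \<open>Dom E f\<close> to the constant family
    at that point.\<close>
  obtain m2 where m2 [simp]: "m2 \<in> Arr E" "Dom E m2 = Dom E f" "Cod E m2 = Dom E g2" "g2 \<cdot> m2 = f"
    and m2_app: "\<And>z b. \<lbrakk>z \<in> Arr E; b \<in> Arr E; Cod E z = Dom E f; Cod E b = Dom E p; Dom E b = Dom E z;
       f \<cdot> z = p \<cdot> b\<rbrakk> \<Longrightarrow> e2 \<cdot> pb_pair E g2 p (m2 \<cdot> z) b =
         pr_pair E ?a ?b ?p ?q \<cdot> pb_pair E f p z b"
    by (rule is_Pi_transpose[OF pi2, of f "pr_pair E ?a ?b ?p ?q"]) auto
  have m1_comp [simp]: "g2 \<cdot> m1 \<cdot> z = g1 \<cdot> z" if "z \<in> Arr E" "Cod E z = Dom E g1" for z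
    by (rule comp_reassoc) (use that in auto)
  have m2_comp [simp]: "g2 \<cdot> m2 \<cdot> z = f \<cdot> z" if "z \<in> Arr E" "Cod E z = Dom E f" for z
    by (rule comp_reassoc) (use that in auto)
  have m1_app1: "?w1 \<cdot> e2 \<cdot> pb_pair E g2 p (m1 \<cdot> z) b = ?p \<cdot> y \<cdot> e1 \<cdot> pb_pair E g1 p z b"
    if [simp]: "z \<in> Arr E" "b \<in> Arr E" "Cod E z = Dom E g1" "Cod E b = Dom E p" "Dom E b = Dom E z"
       "g1 \<cdot> z = p \<cdot> b" for z b
    using comp_reassoc[OF pr1_pair, of ?a ?b "?p \<cdot> y \<cdot> e1" "pb2 E g1 p" "pb_pair E g1 p z b"]
    by (simp add: m1_app)
  have m2_app1: "?w1 \<cdot> e2 \<cdot> pb_pair E g2 p (m2 \<cdot> z) b = z"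
    if [simp]: "z \<in> Arr E" "b \<in> Arr E" "Cod E z = Dom E f" "Cod E b = Dom E p" "Dom E b = Dom E z"
       "f \<cdot> z = p \<cdot> b" for z b
    using comp_reassoc[OF pr1_pair, of ?a ?b ?p ?q "pb_pair E f p z b"]
    by (simp add: m2_app)
  let ?G = "pb_obj E m1 m2" and ?s = "pb1 E m1 m2" and ?g = "pb2 E m1 m2"
  have g_s [simp]: "g1 \<cdot> ?s \<cdot> z = f \<cdot> ?g \<cdot> z" if "z \<in> Arr E" "Cod E z = ?G" for z
    using that m1_comp[of "?s \<cdot> z"] m2_comp[of "?g \<cdot> z"] pb_square'[of m1 m2 z]
    by (simp del: m1_comp m2_comp)
  let ?e = "e1 \<cdot> pb_pair E g1 p (?s \<cdot> pb1 E ?g ?p) (?q \<cdot> pb2 E ?g ?p)"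
  have pq [simp]: "p \<cdot> ?q \<cdot> z = f \<cdot> ?p \<cdot> z" if "z \<in> Arr E" "Cod E z = pb_obj E f p" for z
    using that by simp
  have app: "?e \<cdot> pb_pair E ?g ?p u b = e1 \<cdot> pb_pair E g1 p (?s \<cdot> u) (?q \<cdot> b)"
    if [simp]: "u \<in> Arr E" "b \<in> Arr E" "Cod E u = ?G" "Cod E b = pb_obj E f p" "Dom E b = Dom E u"
      "?g \<cdot> u = ?p \<cdot> b" for u b
    by simp
  have "is_Pi ?p y ?g ?e"
  proof (rule is_PiI)
    show "y \<cdot> ?e = pb2 E ?g ?p"
    proof (rule pb_ext[of f p])
      \<comment> \<open>Over \<open>?G\<close> the family read off by \<open>m1\<close> is the
        constant one given by \<open>m2\<close>, so the value of the section has the right component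
        in \<open>Dom E f\<close>. The other component is right because \<open>e1\<close> lies over
        \<open>p\<close>'s domain through \<open>?q \<cdot> y\<close>.\<close>
      have "?p \<cdot> y \<cdot> ?e = ?w1 \<cdot> e2 \<cdot> pb_pair E g2 p (m1 \<cdot> ?s \<cdot> pb1 E ?g ?p) (?q \<cdot> pb2 E ?g ?p)"
        by (subst m1_app1) simp_all
      also have "m1 \<cdot> ?s \<cdot> pb1 E ?g ?p = m2 \<cdot> ?g \<cdot> pb1 E ?g ?p"
        by simp
      also have "?w1 \<cdot> e2 \<cdot> pb_pair E g2 p \<dots> (?q \<cdot> pb2 E ?g ?p) = ?g \<cdot> pb1 E ?g ?p"
        by (subst m2_app1) simp_all
      finally show "?p \<cdot> y \<cdot> ?e = ?p \<cdot> pb2 E ?g ?p"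
        by simp
    qed simp_all
  next
    fix x h
    assume [simp]: "x \<in> Arr E" "Cod E x = Cod E ?p" "h \<in> Arr E" "Dom E h = pb_obj E x ?p"
        "Cod E h = Dom E y"
      and h [simp]: "y \<cdot> h = pb2 E x ?p"
    then have [simp]: "Cod E x = Dom E f" by simp
    have [simp]: "y \<cdot> h \<cdot> z = pb2 E x ?p \<cdot> z" if "z \<in> Arr E" "Cod E z = pb_obj E x ?p" for z
      by (rule comp_reassoc) (use that in auto)
    let ?x = "f \<cdot> x"
    have sq [simp]: "p \<cdot> pb2 E ?x p = f \<cdot> x \<cdot> pb1 E ?x p"
      by simp
    \<comment> \<open>The comparison between the pullback of \<open>f \<cdot> x\<close> along
      \<open>p\<close> and the pullback of \<open>x\<close> along \<open>?p\<close>; a direction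
      over the former is completed by the component \<open>x\<close>.\<close>
    let ?c = "pb_pair E x ?p (pb1 E ?x p) (pb_pair E f p (x \<cdot> pb1 E ?x p) (pb2 E ?x p))"
    obtain k1 where k1 [simp]: "k1 \<in> Arr E" "Dom E k1 = Dom E x" "Cod E k1 = Dom E g1" "g1 \<cdot> k1 = f \<cdot> x"
      and k1_app: "\<And>z b. \<lbrakk>z \<in> Arr E; b \<in> Arr E; Cod E z = Dom E x; Cod E b = Dom E p; Dom E b = Dom E z;
         f \<cdot> x \<cdot> z = p \<cdot> b\<rbrakk> \<Longrightarrow> e1 \<cdot> pb_pair E g1 p (k1 \<cdot> z) b = (h \<cdot> ?c) \<cdot> pb_pair E ?x p z b"
      by (rule is_Pi_transpose[OF pi1, of ?x "h \<cdot> ?c"]) auto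
    have k1_comp [simp]: "g1 \<cdot> k1 \<cdot> z = f \<cdot> x \<cdot> z" if "z \<in> Arr E" "Cod E z = Dom E x" for z
      using comp_reassoc[OF k1(4), of z] that by simp
    \<comment> \<open>Since \<open>y \<cdot> h\<close> is the projection, the section named by
      \<open>k1\<close> has component constantly \<open>x\<close>. So \<open>k1\<close> and
      \<open>x\<close> pair to a map into the pullback, which is the required transpose.\<close>
    have mk [simp]: "m1 \<cdot> k1 = m2 \<cdot> x"
    proof (rule is_Pi_ext[OF pi2])
      fix l b
      assume "l \<in> Arr E" "b \<in> Arr E" "Cod E l = Dom E (m1 \<cdot> k1)" "Cod E b = Dom E p"
        "Dom E b = Dom E l" "g2 \<cdot> (m1 \<cdot> k1) \<cdot> l = p \<cdot> b"
      then have [simp]: "l \<in> Arr E" "b \<in> Arr E" "Cod E l = Dom E x" "Cod E b = Dom E p"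
        "Dom E b = Dom E l" "f \<cdot> x \<cdot> l = p \<cdot> b"
        by auto
      show "e2 \<cdot> pb_pair E g2 p ((m1 \<cdot> k1) \<cdot> l) b = e2 \<cdot> pb_pair E g2 p ((m2 \<cdot> x) \<cdot> l) b"
        by (rule pr_ext[of ?a ?b]) (simp_all add: m1_app1 m2_app1 k1_app)
    qed auto
    have [simp]: "m1 \<cdot> k1 \<cdot> z = m2 \<cdot> x \<cdot> z" if "z \<in> Arr E" "Cod E z = Dom E x" for z
      using comp_reassoc[OF mk, of z] that by simp
    show "\<exists>k. k \<in> Arr E \<and> Dom E k = Dom E x \<and> Cod E k = Dom E ?g \<and> ?g \<cdot> k = x \<and>
         ?e \<cdot> pb_pair E ?g ?p (k \<cdot> pb1 E x ?p) (pb2 E x ?p) = h"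
      by (intro exI[of _ "pb_pair E m1 m2 k1 x"]) (simp add: k1_app)
  next
    fix u v
    assume [simp]: "u \<in> Arr E" "v \<in> Arr E" and uv: "Cod E u = Dom E ?g" "Cod E v = Dom E ?g"
      and [simp]: "Dom E v = Dom E u"
      and gv [simp]: "?g \<cdot> v = ?g \<cdot> u"
      and *: "\<And>h b. \<lbrakk>h \<in> Arr E; b \<in> Arr E; Cod E h = Dom E u; Cod E b = Dom E ?p; Dom E b = Dom E h;
         ?g \<cdot> u \<cdot> h = ?p \<cdot> b; ?g \<cdot> v \<cdot> h = ?p \<cdot> b\<rbrakk> \<Longrightarrow>
         ?e \<cdot> pb_pair E ?g ?p (u \<cdot> h) b = ?e \<cdot> pb_pair E ?g ?p (v \<cdot> h) b"
    have [simp]: "Cod E u = ?G" "Cod E v = ?G"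
      using uv by auto
    show "u = v"
    proof (rule pb_ext[of m1 m2])
      show "?s \<cdot> u = ?s \<cdot> v"
      proof (rule is_Pi_ext[OF pi1])
        fix l b
        assume 1: "l \<in> Arr E" "b \<in> Arr E" "Cod E l = Dom E (?s \<cdot> u)" "Cod E b = Dom E p"
          "Dom E b = Dom E l" "g1 \<cdot> (?s \<cdot> u) \<cdot> l = p \<cdot> b"
        then have [simp]: "l \<in> Arr E" "b \<in> Arr E" "Cod E l = Dom E u" "Cod E b = Dom E p"
          "Dom E b = Dom E l"
          by auto
        have [simp]: "f \<cdot> ?g \<cdot> u \<cdot> l = p \<cdot> b"
          using 1 by simp
        have [simp]: "?g \<cdot> v \<cdot> l = ?g \<cdot> u \<cdot> l"
          using comp_reassoc[OF gv, of l] by simp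
        \<comment> \<open>The direction \<open>b\<close> of \<open>p\<close> becomes a direction of
          \<open>?p\<close> by adding the point \<open>?g \<cdot> u \<cdot> l\<close>, which is the
          same for \<open>v\<close>.\<close>
        show "e1 \<cdot> pb_pair E g1 p ((?s \<cdot> u) \<cdot> l) b = e1 \<cdot> pb_pair E g1 p ((?s \<cdot> v) \<cdot> l) b"
          using *[of l "pb_pair E f p (?g \<cdot> u \<cdot> l) b"] by simp
      qed auto
    qed (use gv in simp_all)
  qed simp_all
  then show "\<exists>g e. is_Pi ?p y g e" by blast
qed

subsection \<open>Positions and directions of a composite\<close>

context
  fixes p q :: 'a
  assumes p [simp]: "exponentiable E p" and q [simp]: "q \<in> Arr E"
begin

lemma pos_is_Pi:
  "is_Pi p (pr2 E (Cod E q) (Dom E p)) (pos E p q)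
     (slice_map (Pi_counit E p (pr2 E (Cod E q) (Dom E p))))"
  unfolding pos_def by (rule has_Pi_is_Pi[OF _ exponentiable_has_Pi]) simp_all

lemma pos_arr [simp]: "pos E p q \<in> Arr E"
  and cod_pos [simp]: "Cod E (pos E p q) = Cod E p"
  using is_Pi_arr[OF pos_is_Pi] by auto

lemma ev_arr [simp]: "ev E p q \<in> Arr E"
  and dom_ev [simp]: "Dom E (ev E p q) = pb_obj E (pos E p q) p"
  and cod_ev [simp]: "Cod E (ev E p q) = Cod E q"
  unfolding ev_def using is_Pi_arr[OF pos_is_Pi] by auto

lemma app_pos:
  assumes "u \<in> Arr E" "y \<in> Arr E" "Cod E u = Dom E (pos E p q)" "Cod E y = Dom E p"
    "Dom E y = Dom E u" "pos E p q \<cdot> u = p \<cdot> y"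
  shows app_pos_arr [simp]: "app_pos E p q u y \<in> Arr E"
    and dom_app_pos [simp]: "Dom E (app_pos E p q u y) = Dom E u"
    and cod_app_pos [simp]: "Cod E (app_pos E p q u y) = Cod E q"
    and app_pos_comp [simp]: "\<And>h. h \<in> Arr E \<Longrightarrow> Cod E h = Dom E u \<Longrightarrow>
      app_pos E p q u y \<cdot> h = app_pos E p q (u \<cdot> h) (y \<cdot> h)"
  using assms by (simp_all add: app_pos_def)

text \<open>The counit takes values in \<open>Q \<times> P\<^sub>*\<close>, and its second component
  is forced to be the argument. Only the first component, which is \<open>app_pos\<close>, can
  distinguish two positions over the same base.\<close>

lemma pos_ext:
  assumes u [simp]: "u \<in> Arr E" "v \<in> Arr E" "Cod E u = Dom E (pos E p q)" "Cod E v = Dom E (pos E p q)"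
    "Dom E v = Dom E u" and uv: "pos E p q \<cdot> v = pos E p q \<cdot> u"
    and app: "\<And>h y. \<lbrakk>h \<in> Arr E; y \<in> Arr E; Cod E h = Dom E u; Cod E y = Dom E p; Dom E y = Dom E h;
       p \<cdot> y = pos E p q \<cdot> u \<cdot> h; pos E p q \<cdot> v \<cdot> h = pos E p q \<cdot> u \<cdot> h\<rbrakk> \<Longrightarrow>
       app_pos E p q (u \<cdot> h) y = app_pos E p q (v \<cdot> h) y"
  shows "u = v"
proof (rule is_Pi_ext[OF pos_is_Pi])
  let ?e = "slice_map (Pi_counit E p (pr2 E (Cod E q) (Dom E p)))"
  note [simp] = is_Pi_arr[OF pos_is_Pi] is_Pi_app[OF pos_is_Pi]
  fix h y
  assume h [simp]: "h \<in> Arr E" "y \<in> Arr E" "Cod E h = Dom E u" "Cod E y = Dom E p" "Dom E y = Dom E h"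
     "pos E p q \<cdot> u \<cdot> h = p \<cdot> y" "pos E p q \<cdot> v \<cdot> h = p \<cdot> y"
  show "?e \<cdot> pb_pair E (pos E p q) p (u \<cdot> h) y = ?e \<cdot> pb_pair E (pos E p q) p (v \<cdot> h) y"
    by (rule pr_ext[of "Cod E q" "Dom E p"]) (use app[OF h(1-5)] in \<open>simp_all add: app_pos_def ev_def\<close>)
qed (use uv in simp_all)

text \<open>The beta rules for positions, with \<open>pos_ext\<close> as the matching extensionality
  principle. They carry a trailing \<open>h\<close> because composites are normalised to the
  right.\<close>

lemma mk_pos:
  assumes x [simp]: "x \<in> Arr E" "Cod E x = Cod E p"
    and f [simp]: "f \<in> Arr E" "Dom E f = pb_obj E x p" "Cod E f = Cod E q"
  shows mk_pos_arr [simp]: "mk_pos E p q x f \<in> Arr E"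
    and dom_mk_pos [simp]: "Dom E (mk_pos E p q x f) = Dom E x"
    and cod_mk_pos [simp]: "Cod E (mk_pos E p q x f) = Dom E (pos E p q)"
    and pos_mk_pos [simp]: "pos E p q \<cdot> mk_pos E p q x f = x"
    and pos_mk_pos_comp [simp]: "\<And>h. h \<in> Arr E \<Longrightarrow> Cod E h = Dom E x \<Longrightarrow>
       pos E p q \<cdot> mk_pos E p q x f \<cdot> h = x \<cdot> h"
    and app_mk_pos_comp [simp]: "\<And>h y. \<lbrakk>h \<in> Arr E; y \<in> Arr E; Cod E h = Dom E x; Cod E y = Dom E p;
       Dom E y = Dom E h; x \<cdot> h = p \<cdot> y\<rbrakk> \<Longrightarrow>
       app_pos E p q (mk_pos E p q x f \<cdot> h) y = f \<cdot> pb_pair E x p h y"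
proof -
  let ?pr1 = "pr1 E (Cod E q) (Dom E p)" and ?pr2 = "pr2 E (Cod E q) (Dom E p)"
  let ?e = "slice_map (Pi_counit E p ?pr2)"
  let ?h = "pr_pair E (Cod E q) (Dom E p) f (pb2 E x p)"
  let ?k = "mk_pos E p q x f"
  note [simp] = is_Pi_arr[OF pos_is_Pi] is_Pi_app[OF pos_is_Pi]
  have "?k \<in> hom E (Dom E x) (Dom E (pos E p q)) \<and> pos E p q \<cdot> ?k = x \<and>
       ?e \<cdot> pb_pair E (pos E p q) p (?k \<cdot> pb1 E x p) (pb2 E x p) = ?h"
    using has_Pi_transpose(5)[OF _ exponentiable_has_Pi, of p ?pr2 x ?h ?k]
    unfolding pos_def mk_pos_def by (simp add: hom_iff)
  then have app: "?e \<cdot> pb_pair E (pos E p q) p (?k \<cdot> pb1 E x p) (pb2 E x p) = ?h"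
    and k [simp]: "?k \<in> Arr E" "Dom E ?k = Dom E x" "Cod E ?k = Dom E (pos E p q)" "pos E p q \<cdot> ?k = x"
    by (auto simp: hom_iff)
  show "?k \<in> Arr E" "Dom E ?k = Dom E x" "Cod E ?k = Dom E (pos E p q)" "pos E p q \<cdot> ?k = x"
    by simp_all
  show pos: "pos E p q \<cdot> ?k \<cdot> h = x \<cdot> h" if "h \<in> Arr E" "Cod E h = Dom E x" for h
    by (rule comp_reassoc) (use that in auto)
  fix h y
  assume [simp]: "h \<in> Arr E" "y \<in> Arr E" "Cod E h = Dom E x" "Cod E y = Dom E p"
       "Dom E y = Dom E h" "x \<cdot> h = p \<cdot> y"
  have "?e \<cdot> pb_pair E (pos E p q) p (?k \<cdot> h) y = ?h \<cdot> pb_pair E x p h y"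
    by (rule Pi_app_comp[OF _ _ _ _ _ _ _ _ _ _ _ _ app]) simp_all
  then show "app_pos E p q (?k \<cdot> h) y = f \<cdot> pb_pair E x p h y"
    using comp_reassoc[OF pr1_pair, of "Cod E q" "Dom E p" f "pb2 E x p" "pb_pair E x p h y"]
    by (simp add: app_pos_def ev_def pos)
qed

lemma ptens_arr [simp]: "ptens E p q \<in> Arr E"
  and cod_ptens [simp]: "Cod E (ptens E p q) = Dom E (pos E p q)"
  by (simp_all add: ptens_def)

lemma dom_ptens: "Dom E (ptens E p q) = pb_obj E (ev E p q) q"
  by (simp add: ptens_def)

lemma dir:
  assumes "w \<in> Arr E" "Cod E w = Dom E (ptens E p q)"
  shows dir1_arr [simp]: "dir1 E p q w \<in> Arr E"
    and dom_dir1 [simp]: "Dom E (dir1 E p q w) = Dom E w"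
    and cod_dir1 [simp]: "Cod E (dir1 E p q w) = Dom E p"
    and base_dir1 [simp]: "p \<cdot> dir1 E p q w = pos E p q \<cdot> ptens E p q \<cdot> w"
    and dir1_comp [simp]: "\<And>h. h \<in> Arr E \<Longrightarrow> Cod E h = Dom E w \<Longrightarrow> dir1 E p q w \<cdot> h = dir1 E p q (w \<cdot> h)"
    and dir2_arr [simp]: "dir2 E p q w \<in> Arr E"
    and dom_dir2 [simp]: "Dom E (dir2 E p q w) = Dom E w"
    and cod_dir2 [simp]: "Cod E (dir2 E p q w) = Dom E q"
    and base_dir2 [simp]: "q \<cdot> dir2 E p q w = app_pos E p q (ptens E p q \<cdot> w) (dir1 E p q w)"
    and dir2_comp [simp]: "\<And>h. h \<in> Arr E \<Longrightarrow> Cod E h = Dom E w \<Longrightarrow> dir2 E p q w \<cdot> h = dir2 E p q (w \<cdot> h)"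
  using assms by (simp_all add: dom_ptens dir1_def dir2_def ptens_def app_pos_def)

lemma mk_dir:
  assumes "u \<in> Arr E" "y \<in> Arr E" "z \<in> Arr E" "Cod E u = Dom E (pos E p q)" "Cod E y = Dom E p"
    "Cod E z = Dom E q" "Dom E y = Dom E u" "Dom E z = Dom E u" "pos E p q \<cdot> u = p \<cdot> y"
    "app_pos E p q u y = q \<cdot> z"
  shows mk_dir_arr [simp]: "mk_dir E p q u y z \<in> Arr E"
    and dom_mk_dir [simp]: "Dom E (mk_dir E p q u y z) = Dom E u"
    and cod_mk_dir [simp]: "Cod E (mk_dir E p q u y z) = Dom E (ptens E p q)"
    and base_mk_dir [simp]: "ptens E p q \<cdot> mk_dir E p q u y z = u"
    and dir1_mk_dir [simp]: "dir1 E p q (mk_dir E p q u y z) = y"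
    and dir2_mk_dir [simp]: "dir2 E p q (mk_dir E p q u y z) = z"
    and mk_dir_comp [simp]: "\<And>h. h \<in> Arr E \<Longrightarrow> Cod E h = Dom E u \<Longrightarrow>
       mk_dir E p q u y z \<cdot> h = mk_dir E p q (u \<cdot> h) (y \<cdot> h) (z \<cdot> h)"
  using assms by (simp_all add: mk_dir_def dom_ptens dir1_def dir2_def ptens_def app_pos_def)

lemma mk_dir_eta [simp]:
  assumes "w \<in> Arr E" "Cod E w = Dom E (ptens E p q)" "ptens E p q \<cdot> w = u"
  shows "mk_dir E p q u (dir1 E p q w) (dir2 E p q w) = w"
proof -
  have "pb_pair E (pos E p q) p u (dir1 E p q w) = pb1 E (ev E p q) q \<cdot> w"
    using assms(1,2) unfolding assms(3)[symmetric] by (simp add: dom_ptens dir1_def ptens_def)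
  then show ?thesis
    using assms by (simp add: mk_dir_def dir2_def dom_ptens)
qed

end

text \<open>The two projections that make up \<open>ptens E p q\<close> are base changes of
  \<open>p\<close> and of \<open>q\<close>.\<close>

lemma exponentiable_ptens [simp]:
  assumes "exponentiable E p" "exponentiable E q"
  shows "exponentiable E (ptens E p q)"
  unfolding ptens_def using assms by (intro exponentiable_comp exponentiable_pb1) simp_all

lemma yon_comp [simp]: "f \<in> Arr E \<Longrightarrow> Cod E f = terminal E \<Longrightarrow> yon E \<cdot> f = f"
  and dom_yon [simp]: "Dom E (yon E) = terminal E"
  and cod_yon [simp]: "Cod E (yon E) = terminal E"
  and exponentiable_yon [simp]: "exponentiable E (yon E)"
  by (simp_all add: yon_def exponentiable_ident)

lemma pos_yon_comp [simp]:
  assumes "q \<in> Arr E" "u \<in> Arr E" "Cod E u = Dom E (pos E (yon E) q)"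
  shows "pos E (yon E) q \<cdot> u = bang E (Dom E u)"
  using bang_eq[of "pos E (yon E) q \<cdot> u"] assms by simp

lemma app_pos_yon_comp [simp]:
  assumes "exponentiable E p" "u \<in> Arr E" "y \<in> Arr E" "Cod E u = Dom E (pos E p (yon E))"
    "Cod E y = Dom E p" "Dom E y = Dom E u" "pos E p (yon E) \<cdot> u = p \<cdot> y"
  shows "app_pos E p (yon E) u y = bang E (Dom E u)"
  using bang_eq[of "app_pos E p (yon E) u y"] assms by simp

subsection \<open>Morphisms of polynomials on generalized elements\<close>

definition pmor :: "'a pmor \<Rightarrow> bool" where
  "pmor \<phi> \<longleftrightarrow> exponentiable E (pm_dom \<phi>) \<and> exponentiable E (pm_cod \<phi>) \<and>
     is_pmor E (pm_dom \<phi>) (pm_cod \<phi>) \<phi>"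

definition lift :: "'a pmor \<Rightarrow> 'a \<Rightarrow> 'a \<Rightarrow> 'a" where
  "lift \<phi> x y = on_dir \<phi> \<cdot> pb_pair E (on_pos \<phi>) (pm_cod \<phi>) x y"

context
  fixes \<phi> :: "'a pmor"
  assumes phi: "pmor \<phi>"
begin

lemma pmor_exponentiable [simp]: "exponentiable E (pm_dom \<phi>)" "exponentiable E (pm_cod \<phi>)"
  and on_pos_arr [simp]: "on_pos \<phi> \<in> Arr E"
  and dom_on_pos [simp]: "Dom E (on_pos \<phi>) = Cod E (pm_dom \<phi>)"
  and cod_on_pos [simp]: "Cod E (on_pos \<phi>) = Cod E (pm_cod \<phi>)"
  and on_dir_arr [simp]: "on_dir \<phi> \<in> Arr E"
  and dom_on_dir [simp]: "Dom E (on_dir \<phi>) = pb_obj E (on_pos \<phi>) (pm_cod \<phi>)"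
  and cod_on_dir [simp]: "Cod E (on_dir \<phi>) = Dom E (pm_dom \<phi>)"
  and base_on_dir: "pm_dom \<phi> \<cdot> on_dir \<phi> = pb1 E (on_pos \<phi>) (pm_cod \<phi>)"
  using phi by (auto simp: pmor_def is_pmor_def hom_iff)

lemma lift:
  assumes xy: "x \<in> Arr E" "y \<in> Arr E" "Cod E x = Cod E (pm_dom \<phi>)" "Cod E y = Dom E (pm_cod \<phi>)"
    "Dom E y = Dom E x" "on_pos \<phi> \<cdot> x = pm_cod \<phi> \<cdot> y"
  shows lift_arr [simp]: "lift \<phi> x y \<in> Arr E"
    and dom_lift [simp]: "Dom E (lift \<phi> x y) = Dom E x"
    and cod_lift [simp]: "Cod E (lift \<phi> x y) = Dom E (pm_dom \<phi>)"
    and base_lift [simp]: "\<And>p. pm_dom \<phi> = p \<Longrightarrow> p \<cdot> lift \<phi> x y = x"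
    and lift_comp [simp]: "\<And>h. h \<in> Arr E \<Longrightarrow> Cod E h = Dom E x \<Longrightarrow>
       lift \<phi> x y \<cdot> h = lift \<phi> (x \<cdot> h) (y \<cdot> h)"
proof -
  show "p \<cdot> lift \<phi> x y = x" if "pm_dom \<phi> = p" for p
    using comp_reassoc[OF base_on_dir, of "pb_pair E (on_pos \<phi>) (pm_cod \<phi>) x y"] xy that
    by (auto simp: lift_def)
qed (use xy in \<open>simp_all add: lift_def\<close>)

lemma lift_generic: "lift \<phi> (pb1 E (on_pos \<phi>) (pm_cod \<phi>)) (pb2 E (on_pos \<phi>) (pm_cod \<phi>)) = on_dir \<phi>"
  by (simp add: lift_def)

end

lemma pmorI:
  assumes "exponentiable E (pm_dom \<phi>)" "exponentiable E (pm_cod \<phi>)" "on_pos \<phi> \<in> Arr E"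
    "Dom E (on_pos \<phi>) = Cod E (pm_dom \<phi>)" "Cod E (on_pos \<phi>) = Cod E (pm_cod \<phi>)"
    "on_dir \<phi> \<in> Arr E" "Dom E (on_dir \<phi>) = pb_obj E (on_pos \<phi>) (pm_cod \<phi>)"
    "Cod E (on_dir \<phi>) = Dom E (pm_dom \<phi>)"
    "pm_dom \<phi> \<cdot> on_dir \<phi> = pb1 E (on_pos \<phi>) (pm_cod \<phi>)"
  shows "pmor \<phi>"
  unfolding pmor_def is_pmor_def hom_iff using assms by blast

text \<open>On the pair of pullback projections \<open>lift\<close> returns \<open>on_dir\<close>
  itself, so equality on all elements gives equality of records.\<close>

lemma pmor_ext:
  assumes phi: "pmor \<phi>" "pmor \<psi>" and eq: "pm_dom \<phi> = pm_dom \<psi>" "pm_cod \<phi> = pm_cod \<psi>"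
    "on_pos \<phi> = on_pos \<psi>"
    and lift: "\<And>x y. \<lbrakk>x \<in> Arr E; y \<in> Arr E; Cod E x = Cod E (pm_dom \<psi>); Cod E y = Dom E (pm_cod \<psi>);
      Dom E y = Dom E x; pm_cod \<psi> \<cdot> y = on_pos \<psi> \<cdot> x\<rbrakk> \<Longrightarrow> lift \<phi> x y = lift \<psi> x y"
  shows "\<phi> = \<psi>"
proof -
  have "on_dir \<phi> = on_dir \<psi>"
    using lift[of "pb1 E (on_pos \<psi>) (pm_cod \<psi>)" "pb2 E (on_pos \<psi>) (pm_cod \<psi>)"] phi eq
      lift_generic[OF phi(1)] lift_generic[OF phi(2)] by simp
  with eq show ?thesis by simp
qed

lemma pmor_id_simps [simp]:
  "pm_dom (pmor_id E p) = p" "pm_cod (pmor_id E p) = p" "on_pos (pmor_id E p) = Ident E (Cod E p)"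
  by (simp_all add: pmor_id_def)

lemma pmor_id [simp]: "exponentiable E p \<Longrightarrow> pmor (pmor_id E p)"
  by (rule pmorI) (simp_all, simp_all add: pmor_id_def)

lemma lift_pmor_id [simp]:
  "exponentiable E p \<Longrightarrow> y \<in> Arr E \<Longrightarrow> Cod E y = Dom E p \<Longrightarrow> p \<cdot> y = x \<Longrightarrow> lift (pmor_id E p) x y = y"
  by (auto simp: lift_def) (simp add: pmor_id_def)

lemma pmor_comp_simps [simp]:
  "pm_dom (pmor_comp E \<psi> \<phi>) = pm_dom \<phi>" "pm_cod (pmor_comp E \<psi> \<phi>) = pm_cod \<psi>"
  "on_pos (pmor_comp E \<psi> \<phi>) = on_pos \<psi> \<cdot> on_pos \<phi>"
  by (simp_all add: pmor_comp_def Let_def)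

context
  fixes \<phi> \<psi> :: "'a pmor"
  assumes phi [simp]: "pmor \<phi>" and psi [simp]: "pmor \<psi>" and dc [simp]: "pm_dom \<psi> = pm_cod \<phi>"
begin

lemma on_dir_pmor_comp:
  "on_dir (pmor_comp E \<psi> \<phi>) =
     (let n = on_pos \<psi> \<cdot> on_pos \<phi>; x = pb1 E n (pm_cod \<psi>); z = pb2 E n (pm_cod \<psi>)
      in lift \<phi> x (lift \<psi> (on_pos \<phi> \<cdot> x) z))"
  by (simp add: pmor_comp_def Let_def lift_def)

lemma pmor_comp [simp]: "pmor (pmor_comp E \<psi> \<phi>)"
  by (rule pmorI) (simp_all, simp_all add: on_dir_pmor_comp Let_def)

lemma lift_pmor_comp [simp]:
  assumes "x \<in> Arr E" "z \<in> Arr E" "Cod E x = Cod E (pm_dom \<phi>)" "Cod E z = Dom E (pm_cod \<psi>)"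
    "Dom E z = Dom E x" "on_pos \<psi> \<cdot> on_pos \<phi> \<cdot> x = pm_cod \<psi> \<cdot> z"
  shows "lift (pmor_comp E \<psi> \<phi>) x z = lift \<phi> x (lift \<psi> (on_pos \<phi> \<cdot> x) z)"
  using assms by (simp add: lift_def[of "pmor_comp E \<psi> \<phi>"] on_dir_pmor_comp Let_def)

end

subsection \<open>Composition product of morphisms, unitors and associator\<close>

lemma ptens_mor_simps [simp]:
  "pm_dom (ptens_mor E \<phi> \<psi>) = ptens E (pm_dom \<phi>) (pm_dom \<psi>)"
  "pm_cod (ptens_mor E \<phi> \<psi>) = ptens E (pm_cod \<phi>) (pm_cod \<psi>)"
  "on_pos (ptens_mor E \<phi> \<psi>) = ptens_pos E \<phi> \<psi>"
  by (simp_all add: ptens_mor_def)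

context
  fixes \<phi> \<psi> :: "'a pmor" and p q p' q' :: 'a
  assumes phi [simp]: "pmor \<phi>" and psi [simp]: "pmor \<psi>"
    and ends [simp]: "pm_dom \<phi> = p" "pm_cod \<phi> = p'" "pm_dom \<psi> = q" "pm_cod \<psi> = q'"
begin

lemma ends_exponentiable [simp]:
  "exponentiable E p" "exponentiable E p'" "exponentiable E q" "exponentiable E q'"
  using pmor_exponentiable[OF phi] pmor_exponentiable[OF psi] by auto

lemma ptens_pos_alt:
  "ptens_pos E \<phi> \<psi> =
     (let x' = on_pos \<phi> \<cdot> pos E p q; u = pb1 E x' p'; y' = pb2 E x' p'
      in mk_pos E p' q' x' (on_pos \<psi> \<cdot> app_pos E p q u (lift \<phi> (pos E p q \<cdot> u) y')))"
  by (simp add: ptens_pos_def lift_def)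

lemma ptens_pos_arr [simp]: "ptens_pos E \<phi> \<psi> \<in> Arr E"
  and dom_ptens_pos [simp]: "Dom E (ptens_pos E \<phi> \<psi>) = Dom E (pos E p q)"
  and cod_ptens_pos [simp]: "Cod E (ptens_pos E \<phi> \<psi>) = Dom E (pos E p' q')"
  by (simp_all add: ptens_pos_alt Let_def)

lemma ptens_pos_comp:
  assumes "u \<in> Arr E" "Cod E u = Dom E (pos E p q)"
  shows pos_ptens_pos [simp]: "pos E p' q' \<cdot> ptens_pos E \<phi> \<psi> \<cdot> u = on_pos \<phi> \<cdot> pos E p q \<cdot> u"
    and app_ptens_pos [simp]: "\<And>y. \<lbrakk>y \<in> Arr E; Cod E y = Dom E p'; Dom E y = Dom E u;
       on_pos \<phi> \<cdot> pos E p q \<cdot> u = p' \<cdot> y\<rbrakk> \<Longrightarrow>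
       app_pos E p' q' (ptens_pos E \<phi> \<psi> \<cdot> u) y = on_pos \<psi> \<cdot> app_pos E p q u (lift \<phi> (pos E p q \<cdot> u) y)"
  using assms by (simp_all add: ptens_pos_alt Let_def)

lemma on_dir_ptens_mor:
  "on_dir (ptens_mor E \<phi> \<psi>) =
     (let n = ptens_pos E \<phi> \<psi>; u = pb1 E n (ptens E p' q'); w = pb2 E n (ptens E p' q');
          y = lift \<phi> (pos E p q \<cdot> u) (dir1 E p' q' w)
      in mk_dir E p q u y (lift \<psi> (app_pos E p q u y) (dir2 E p' q' w)))"
  by (simp add: ptens_mor_def ptens_dir_def Let_def lift_def)

lemma pmor_ptens_mor [simp]: "pmor (ptens_mor E \<phi> \<psi>)"
  by (rule pmorI) (simp_all, simp_all add: on_dir_ptens_mor Let_def)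

lemma lift_ptens_mor [simp]:
  assumes "u \<in> Arr E" "w \<in> Arr E" "Cod E u = Dom E (pos E p q)" "Cod E w = Dom E (ptens E p' q')"
    "Dom E w = Dom E u" "ptens_pos E \<phi> \<psi> \<cdot> u = ptens E p' q' \<cdot> w"
  shows "lift (ptens_mor E \<phi> \<psi>) u w =
     mk_dir E p q u (lift \<phi> (pos E p q \<cdot> u) (dir1 E p' q' w))
       (lift \<psi> (app_pos E p q u (lift \<phi> (pos E p q \<cdot> u) (dir1 E p' q' w))) (dir2 E p' q' w))"
  using assms(1-5) assms(6)[symmetric]
  by (simp add: lift_def[of "ptens_mor E \<phi> \<psi>"]) (simp add: on_dir_ptens_mor Let_def)

end

lemma plunit_simps [simp]: "pm_dom (plunit E p) = ptens E (yon E) p" "pm_cod (plunit E p) = p"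
  by (simp_all add: plunit_def Let_def)

lemma prunit_simps [simp]: "pm_dom (prunit E p) = ptens E p (yon E)" "pm_cod (prunit E p) = p"
  "on_pos (prunit E p) = pos E p (yon E)"
  by (simp_all add: prunit_def Let_def)

lemma passoc_simps [simp]: "pm_dom (passoc E p q r) = ptens E (ptens E p q) r"
  "pm_cod (passoc E p q r) = ptens E p (ptens E q r)" "on_pos (passoc E p q r) = passoc_pos E p q r"
  by (simp_all add: passoc_def)

context
  fixes p :: 'a
  assumes p [simp]: "exponentiable E p"
begin

lemma on_pos_plunit:
  "on_pos (plunit E p) = app_pos E (yon E) p (Ident E (Dom E (pos E (yon E) p))) (bang E (Dom E (pos E (yon E) p)))"
  by (simp add: plunit_def Let_def)

text \<open>The base condition for evaluating at \<open>bang\<close> holds because every map to the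
  terminal object equals \<open>bang\<close>; it is what allows the evaluation to commute with
  \<open>u\<close>.\<close>

lemma on_pos_plunit_comp [simp]:
  "u \<in> Arr E \<Longrightarrow> Cod E u = Dom E (pos E (yon E) p) \<Longrightarrow>
    on_pos (plunit E p) \<cdot> u = app_pos E (yon E) p u (bang E (Dom E u))"
  using pos_yon_comp[of p "Ident E (Dom E (pos E (yon E) p))"] by (simp add: on_pos_plunit)

lemma on_pos_plunit_arr [simp]: "on_pos (plunit E p) \<in> Arr E"
  "Dom E (on_pos (plunit E p)) = Dom E (pos E (yon E) p)" "Cod E (on_pos (plunit E p)) = Cod E p"
  using pos_yon_comp[of p "Ident E (Dom E (pos E (yon E) p))"] by (simp_all add: on_pos_plunit)

lemma on_dir_plunit:
  "on_dir (plunit E p) = (let n = on_pos (plunit E p) in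
     mk_dir E (yon E) p (pb1 E n p) (bang E (pb_obj E n p)) (pb2 E n p))"
  by (simp add: plunit_def Let_def)

lemma pmor_plunit [simp]: "pmor (plunit E p)"
  by (rule pmorI) (simp_all, simp_all add: on_dir_plunit Let_def)

lemma lift_plunit [simp]:
  assumes "u \<in> Arr E" "z \<in> Arr E" "Cod E u = Dom E (pos E (yon E) p)" "Cod E z = Dom E p"
    "Dom E z = Dom E u" "app_pos E (yon E) p u (bang E (Dom E u)) = p \<cdot> z"
  shows "lift (plunit E p) u z = mk_dir E (yon E) p u (bang E (Dom E u)) z"
  using assms by (simp add: lift_def) (simp add: on_dir_plunit Let_def)

lemma pmor_prunit [simp]: "pmor (prunit E p)"
  by (rule pmorI) (simp_all, simp_all add: prunit_def Let_def)

lemma lift_prunit [simp]: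
  assumes "u \<in> Arr E" "y \<in> Arr E" "Cod E u = Dom E (pos E p (yon E))" "Cod E y = Dom E p"
    "Dom E y = Dom E u" "pos E p (yon E) \<cdot> u = p \<cdot> y"
  shows "lift (prunit E p) u y = mk_dir E p (yon E) u y (bang E (Dom E u))"
  using assms by (simp add: lift_def) (simp add: prunit_def Let_def)

end

context
  fixes p q r :: 'a
  assumes pqr [simp]: "exponentiable E p" "exponentiable E q" "exponentiable E r"
begin

text \<open>The nested beta rules of the associator: base, base of the inner position, inner
  function part. The \<open>Let\<close> variables of \<open>passoc_pos\<close> become opaque
  constants with their own typing and composition rules, so the nested pairings are expanded one
  layer at a time.\<close>

lemma passoc_pos:
  defines "n \<equiv> passoc_pos E p q r" and "e \<equiv> pos E (ptens E p q) r"
  shows passoc_pos_arr [simp]: "n \<in> Arr E"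
    and dom_passoc_pos [simp]: "Dom E n = Dom E e"
    and cod_passoc_pos [simp]: "Cod E n = Dom E (pos E p (ptens E q r))"
    and pos_passoc_pos [simp]: "\<And>w. \<lbrakk>w \<in> Arr E; Cod E w = Dom E e\<rbrakk> \<Longrightarrow>
      pos E p (ptens E q r) \<cdot> n \<cdot> w = pos E p q \<cdot> e \<cdot> w"
    and pos_app_passoc_pos [simp]: "\<And>w y. \<lbrakk>w \<in> Arr E; Cod E w = Dom E e; y \<in> Arr E; Cod E y = Dom E p;
      Dom E y = Dom E w; pos E p q \<cdot> e \<cdot> w = p \<cdot> y\<rbrakk> \<Longrightarrow>
      pos E q r \<cdot> app_pos E p (ptens E q r) (n \<cdot> w) y = app_pos E p q (e \<cdot> w) y"
    and app_app_passoc_pos [simp]: "\<And>w y z. \<lbrakk>w \<in> Arr E; Cod E w = Dom E e; y \<in> Arr E; Cod E y = Dom E p;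
      Dom E y = Dom E w; pos E p q \<cdot> e \<cdot> w = p \<cdot> y; z \<in> Arr E; Cod E z = Dom E q; Dom E z = Dom E w;
      app_pos E p q (e \<cdot> w) y = q \<cdot> z\<rbrakk> \<Longrightarrow>
      app_pos E q r (app_pos E p (ptens E q r) (n \<cdot> w) y) z =
      app_pos E (ptens E p q) r w (mk_dir E p q (e \<cdot> w) y z)"
proof -
  have e [simp]: "e \<in> Arr E" "Cod E e = Dom E (pos E p q)"
    by (simp_all add: e_def)
  define x where "x = pos E p q \<cdot> e"
  define u where "u = pb1 E x p"
  define y where "y = pb2 E x p"
  define fy where "fy = app_pos E p q (e \<cdot> u) y"
  define v where "v = pb1 E fy q"
  define z where "z = pb2 E fy q"
  define d where "d = mk_dir E p q (e \<cdot> u \<cdot> v) (y \<cdot> v) z"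
  define gyz where "gyz = app_pos E (ptens E p q) r (u \<cdot> v) d"
  define m where "m = mk_pos E q r fy gyz"
  have n: "n = mk_pos E p (ptens E q r) x m"
    by (simp add: n_def passoc_pos_def Let_def m_def gyz_def d_def z_def v_def fy_def y_def u_def x_def e_def)
  have x [simp]: "x \<in> Arr E" "Dom E x = Dom E e" "Cod E x = Cod E p" "pos E p q \<cdot> e = x"
    by (simp_all add: x_def)
  have xh [simp]: "pos E p q \<cdot> e \<cdot> h = x \<cdot> h" if "h \<in> Arr E" "Cod E h = Dom E e" for h
    using that comp_reassoc[OF x(4), of h] by simp
  have u [simp]: "u \<in> Arr E" "Dom E u = pb_obj E x p" "Cod E u = Dom E e"
    and y [simp]: "y \<in> Arr E" "Dom E y = pb_obj E x p" "Cod E y = Dom E p" "p \<cdot> y = x \<cdot> u"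
    by (simp_all add: u_def y_def)
  have yh [simp]: "p \<cdot> y \<cdot> h = x \<cdot> u \<cdot> h" if "h \<in> Arr E" "Cod E h = pb_obj E x p" for h
    using that by (simp add: u_def y_def)
  have fy [simp]: "fy \<in> Arr E" "Dom E fy = pb_obj E x p" "Cod E fy = Cod E q"
    by (simp_all add: fy_def)
  have fyh [simp]: "app_pos E p q (e \<cdot> u \<cdot> h) (y \<cdot> h) = fy \<cdot> h" if "h \<in> Arr E" "Cod E h = pb_obj E x p" for h
    using that by (simp add: fy_def)
  have v [simp]: "v \<in> Arr E" "Dom E v = pb_obj E fy q" "Cod E v = pb_obj E x p"
    and z [simp]: "z \<in> Arr E" "Dom E z = pb_obj E fy q" "Cod E z = Dom E q" "q \<cdot> z = fy \<cdot> v"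
    by (simp_all add: v_def z_def)
  have d [simp]: "d \<in> Arr E" "Dom E d = pb_obj E fy q" "Cod E d = Dom E (ptens E p q)"
      "ptens E p q \<cdot> d = e \<cdot> u \<cdot> v"
    by (simp_all add: d_def)
  have dh: "d \<cdot> h = mk_dir E p q (e \<cdot> u \<cdot> v \<cdot> h) (y \<cdot> v \<cdot> h) (z \<cdot> h)"
      if "h \<in> Arr E" "Cod E h = pb_obj E fy q" for h
    using that by (simp_all add: d_def)
  have gyz [simp]: "gyz \<in> Arr E" "Dom E gyz = pb_obj E fy q" "Cod E gyz = Cod E r"
    by (simp_all add: gyz_def e_def[symmetric])
  have gyzh: "gyz \<cdot> h = app_pos E (ptens E p q) r (u \<cdot> v \<cdot> h) (d \<cdot> h)"
      if "h \<in> Arr E" "Cod E h = pb_obj E fy q" for h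
    using that by (simp_all add: gyz_def e_def[symmetric])
  have m [simp]: "m \<in> Arr E" "Dom E m = pb_obj E x p" "Cod E m = Dom E (pos E q r)"
    by (simp_all add: m_def)
  show "n \<in> Arr E" "Dom E n = Dom E e" "Cod E n = Dom E (pos E p (ptens E q r))"
    by (simp_all add: n)
  show "pos E p (ptens E q r) \<cdot> n \<cdot> w = pos E p q \<cdot> e \<cdot> w" if "w \<in> Arr E" "Cod E w = Dom E e" for w
    using that by (simp add: n)
  fix w y'
  assume w [simp]: "w \<in> Arr E" "Cod E w = Dom E e" and y' [simp]: "y' \<in> Arr E" "Cod E y' = Dom E p"
      "Dom E y' = Dom E w" and "pos E p q \<cdot> e \<cdot> w = p \<cdot> y'"
  then have [simp]: "p \<cdot> y' = x \<cdot> w" by simp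
  \<comment> \<open>\<open>h\<close> is the element \<open>(w, y')\<close> at which the generic
    \<open>u\<close> and \<open>y\<close> are instantiated; \<open>h'\<close> below extends it by
    \<open>z'\<close> to instantiate \<open>v\<close> and \<open>z\<close>.\<close>
  define h where "h = pb_pair E x p w y'"
  have h [simp]: "h \<in> Arr E" "Dom E h = Dom E w" "Cod E h = pb_obj E x p" "u \<cdot> h = w" "y \<cdot> h = y'"
    by (simp_all add: h_def u_def y_def)
  have app_n: "app_pos E p (ptens E q r) (n \<cdot> w) y' = m \<cdot> h"
    by (simp add: n h_def)
  have fh: "app_pos E p q (e \<cdot> w) y' = fy \<cdot> h"
    using fyh[of h] by (simp del: fyh)
  show "pos E q r \<cdot> app_pos E p (ptens E q r) (n \<cdot> w) y' = app_pos E p q (e \<cdot> w) y'"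
    unfolding app_n fh by (simp add: m_def)
  fix z'
  assume z' [simp]: "z' \<in> Arr E" "Cod E z' = Dom E q" "Dom E z' = Dom E w"
    and "app_pos E p q (e \<cdot> w) y' = q \<cdot> z'"
  then have [simp]: "q \<cdot> z' = fy \<cdot> h" by (simp add: fh)
  define h' where "h' = pb_pair E fy q h z'"
  have h' [simp]: "h' \<in> Arr E" "Dom E h' = Dom E w" "Cod E h' = pb_obj E fy q" "v \<cdot> h' = h" "z \<cdot> h' = z'"
    by (simp_all add: h'_def v_def z_def)
  have "app_pos E q r (m \<cdot> h) z' = gyz \<cdot> h'"
    by (simp add: m_def h'_def)
  then show "app_pos E q r (app_pos E p (ptens E q r) (n \<cdot> w) y') z' =
      app_pos E (ptens E p q) r w (mk_dir E p q (e \<cdot> w) y' z')"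
    by (simp add: app_n gyzh dh)
qed

lemma on_dir_passoc:
  "on_dir (passoc E p q r) = passoc_dir E p q r"
  by (simp add: passoc_def)

lemma pmor_passoc [simp]: "pmor (passoc E p q r)"
  by (rule pmorI) (simp_all, simp_all add: on_dir_passoc passoc_dir_def Let_def)

lemma lift_passoc [simp]:
  assumes "w \<in> Arr E" "d \<in> Arr E" "Cod E w = Dom E (pos E (ptens E p q) r)"
    "Cod E d = Dom E (ptens E p (ptens E q r))" "Dom E d = Dom E w"
    "passoc_pos E p q r \<cdot> w = ptens E p (ptens E q r) \<cdot> d"
  shows "lift (passoc E p q r) w d =
    mk_dir E (ptens E p q) r w
     (mk_dir E p q (pos E (ptens E p q) r \<cdot> w) (dir1 E p (ptens E q r) d)
       (dir1 E q r (dir2 E p (ptens E q r) d)))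
     (dir2 E q r (dir2 E p (ptens E q r) d))"
  using assms(1-5) assms(6)[symmetric]
  by (simp add: lift_def) (simp add: on_dir_passoc passoc_dir_def Let_def)

end

subsection \<open>Comonoids and internal categories\<close>

lemma Poly_simps [simp]:
  "Obj (Poly E) = {p. exponentiable E p}" "Arr (Poly E) = {\<phi>. pmor \<phi>}"
  "Dom (Poly E) = pm_dom" "Cod (Poly E) = pm_cod" "Ident (Poly E) = pmor_id E"
  "Comp (Poly E) = pmor_comp E" "tens_obj (Poly E) = ptens E" "tens_arr (Poly E) = ptens_mor E"
  "tens_unit (Poly E) = yon E" "assoc (Poly E) = passoc E" "lunit (Poly E) = plunit E"
  "runit (Poly E) = prunit E"
  unfolding Poly_def pmor_def by simp_all

text \<open>When the map on positions is the identity, a direction \<open>f\<close> determines its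
  base point as \<open>p \<cdot> f\<close>, so \<open>lift\<close> needs testing only on pairs
  \<open>(p \<cdot> f, f)\<close>. The unit laws are read off in this form.\<close>

lemma pmor_eq_id_iff:
  assumes phi [simp]: "pmor \<phi>" and "pm_dom \<phi> = p" "pm_cod \<phi> = p"
  shows "\<phi> = pmor_id E p \<longleftrightarrow> on_pos \<phi> = Ident E (Cod E p) \<and>
    (\<forall>f\<in>Arr E. Cod E f = Dom E p \<longrightarrow> lift \<phi> (p \<cdot> f) f = f)"
proof -
  have p [simp]: "exponentiable E p"
    using pmor_exponentiable(1)[OF phi] unfolding assms .
  show ?thesis
  proof (intro iffI)
    assume *: "on_pos \<phi> = Ident E (Cod E p) \<and>
      (\<forall>f\<in>Arr E. Cod E f = Dom E p \<longrightarrow> lift \<phi> (p \<cdot> f) f = f)"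
    show "\<phi> = pmor_id E p"
    proof (rule pmor_ext)
      fix x y
      assume "x \<in> Arr E" "y \<in> Arr E" "Cod E y = Dom E (pm_cod (pmor_id E p))"
        "Cod E x = Cod E (pm_dom (pmor_id E p))"
        "pm_cod (pmor_id E p) \<cdot> y = on_pos (pmor_id E p) \<cdot> x"
      then have "y \<in> Arr E" "Cod E y = Dom E p" "p \<cdot> y = x"
        by simp_all
      with * show "lift \<phi> x y = lift (pmor_id E p) x y"
        by auto
    qed (use assms * in simp_all)
  qed simp
qed

text \<open>Trades quantification over hom-sets for conditions on \<open>Dom\<close> and
  \<open>Cod\<close>, the form in which the simplification rules are stated.\<close>

lemma is_icat_iff:
  "is_icat E C \<longleftrightarrow> (let s = isrc C; t = itgt C; i = iid C; k = icomp C in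
     s \<in> Arr E \<and> t \<in> Arr E \<and> Dom E t = Dom E s \<and> Cod E t = Cod E s \<and>
     i \<in> Arr E \<and> Dom E i = Cod E s \<and> Cod E i = Dom E s \<and>
     s \<cdot> i = Ident E (Cod E s) \<and> t \<cdot> i = Ident E (Cod E s) \<and>
     k \<in> Arr E \<and> Dom E k = pb_obj E t s \<and> Cod E k = Dom E s \<and>
     s \<cdot> k = s \<cdot> pb1 E t s \<and> t \<cdot> k = t \<cdot> pb2 E t s \<and>
     (\<forall>f\<in>Arr E. Cod E f = Dom E s \<longrightarrow> kap E C (i \<cdot> s \<cdot> f) f = f) \<and>
     (\<forall>f\<in>Arr E. Cod E f = Dom E s \<longrightarrow> kap E C f (i \<cdot> t \<cdot> f) = f) \<and>
     (\<forall>f\<in>Arr E. \<forall>g\<in>Arr E. \<forall>h\<in>Arr E. Cod E f = Dom E s \<and> Cod E g = Dom E s \<and> Cod E h = Dom E s \<and>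
        Dom E g = Dom E f \<and> Dom E h = Dom E f \<and> t \<cdot> f = s \<cdot> g \<and> t \<cdot> g = s \<cdot> h \<longrightarrow>
        kap E C (kap E C f g) h = kap E C f (kap E C g h)))"
proof -
  have all_hom: "(\<forall>X. \<forall>f\<in>hom E X a. P f \<and> Q f) \<longleftrightarrow>
    (\<forall>f\<in>Arr E. Cod E f = a \<longrightarrow> P f) \<and> (\<forall>f\<in>Arr E. Cod E f = a \<longrightarrow> Q f)" for P Q a
    by (auto simp: hom_iff)
  have all_hom3: "(\<forall>X. \<forall>f\<in>hom E X a. \<forall>g\<in>hom E X a. \<forall>h\<in>hom E X a. P f g h \<and> Q f g h \<longrightarrow> R f g h) \<longleftrightarrow>
    (\<forall>f\<in>Arr E. \<forall>g\<in>Arr E. \<forall>h\<in>Arr E. Cod E f = a \<and> Cod E g = a \<and> Cod E h = a \<and>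
       Dom E g = Dom E f \<and> Dom E h = Dom E f \<and> P f g h \<and> Q f g h \<longrightarrow> R f g h)" for P Q R a
    by (auto simp: hom_iff)
  show ?thesis
    unfolding is_icat_def Let_def all_hom all_hom3
    by (simp only: hom_iff iob_def imor_def simp_thms conj_assoc)
qed

text \<open>The typing half of a comonoid, split off so that each law can be analysed separately
  over data of the right type.\<close>

definition comonoid_data :: "('a, 'a pmor) comonoid \<Rightarrow> bool" where
  "comonoid_data c \<longleftrightarrow> exponentiable E (cobj c) \<and>
     pmor (counit c) \<and> pm_dom (counit c) = cobj c \<and> pm_cod (counit c) = yon E \<and>
     pmor (comult c) \<and> pm_dom (comult c) = cobj c \<and> pm_cod (comult c) = ptens E (cobj c) (cobj c)"

lemma is_comonoid_Poly_iff:
  "is_comonoid (Poly E) c \<longleftrightarrow> comonoid_data c \<and>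
     (let S = cobj c; \<epsilon> = counit c; \<delta> = comult c; I = pmor_id E S in
      pmor_comp E (plunit E S) (pmor_comp E (ptens_mor E \<epsilon> I) \<delta>) = I \<and>
      pmor_comp E (prunit E S) (pmor_comp E (ptens_mor E I \<epsilon>) \<delta>) = I \<and>
      pmor_comp E (passoc E S S S) (pmor_comp E (ptens_mor E \<delta> I) \<delta>) = pmor_comp E (ptens_mor E I \<delta>) \<delta>)"
  unfolding is_comonoid_def comonoid_data_def Let_def hom_iff Poly_simps mem_Collect_eq
  by (simp only: conj_assoc)

text \<open>Each operation is the comonoid structure evaluated at a generic element: the generic
  direction for the target, the generic object for the identity, the generic composable pair
  \<open>(f, g)\<close> for composition. Such a pair is a direction at the comultiplied object
  because \<open>t \<cdot> f = s \<cdot> g\<close>.\<close>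

definition comonoid_icat :: "('a, 'a pmor) comonoid \<Rightarrow> 'a icat" where
  "comonoid_icat c =
     (let a = cobj c; d = on_pos (comult c); t = app_pos E a a (d \<cdot> a) (Ident E (Dom E a));
        f = pb1 E t a; g = pb2 E t a
      in \<lparr>isrc = a, itgt = t, iid = lift (counit c) (Ident E (Cod E a)) (bang E (Cod E a)),
         icomp = lift (comult c) (a \<cdot> f) (mk_dir E a a (d \<cdot> a \<cdot> f) f g)\<rparr>)"

lemma isrc_comonoid_icat [simp]: "isrc (comonoid_icat c) = cobj c"
  and tgt_comonoid_icat: "itgt (comonoid_icat c) =
    app_pos E (cobj c) (cobj c) (on_pos (comult c) \<cdot> cobj c) (Ident E (Dom E (cobj c)))"
  and id_comonoid_icat: "iid (comonoid_icat c) =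
    lift (counit c) (Ident E (Cod E (cobj c))) (bang E (Cod E (cobj c)))"
  and comp_comonoid_icat: "icomp (comonoid_icat c) =
    (let f = pb1 E (itgt (comonoid_icat c)) (cobj c); g = pb2 E (itgt (comonoid_icat c)) (cobj c)
     in lift (comult c) (cobj c \<cdot> f)
          (mk_dir E (cobj c) (cobj c) (on_pos (comult c) \<cdot> cobj c \<cdot> f) f g))"
  by (simp_all add: comonoid_icat_def Let_def)

context
  fixes c
  assumes c: "comonoid_data c"
begin

abbreviation (input) "S\<^sub>c \<equiv> cobj c"
abbreviation (input) "\<epsilon>\<^sub>c \<equiv> counit c"
abbreviation (input) "\<delta>\<^sub>c \<equiv> comult c"
abbreviation (input) "C\<^sub>c \<equiv> comonoid_icat c"
abbreviation (input) "t\<^sub>c \<equiv> itgt (comonoid_icat c)"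
abbreviation (input) "i\<^sub>c \<equiv> iid (comonoid_icat c)"

lemma comonoid_data_simps [simp]:
  "exponentiable E S\<^sub>c" "pmor \<epsilon>\<^sub>c" "pm_dom \<epsilon>\<^sub>c = S\<^sub>c" "pm_cod \<epsilon>\<^sub>c = yon E"
  "pmor \<delta>\<^sub>c" "pm_dom \<delta>\<^sub>c = S\<^sub>c" "pm_cod \<delta>\<^sub>c = ptens E S\<^sub>c S\<^sub>c"
  using c by (simp_all add: comonoid_data_def)

lemma comult_pos [simp]: "on_pos \<delta>\<^sub>c \<in> Arr E" "Dom E (on_pos \<delta>\<^sub>c) = Cod E S\<^sub>c" "Cod E (on_pos \<delta>\<^sub>c) = Dom E (pos E S\<^sub>c S\<^sub>c)"
  and counit_pos [simp]: "on_pos \<epsilon>\<^sub>c \<in> Arr E" "Dom E (on_pos \<epsilon>\<^sub>c) = Cod E S\<^sub>c" "Cod E (on_pos \<epsilon>\<^sub>c) = terminal E"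
  using on_pos_arr[of \<delta>\<^sub>c] dom_on_pos[of \<delta>\<^sub>c] cod_on_pos[of \<delta>\<^sub>c]
    on_pos_arr[of \<epsilon>\<^sub>c] dom_on_pos[of \<epsilon>\<^sub>c] cod_on_pos[of \<epsilon>\<^sub>c] by simp_all

lemma counit_pos_bang [simp]: "on_pos \<epsilon>\<^sub>c = bang E (Cod E S\<^sub>c)"
  using bang_eq[of "on_pos \<epsilon>\<^sub>c"] counit_pos by simp

context
  assumes pos_comult [simp]: "pos E S\<^sub>c S\<^sub>c \<cdot> on_pos \<delta>\<^sub>c = Ident E (Cod E S\<^sub>c)"
begin

lemma pos_comult_comp [simp]:
  "x \<in> Arr E \<Longrightarrow> Cod E x = Cod E S\<^sub>c \<Longrightarrow> pos E S\<^sub>c S\<^sub>c \<cdot> on_pos \<delta>\<^sub>c \<cdot> x = x"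
  using comp_reassoc[OF pos_comult, of x] by simp

text \<open>Evaluation at the generic direction is legitimate only if the position
  \<open>on_pos \<delta>\<^sub>c \<cdot> S\<^sub>c\<close> has base \<open>S\<^sub>c\<close>. The
  assumption \<open>pos_comult\<close> guarantees this, and is therefore fixed before the laws are
  analysed.\<close>

lemma comonoid_tgt [simp]: "t\<^sub>c \<in> Arr E" "Dom E t\<^sub>c = Dom E S\<^sub>c" "Cod E t\<^sub>c = Cod E S\<^sub>c"
  by (simp_all add: tgt_comonoid_icat)

text \<open>A direction \<open>y\<close> determines its base point
  \<open>S\<^sub>c \<cdot> y\<close>, so the function parts of all positions in the image of the
  comultiplication amount to one map out of \<open>Dom E S\<^sub>c\<close>.\<close>

lemma app_comult [simp]:
  "\<lbrakk>x \<in> Arr E; y \<in> Arr E; Cod E y = Dom E S\<^sub>c; Cod E x = Cod E S\<^sub>c; Dom E y = Dom E x; S\<^sub>c \<cdot> y = x\<rbrakk> \<Longrightarrow>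
     app_pos E S\<^sub>c S\<^sub>c (on_pos \<delta>\<^sub>c \<cdot> x) y = t\<^sub>c \<cdot> y"
  by (auto simp: tgt_comonoid_icat)

lemma app_comult_generic [simp]:
  "\<lbrakk>y \<in> Arr E; Cod E y = Dom E S\<^sub>c; S\<^sub>c \<cdot> y = Ident E (Cod E S\<^sub>c); Dom E y = Cod E S\<^sub>c\<rbrakk> \<Longrightarrow>
     app_pos E S\<^sub>c S\<^sub>c (on_pos \<delta>\<^sub>c) y = t\<^sub>c \<cdot> y"
  using app_comult[of "Ident E (Cod E S\<^sub>c)" y] by simp

lemma comonoid_id [simp]: "i\<^sub>c \<in> Arr E" "Dom E i\<^sub>c = Cod E S\<^sub>c" "Cod E i\<^sub>c = Dom E S\<^sub>c" "S\<^sub>c \<cdot> i\<^sub>c = Ident E (Cod E S\<^sub>c)"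
  by (simp_all add: id_comonoid_icat)

lemma src_id_comp [simp]: "x \<in> Arr E \<Longrightarrow> Cod E x = Cod E S\<^sub>c \<Longrightarrow> S\<^sub>c \<cdot> i\<^sub>c \<cdot> x = x"
  using comp_reassoc[OF comonoid_id(4), of x] by simp

lemma lift_counit [simp]:
  "\<lbrakk>x \<in> Arr E; Cod E x = Cod E S\<^sub>c; Dom E x = X\<rbrakk> \<Longrightarrow> lift \<epsilon>\<^sub>c x (bang E X) = i\<^sub>c \<cdot> x"
  by (auto simp: id_comonoid_icat)

lemma comonoid_comp [simp]: "icomp C\<^sub>c \<in> Arr E" "Dom E (icomp C\<^sub>c) = pb_obj E t\<^sub>c S\<^sub>c" "Cod E (icomp C\<^sub>c) = Dom E S\<^sub>c"
  "S\<^sub>c \<cdot> icomp C\<^sub>c = S\<^sub>c \<cdot> pb1 E t\<^sub>c S\<^sub>c"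
  by (simp_all add: comp_comonoid_icat Let_def)

lemma kap_comonoid_icat:
  assumes "f \<in> Arr E" "g \<in> Arr E" "Cod E f = Dom E S\<^sub>c" "Cod E g = Dom E S\<^sub>c" "Dom E g = Dom E f"
    "t\<^sub>c \<cdot> f = S\<^sub>c \<cdot> g"
  shows "kap E C\<^sub>c f g = lift \<delta>\<^sub>c (S\<^sub>c \<cdot> f) (mk_dir E S\<^sub>c S\<^sub>c (on_pos \<delta>\<^sub>c \<cdot> S\<^sub>c \<cdot> f) f g)"
  using assms by (simp add: kap_def comp_comonoid_icat Let_def)

lemma kap:
  assumes "f \<in> Arr E" "g \<in> Arr E" "Cod E f = Dom E S\<^sub>c" "Cod E g = Dom E S\<^sub>c" "Dom E g = Dom E f"
    "t\<^sub>c \<cdot> f = S\<^sub>c \<cdot> g"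
  shows kap_arr [simp]: "kap E C\<^sub>c f g \<in> Arr E"
    and dom_kap [simp]: "Dom E (kap E C\<^sub>c f g) = Dom E f"
    and cod_kap [simp]: "Cod E (kap E C\<^sub>c f g) = Dom E S\<^sub>c"
    and src_kap [simp]: "S\<^sub>c \<cdot> kap E C\<^sub>c f g = S\<^sub>c \<cdot> f"
    and lift_comult [simp]: "\<And>x u. S\<^sub>c \<cdot> f = x \<Longrightarrow> on_pos \<delta>\<^sub>c \<cdot> x = u \<Longrightarrow>
      lift \<delta>\<^sub>c x (mk_dir E S\<^sub>c S\<^sub>c u f g) = kap E C\<^sub>c f g"
  using assms by (auto simp: kap_comonoid_icat)

text \<open>The source equations for identities and composites hold for free, since a lifted
  direction always lies over the given base point. What remains is split to match the three comonoid
  laws.\<close>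

lemma is_icat_comonoid_icat:
  "is_icat E C\<^sub>c \<longleftrightarrow> t\<^sub>c \<cdot> i\<^sub>c = Ident E (Cod E S\<^sub>c) \<and> t\<^sub>c \<cdot> icomp C\<^sub>c = t\<^sub>c \<cdot> pb2 E t\<^sub>c S\<^sub>c \<and>
    (\<forall>f\<in>Arr E. Cod E f = Dom E S\<^sub>c \<longrightarrow> kap E C\<^sub>c (i\<^sub>c \<cdot> S\<^sub>c \<cdot> f) f = f) \<and>
    (\<forall>f\<in>Arr E. Cod E f = Dom E S\<^sub>c \<longrightarrow> kap E C\<^sub>c f (i\<^sub>c \<cdot> t\<^sub>c \<cdot> f) = f) \<and>
    (\<forall>f\<in>Arr E. \<forall>g\<in>Arr E. \<forall>h\<in>Arr E. Cod E f = Dom E S\<^sub>c \<and> Cod E g = Dom E S\<^sub>c \<and> Cod E h = Dom E S\<^sub>c \<and>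
       Dom E g = Dom E f \<and> Dom E h = Dom E f \<and> t\<^sub>c \<cdot> f = S\<^sub>c \<cdot> g \<and> t\<^sub>c \<cdot> g = S\<^sub>c \<cdot> h \<longrightarrow>
       kap E C\<^sub>c (kap E C\<^sub>c f g) h = kap E C\<^sub>c f (kap E C\<^sub>c g h))"
  unfolding is_icat_iff Let_def by simp

text \<open>The left side sends a position \<open>x\<close> to \<open>t \<cdot> i \<cdot> x\<close>
  and a direction \<open>f\<close> to the composite of the identity at its source with
  \<open>f\<close>. That composite is well typed only if \<open>t \<cdot> i\<close> is the identity,
  hence the premise of the inner fact \<open>lift\<close>.\<close>

lemma lunit_law_iff:
  "pmor_comp E (plunit E S\<^sub>c) (pmor_comp E (ptens_mor E \<epsilon>\<^sub>c (pmor_id E S\<^sub>c)) \<delta>\<^sub>c) = pmor_id E S\<^sub>c \<longleftrightarrow>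
     t\<^sub>c \<cdot> i\<^sub>c = Ident E (Cod E S\<^sub>c) \<and>
     (\<forall>f\<in>Arr E. Cod E f = Dom E S\<^sub>c \<longrightarrow> kap E C\<^sub>c (i\<^sub>c \<cdot> S\<^sub>c \<cdot> f) f = f)"
  (is "?L = _ \<longleftrightarrow> _")
proof -
  have pos: "on_pos ?L = t\<^sub>c \<cdot> i\<^sub>c"
    by simp
  have lift: "lift ?L (S\<^sub>c \<cdot> f) f = kap E C\<^sub>c (i\<^sub>c \<cdot> S\<^sub>c \<cdot> f) f"
    if ti: "t\<^sub>c \<cdot> i\<^sub>c = Ident E (Cod E S\<^sub>c)" and [simp]: "f \<in> Arr E" "Cod E f = Dom E S\<^sub>c" for f
  proof -
    have "t\<^sub>c \<cdot> i\<^sub>c \<cdot> S\<^sub>c \<cdot> f = S\<^sub>c \<cdot> f"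
      using comp_reassoc[OF ti, of "S\<^sub>c \<cdot> f"] by simp
    then show ?thesis by simp
  qed
  show ?thesis
    by (subst pmor_eq_id_iff, simp, simp, simp, unfold pos) (use lift in metis)
qed

text \<open>The position half is already the standing assumption \<open>pos_comult\<close>, so only
  the equation for directions is left.\<close>

lemma runit_law_iff:
  "pmor_comp E (prunit E S\<^sub>c) (pmor_comp E (ptens_mor E (pmor_id E S\<^sub>c) \<epsilon>\<^sub>c) \<delta>\<^sub>c) = pmor_id E S\<^sub>c \<longleftrightarrow>
     (\<forall>f\<in>Arr E. Cod E f = Dom E S\<^sub>c \<longrightarrow> kap E C\<^sub>c f (i\<^sub>c \<cdot> t\<^sub>c \<cdot> f) = f)"
  (is "?L = _ \<longleftrightarrow> _")
proof -
  have pos: "on_pos ?L = Ident E (Cod E S\<^sub>c)"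
    by simp
  have lift: "lift ?L (S\<^sub>c \<cdot> f) f = kap E C\<^sub>c f (i\<^sub>c \<cdot> t\<^sub>c \<cdot> f)"
    if [simp]: "f \<in> Arr E" "Cod E f = Dom E S\<^sub>c" for f
    by simp
  show ?thesis
    by (subst pmor_eq_id_iff, simp, simp, simp, unfold pos) (use lift in metis)
qed

text \<open>Both sides send \<open>x\<close> to a position with base \<open>x\<close> whose value at
  \<open>f\<close> is again a position, with base \<open>t \<cdot> f\<close>. At a further
  \<open>g\<close> the left side yields \<open>t\<close> of the composite of \<open>f\<close> and
  \<open>g\<close>, the right side \<open>t \<cdot> g\<close>; this comparison is the target law. A
  direction \<open>(f, (g, h))\<close> goes to the two bracketings of a triple composite.\<close>

lemma assoc_law_iff:
  "pmor_comp E (passoc E S\<^sub>c S\<^sub>c S\<^sub>c) (pmor_comp E (ptens_mor E \<delta>\<^sub>c (pmor_id E S\<^sub>c)) \<delta>\<^sub>c) =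
     pmor_comp E (ptens_mor E (pmor_id E S\<^sub>c) \<delta>\<^sub>c) \<delta>\<^sub>c \<longleftrightarrow>
   t\<^sub>c \<cdot> icomp C\<^sub>c = t\<^sub>c \<cdot> pb2 E t\<^sub>c S\<^sub>c \<and>
    (\<forall>f\<in>Arr E. \<forall>g\<in>Arr E. \<forall>h\<in>Arr E. Cod E f = Dom E S\<^sub>c \<and> Cod E g = Dom E S\<^sub>c \<and> Cod E h = Dom E S\<^sub>c \<and>
       Dom E g = Dom E f \<and> Dom E h = Dom E f \<and> t\<^sub>c \<cdot> f = S\<^sub>c \<cdot> g \<and> t\<^sub>c \<cdot> g = S\<^sub>c \<cdot> h \<longrightarrow>
       kap E C\<^sub>c (kap E C\<^sub>c f g) h = kap E C\<^sub>c f (kap E C\<^sub>c g h))"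
  (is "?L = ?R \<longleftrightarrow> _")
proof -
  let ?SS = "ptens E S\<^sub>c S\<^sub>c"
  have L [simp]: "pmor ?L" "pmor ?R" "pm_dom ?L = S\<^sub>c" "pm_dom ?R = S\<^sub>c" "pm_cod ?L = ptens E S\<^sub>c ?SS"
    "pm_cod ?R = ptens E S\<^sub>c ?SS"
    by simp_all
  \<comment> \<open>Naming the two position maps keeps the simplifier from expanding them into
    \<open>passoc_pos\<close> and \<open>ptens_pos\<close>; their function parts are recorded as
    rules instead.\<close>
  define l where "l = on_pos ?L"
  define r where "r = on_pos ?R"
  have l [simp]: "l \<in> Arr E" "Dom E l = Cod E S\<^sub>c" "Cod E l = Dom E (pos E S\<^sub>c ?SS)"
    and r [simp]: "r \<in> Arr E" "Dom E r = Cod E S\<^sub>c" "Cod E r = Dom E (pos E S\<^sub>c ?SS)"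
    by (simp_all add: l_def r_def)
  have pos_l [simp]: "pos E S\<^sub>c ?SS \<cdot> l \<cdot> x = x" and pos_r [simp]: "pos E S\<^sub>c ?SS \<cdot> r \<cdot> x = x"
    if "x \<in> Arr E" "Cod E x = Cod E S\<^sub>c" for x
    using that by (simp_all add: l_def r_def)
  have pos_l' [simp]: "pos E S\<^sub>c ?SS \<cdot> l = Ident E (Cod E S\<^sub>c)" and pos_r' [simp]: "pos E S\<^sub>c ?SS \<cdot> r = Ident E (Cod E S\<^sub>c)"
    using pos_l[of "Ident E (Cod E S\<^sub>c)"] pos_r[of "Ident E (Cod E S\<^sub>c)"] by simp_all
  have app_r [simp]: "app_pos E S\<^sub>c ?SS (r \<cdot> x) f = on_pos \<delta>\<^sub>c \<cdot> t\<^sub>c \<cdot> f"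
    if "x \<in> Arr E" "f \<in> Arr E" "Cod E x = Cod E S\<^sub>c" "Cod E f = Dom E S\<^sub>c" "S\<^sub>c \<cdot> f = x" "Dom E x = Dom E f" for x f
    using that by (simp add: r_def)
  have pos_app_l [simp]: "pos E S\<^sub>c S\<^sub>c \<cdot> app_pos E S\<^sub>c ?SS (l \<cdot> x) f = t\<^sub>c \<cdot> f"
    if "x \<in> Arr E" "f \<in> Arr E" "Cod E x = Cod E S\<^sub>c" "Cod E f = Dom E S\<^sub>c" "S\<^sub>c \<cdot> f = x" "Dom E x = Dom E f" for x f
    using that by (simp add: l_def)
  have app_app_l [simp]: "app_pos E S\<^sub>c S\<^sub>c (app_pos E S\<^sub>c ?SS (l \<cdot> x) f) g = t\<^sub>c \<cdot> kap E C\<^sub>c f g"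
    if "x \<in> Arr E" "f \<in> Arr E" "g \<in> Arr E" "Cod E x = Cod E S\<^sub>c" "Cod E f = Dom E S\<^sub>c" "Cod E g = Dom E S\<^sub>c"
      "S\<^sub>c \<cdot> f = x" "S\<^sub>c \<cdot> g = t\<^sub>c \<cdot> f" "Dom E x = Dom E f" "Dom E g = Dom E f" for x f g
    using that by (simp add: l_def)
  \<comment> \<open>The equation between maps is the instance of the equation between elements at
    the two projections, and every other instance follows by composition.\<close>
  have t_comp: "t\<^sub>c \<cdot> icomp C\<^sub>c = t\<^sub>c \<cdot> pb2 E t\<^sub>c S\<^sub>c \<longleftrightarrow>
    (\<forall>f\<in>Arr E. \<forall>g\<in>Arr E. Cod E f = Dom E S\<^sub>c \<and> Cod E g = Dom E S\<^sub>c \<and> Dom E g = Dom E f \<and>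
       S\<^sub>c \<cdot> g = t\<^sub>c \<cdot> f \<longrightarrow> t\<^sub>c \<cdot> kap E C\<^sub>c f g = t\<^sub>c \<cdot> g)"
  proof (intro iffI ballI impI)
    fix f g
    assume *: "t\<^sub>c \<cdot> icomp C\<^sub>c = t\<^sub>c \<cdot> pb2 E t\<^sub>c S\<^sub>c" and "f \<in> Arr E" "g \<in> Arr E" "Cod E f = Dom E S\<^sub>c \<and>
      Cod E g = Dom E S\<^sub>c \<and> Dom E g = Dom E f \<and> S\<^sub>c \<cdot> g = t\<^sub>c \<cdot> f"
    then show "t\<^sub>c \<cdot> kap E C\<^sub>c f g = t\<^sub>c \<cdot> g"
      using comp_reassoc[OF *, of "pb_pair E t\<^sub>c S\<^sub>c f g"] by (simp add: kap_def)
  next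
    assume *: "\<forall>f\<in>Arr E. \<forall>g\<in>Arr E. Cod E f = Dom E S\<^sub>c \<and> Cod E g = Dom E S\<^sub>c \<and> Dom E g = Dom E f \<and>
       S\<^sub>c \<cdot> g = t\<^sub>c \<cdot> f \<longrightarrow> t\<^sub>c \<cdot> kap E C\<^sub>c f g = t\<^sub>c \<cdot> g"
    show "t\<^sub>c \<cdot> icomp C\<^sub>c = t\<^sub>c \<cdot> pb2 E t\<^sub>c S\<^sub>c"
      using *[rule_format, of "pb1 E t\<^sub>c S\<^sub>c" "pb2 E t\<^sub>c S\<^sub>c"] by (simp add: kap_def)
  qed
  have pos_iff: "l = r \<longleftrightarrow> t\<^sub>c \<cdot> icomp C\<^sub>c = t\<^sub>c \<cdot> pb2 E t\<^sub>c S\<^sub>c"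
    unfolding t_comp
  proof (intro iffI ballI impI)
    fix f g
    assume eq: "l = r" and fg [simp]: "f \<in> Arr E" "g \<in> Arr E" and "Cod E f = Dom E S\<^sub>c \<and>
      Cod E g = Dom E S\<^sub>c \<and> Dom E g = Dom E f \<and> S\<^sub>c \<cdot> g = t\<^sub>c \<cdot> f"
    then have [simp]: "Cod E f = Dom E S\<^sub>c" "Cod E g = Dom E S\<^sub>c" "Dom E g = Dom E f" "S\<^sub>c \<cdot> g = t\<^sub>c \<cdot> f"
      by auto
    have "t\<^sub>c \<cdot> kap E C\<^sub>c f g = app_pos E S\<^sub>c S\<^sub>c (app_pos E S\<^sub>c ?SS (l \<cdot> S\<^sub>c \<cdot> f) f) g"
      by simp
    also have "\<dots> = t\<^sub>c \<cdot> g"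
      unfolding eq by simp
    finally show "t\<^sub>c \<cdot> kap E C\<^sub>c f g = t\<^sub>c \<cdot> g" .
  next
    assume *: "\<forall>f\<in>Arr E. \<forall>g\<in>Arr E. Cod E f = Dom E S\<^sub>c \<and> Cod E g = Dom E S\<^sub>c \<and> Dom E g = Dom E f \<and>
       S\<^sub>c \<cdot> g = t\<^sub>c \<cdot> f \<longrightarrow> t\<^sub>c \<cdot> kap E C\<^sub>c f g = t\<^sub>c \<cdot> g"
    show "l = r"
    proof (rule pos_ext[of S\<^sub>c ?SS])
      fix x f
      assume [simp]: "x \<in> Arr E" "f \<in> Arr E" "Cod E f = Dom E S\<^sub>c" "Dom E f = Dom E x"
        and "Cod E x = Dom E l" "S\<^sub>c \<cdot> f = pos E S\<^sub>c ?SS \<cdot> l \<cdot> x"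
      then have [simp]: "Cod E x = Cod E S\<^sub>c" "S\<^sub>c \<cdot> f = x"
        by auto
      show "app_pos E S\<^sub>c ?SS (l \<cdot> x) f = app_pos E S\<^sub>c ?SS (r \<cdot> x) f"
      proof (rule pos_ext[of S\<^sub>c S\<^sub>c])
        fix k g
        assume [simp]: "k \<in> Arr E" "g \<in> Arr E" "Cod E g = Dom E S\<^sub>c" "Dom E g = Dom E k"
          and "Cod E k = Dom E (app_pos E S\<^sub>c ?SS (l \<cdot> x) f)"
            "S\<^sub>c \<cdot> g = pos E S\<^sub>c S\<^sub>c \<cdot> app_pos E S\<^sub>c ?SS (l \<cdot> x) f \<cdot> k"
        then have k [simp]: "Cod E k = Dom E x"
          by simp
        have [simp]: "S\<^sub>c \<cdot> f \<cdot> k = x \<cdot> k"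
          by (rule comp_reassoc) simp_all
        have [simp]: "S\<^sub>c \<cdot> g = t\<^sub>c \<cdot> f \<cdot> k"
          using \<open>S\<^sub>c \<cdot> g = _\<close> by simp
        show "app_pos E S\<^sub>c S\<^sub>c (app_pos E S\<^sub>c ?SS (l \<cdot> x) f \<cdot> k) g =
            app_pos E S\<^sub>c S\<^sub>c (app_pos E S\<^sub>c ?SS (r \<cdot> x) f \<cdot> k) g"
          using * by simp
      qed simp_all
    qed simp_all
  qed
  \<comment> \<open>The direction \<open>d\<close> is given over \<open>r \<cdot> x\<close>, and it
    is an argument for the left side only if it also lies over \<open>l \<cdot> x\<close>. Moreover
    \<open>l = r\<close> supplies the target law, without which the left bracketing is not
    composable.\<close>
  have lift_eq: "lift ?L x d = kap E C\<^sub>c (kap E C\<^sub>c f g) h \<and> lift ?R x d = kap E C\<^sub>c f (kap E C\<^sub>c g h)"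
    if lr: "l = r" and d: "d = mk_dir E S\<^sub>c ?SS (r \<cdot> x) f (mk_dir E S\<^sub>c S\<^sub>c (on_pos \<delta>\<^sub>c \<cdot> t\<^sub>c \<cdot> f) g h)"
      and "S\<^sub>c \<cdot> f = x" and [simp]: "f \<in> Arr E" "g \<in> Arr E" "h \<in> Arr E"
      "Cod E f = Dom E S\<^sub>c" "Cod E g = Dom E S\<^sub>c" "Cod E h = Dom E S\<^sub>c" "Dom E g = Dom E f" "Dom E h = Dom E f"
      "S\<^sub>c \<cdot> g = t\<^sub>c \<cdot> f" "S\<^sub>c \<cdot> h = t\<^sub>c \<cdot> g"
    for x d f g h
  proof -
    have x: "x = S\<^sub>c \<cdot> f" using \<open>S\<^sub>c \<cdot> f = x\<close> by simp
    have [simp]: "t\<^sub>c \<cdot> kap E C\<^sub>c f g = t\<^sub>c \<cdot> g"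
      using lr[unfolded pos_iff t_comp] by simp
    \<comment> \<open>Evaluating the two lifts exposes the position maps in expanded form; these
      equations fold them back to \<open>r\<close>, the base of \<open>d\<close>.\<close>
    have "l \<cdot> S\<^sub>c \<cdot> f = passoc_pos E S\<^sub>c S\<^sub>c S\<^sub>c \<cdot> ptens_pos E \<delta>\<^sub>c (pmor_id E S\<^sub>c) \<cdot> on_pos \<delta>\<^sub>c \<cdot> S\<^sub>c \<cdot> f"
      "r \<cdot> S\<^sub>c \<cdot> f = ptens_pos E (pmor_id E S\<^sub>c) \<delta>\<^sub>c \<cdot> on_pos \<delta>\<^sub>c \<cdot> S\<^sub>c \<cdot> f"
      by (simp_all add: l_def r_def)
    then have [simp]:
      "passoc_pos E S\<^sub>c S\<^sub>c S\<^sub>c \<cdot> ptens_pos E \<delta>\<^sub>c (pmor_id E S\<^sub>c) \<cdot> on_pos \<delta>\<^sub>c \<cdot> S\<^sub>c \<cdot> f = r \<cdot> S\<^sub>c \<cdot> f"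
      "ptens_pos E (pmor_id E S\<^sub>c) \<delta>\<^sub>c \<cdot> on_pos \<delta>\<^sub>c \<cdot> S\<^sub>c \<cdot> f = r \<cdot> S\<^sub>c \<cdot> f"
      using lr by simp_all
    show ?thesis
      unfolding d x by simp
  qed
  show ?thesis
    unfolding pos_iff[symmetric]
  proof (intro iffI conjI ballI impI)
    assume eq: "?L = ?R"
    then show lr: "l = r"
      unfolding l_def r_def by (rule arg_cong)
    fix f g h
    assume "f \<in> Arr E" "g \<in> Arr E" "h \<in> Arr E" "Cod E f = Dom E S\<^sub>c \<and> Cod E g = Dom E S\<^sub>c \<and>
      Cod E h = Dom E S\<^sub>c \<and> Dom E g = Dom E f \<and> Dom E h = Dom E f \<and> t\<^sub>c \<cdot> f = S\<^sub>c \<cdot> g \<and> t\<^sub>c \<cdot> g = S\<^sub>c \<cdot> h"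
    then show "kap E C\<^sub>c (kap E C\<^sub>c f g) h = kap E C\<^sub>c f (kap E C\<^sub>c g h)"
      using lift_eq[OF lr refl refl, of f g h, unfolded eq] by metis
  next
    assume *: "l = r \<and> (\<forall>f\<in>Arr E. \<forall>g\<in>Arr E. \<forall>h\<in>Arr E. Cod E f = Dom E S\<^sub>c \<and> Cod E g = Dom E S\<^sub>c \<and>
       Cod E h = Dom E S\<^sub>c \<and> Dom E g = Dom E f \<and> Dom E h = Dom E f \<and> t\<^sub>c \<cdot> f = S\<^sub>c \<cdot> g \<and> t\<^sub>c \<cdot> g = S\<^sub>c \<cdot> h \<longrightarrow>
       kap E C\<^sub>c (kap E C\<^sub>c f g) h = kap E C\<^sub>c f (kap E C\<^sub>c g h))"
    show "?L = ?R"
    proof (rule pmor_ext)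
      show "on_pos ?L = on_pos ?R"
        using * by (simp only: l_def r_def)
      fix x d
      assume "x \<in> Arr E" "d \<in> Arr E" "Cod E x = Cod E (pm_dom ?R)" "Cod E d = Dom E (pm_cod ?R)"
        "Dom E d = Dom E x" "pm_cod ?R \<cdot> d = on_pos ?R \<cdot> x"
      then have x [simp]: "x \<in> Arr E" "d \<in> Arr E" "Cod E x = Cod E S\<^sub>c" "Cod E d = Dom E (ptens E S\<^sub>c ?SS)"
        "Dom E d = Dom E x" "ptens E S\<^sub>c ?SS \<cdot> d = r \<cdot> x"
        unfolding r_def L .
      \<comment> \<open>Every direction of the triple product splits as \<open>(f, (g, h))\<close>,
        with consecutive directions composable.\<close>
      define f where "f = dir1 E S\<^sub>c ?SS d"
      define e where "e = dir2 E S\<^sub>c ?SS d"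
      define g where "g = dir1 E S\<^sub>c S\<^sub>c e"
      define h where "h = dir2 E S\<^sub>c S\<^sub>c e"
      have f [simp]: "f \<in> Arr E" "Dom E f = Dom E x" "Cod E f = Dom E S\<^sub>c" "S\<^sub>c \<cdot> f = x"
        by (simp_all add: f_def)
      have e [simp]: "e \<in> Arr E" "Dom E e = Dom E x" "Cod E e = Dom E ?SS"
          "?SS \<cdot> e = on_pos \<delta>\<^sub>c \<cdot> t\<^sub>c \<cdot> f"
        by (simp_all add: e_def f_def[symmetric])
      have g [simp]: "g \<in> Arr E" "Dom E g = Dom E x" "Cod E g = Dom E S\<^sub>c" "S\<^sub>c \<cdot> g = t\<^sub>c \<cdot> f"
        by (simp_all add: g_def)
      have h [simp]: "h \<in> Arr E" "Dom E h = Dom E x" "Cod E h = Dom E S\<^sub>c" "S\<^sub>c \<cdot> h = t\<^sub>c \<cdot> g"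
        by (simp_all add: h_def g_def[symmetric])
      have "e = mk_dir E S\<^sub>c S\<^sub>c (on_pos \<delta>\<^sub>c \<cdot> t\<^sub>c \<cdot> f) g h"
        by (simp add: g_def h_def)
      moreover have "d = mk_dir E S\<^sub>c ?SS (r \<cdot> x) f e"
        by (simp add: f_def e_def)
      ultimately have "lift ?L x d = kap E C\<^sub>c (kap E C\<^sub>c f g) h \<and> lift ?R x d = kap E C\<^sub>c f (kap E C\<^sub>c g h)"
        using * by (intro lift_eq) simp_all
      then show "lift ?L x d = lift ?R x d"
        using * by simp
    qed simp_all
  qed
qed

end

end

definition elementary_comonoid :: "('a, 'a pmor) comonoid \<Rightarrow> bool" where
  "elementary_comonoid c \<longleftrightarrow> comonoid_data c \<and>
     pos E (cobj c) (cobj c) \<cdot> on_pos (comult c) = Ident E (Cod E (cobj c)) \<and> is_icat E (comonoid_icat c)"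

text \<open>If the base part of the comultiplication is not the identity, the right counit law
  already fails on positions and both sides are false. Otherwise the three law equivalences add up
  to the laws of an internal category.\<close>

lemma is_comonoid_iff: "is_comonoid (Poly E) c \<longleftrightarrow> elementary_comonoid c"
proof (cases "comonoid_data c")
  case c: True
  let ?S = "cobj c" and ?\<epsilon> = "counit c" and ?\<delta> = "comult c"
  let ?r = "pmor_comp E (prunit E ?S) (pmor_comp E (ptens_mor E (pmor_id E ?S) ?\<epsilon>) ?\<delta>)"
  note [simp] = comonoid_data_simps[OF c] comult_pos[OF c]
  have r: "on_pos ?r = pos E ?S ?S \<cdot> on_pos ?\<delta>"
    by simp
  show ?thesis
  proof (cases "pos E ?S ?S \<cdot> on_pos ?\<delta> = Ident E (Cod E ?S)")
    case True
    then show ?thesis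
      unfolding is_comonoid_Poly_iff elementary_comonoid_def Let_def
        lunit_law_iff[OF c True] runit_law_iff[OF c True] assoc_law_iff[OF c True]
        is_icat_comonoid_icat[OF c True]
      by blast
  next
    case False
    then have "?r \<noteq> pmor_id E ?S"
      using r by (metis pmor_id_simps(3))
    with False show ?thesis
      unfolding is_comonoid_Poly_iff elementary_comonoid_def Let_def by blast
  qed
next
  case False
  then show ?thesis
    by (simp add: is_comonoid_Poly_iff elementary_comonoid_def)
qed

section \<open>From internal categories back to comonoids\<close>

text \<open>\<open>n\<close> sends an object \<open>x\<close> to the pair of \<open>x\<close> and
  the target map on the arrows out of \<open>x\<close>: the pullback of \<open>s\<close> along the
  identity is a copy of the object of arrows, whence \<open>t \<cdot> pb2\<close>. The map
  \<open>w\<close> is the generic direction over \<open>n\<close>, that is, the generic composable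
  pair.\<close>

definition icat_comonoid :: "'a icat \<Rightarrow> ('a, 'a pmor) comonoid" where
  "icat_comonoid C =
     (let s = isrc C; t = itgt C; S = Cod E s;
        n = mk_pos E s s (Ident E S) (t \<cdot> pb2 E (Ident E S) s); w = pb2 E n (ptens E s s)
      in \<lparr>cobj = s,
        counit = \<lparr>pm_dom = s, pm_cod = yon E, on_pos = bang E S, on_dir = iid C \<cdot> pb1 E (bang E S) (yon E)\<rparr>,
        comult = \<lparr>pm_dom = s, pm_cod = ptens E s s, on_pos = n, on_dir = kap E C (dir1 E s s w) (dir2 E s s w)\<rparr>\<rparr>)"

lemma icat_comonoid_simps [simp]:
  "cobj (icat_comonoid C) = isrc C" "pm_dom (counit (icat_comonoid C)) = isrc C"
  "pm_cod (counit (icat_comonoid C)) = yon E" "on_pos (counit (icat_comonoid C)) = bang E (Cod E (isrc C))"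
  "pm_dom (comult (icat_comonoid C)) = isrc C" "pm_cod (comult (icat_comonoid C)) = ptens E (isrc C) (isrc C)"
  by (simp_all add: icat_comonoid_def Let_def)

context
  fixes C :: "'a icat"
  assumes C: "is_icat E C"
begin

lemma icat_simps [simp]:
  "isrc C \<in> Arr E" "itgt C \<in> Arr E" "Dom E (itgt C) = Dom E (isrc C)" "Cod E (itgt C) = Cod E (isrc C)"
  "iid C \<in> Arr E" "Dom E (iid C) = Cod E (isrc C)" "Cod E (iid C) = Dom E (isrc C)"
  "isrc C \<cdot> iid C = Ident E (Cod E (isrc C))" "itgt C \<cdot> iid C = Ident E (Cod E (isrc C))"
  "icomp C \<in> Arr E" "Dom E (icomp C) = pb_obj E (itgt C) (isrc C)" "Cod E (icomp C) = Dom E (isrc C)"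
  and icat_comp_ends: "isrc C \<cdot> icomp C = isrc C \<cdot> pb1 E (itgt C) (isrc C)"
  "itgt C \<cdot> icomp C = itgt C \<cdot> pb2 E (itgt C) (isrc C)"
  using C unfolding is_icat_iff Let_def by blast+

lemma icat_id_comp [simp]:
  assumes "x \<in> Arr E" "Cod E x = Cod E (isrc C)"
  shows "isrc C \<cdot> iid C \<cdot> x = x" "itgt C \<cdot> iid C \<cdot> x = x"
  using comp_reassoc[OF icat_simps(8), of x] comp_reassoc[OF icat_simps(9), of x] assms by simp_all

lemma icat_kap:
  assumes "f \<in> Arr E" "g \<in> Arr E" "Cod E f = Dom E (isrc C)" "Cod E g = Dom E (isrc C)"
    "Dom E g = Dom E f" "itgt C \<cdot> f = isrc C \<cdot> g"
  shows icat_kap_arr [simp]: "kap E C f g \<in> Arr E"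
    and dom_icat_kap [simp]: "Dom E (kap E C f g) = Dom E f"
    and cod_icat_kap [simp]: "Cod E (kap E C f g) = Dom E (isrc C)"
    and src_icat_kap [simp]: "isrc C \<cdot> kap E C f g = isrc C \<cdot> f"
    and tgt_icat_kap [simp]: "itgt C \<cdot> kap E C f g = itgt C \<cdot> g"
    and icat_kap_comp [simp]: "\<And>h. h \<in> Arr E \<Longrightarrow> Cod E h = Dom E f \<Longrightarrow>
      kap E C f g \<cdot> h = kap E C (f \<cdot> h) (g \<cdot> h)"
  using assms comp_reassoc[OF icat_comp_ends(1), of "pb_pair E (itgt C) (isrc C) f g"]
    comp_reassoc[OF icat_comp_ends(2), of "pb_pair E (itgt C) (isrc C) f g"]
  by (simp_all add: kap_def)

lemma icat_kap_generic: "kap E C (pb1 E (itgt C) (isrc C)) (pb2 E (itgt C) (isrc C)) = icomp C"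
  by (simp add: kap_def)

context
  assumes s [simp]: "exponentiable E (isrc C)"
begin

lemma on_pos_icat_comonoid:
  "on_pos (comult (icat_comonoid C)) = mk_pos E (isrc C) (isrc C) (Ident E (Cod E (isrc C)))
     (itgt C \<cdot> pb2 E (Ident E (Cod E (isrc C))) (isrc C))"
  by (simp add: icat_comonoid_def Let_def)

lemma on_pos_icat_comonoid_simps [simp]:
  defines "n \<equiv> on_pos (comult (icat_comonoid C))"
  shows "n \<in> Arr E" "Dom E n = Cod E (isrc C)" "Cod E n = Dom E (pos E (isrc C) (isrc C))"
    and "pos E (isrc C) (isrc C) \<cdot> n = Ident E (Cod E (isrc C))"
    and "\<And>x. x \<in> Arr E \<Longrightarrow> Cod E x = Cod E (isrc C) \<Longrightarrow> pos E (isrc C) (isrc C) \<cdot> n \<cdot> x = x"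
    and app_icat_comonoid: "\<And>x y. \<lbrakk>x \<in> Arr E; Cod E x = Cod E (isrc C); y \<in> Arr E; Cod E y = Dom E (isrc C);
      Dom E y = Dom E x; isrc C \<cdot> y = x\<rbrakk> \<Longrightarrow> app_pos E (isrc C) (isrc C) (n \<cdot> x) y = itgt C \<cdot> y"
  by (simp_all add: n_def on_pos_icat_comonoid)

lemma on_dir_icat_comonoid:
  "on_dir (counit (icat_comonoid C)) = iid C \<cdot> pb1 E (bang E (Cod E (isrc C))) (yon E)"
  "on_dir (comult (icat_comonoid C)) =
     (let w = pb2 E (on_pos (comult (icat_comonoid C))) (ptens E (isrc C) (isrc C))
      in kap E C (dir1 E (isrc C) (isrc C) w) (dir2 E (isrc C) (isrc C) w))"
  by (simp_all add: icat_comonoid_def Let_def)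

lemma pmor_counit_icat_comonoid [simp]: "pmor (counit (icat_comonoid C))"
  by (rule pmorI) (simp_all, simp_all add: on_dir_icat_comonoid)

lemma pmor_comult_icat_comonoid [simp]: "pmor (comult (icat_comonoid C))"
  by (rule pmorI) (simp_all, simp_all add: on_dir_icat_comonoid Let_def)

lemma lift_counit_icat_comonoid [simp]:
  assumes "x \<in> Arr E" "Cod E x = Cod E (isrc C)" "Dom E x = X"
  shows "lift (counit (icat_comonoid C)) x (bang E X) = iid C \<cdot> x"
  unfolding assms(3)[symmetric] using assms(1,2)
  by (simp add: lift_def) (simp add: on_dir_icat_comonoid)

lemma lift_comult_icat_comonoid [simp]:
  assumes "f \<in> Arr E" "g \<in> Arr E" "Cod E f = Dom E (isrc C)" "Cod E g = Dom E (isrc C)"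
    "Dom E g = Dom E f" "itgt C \<cdot> f = isrc C \<cdot> g" "isrc C \<cdot> f = x"
    "on_pos (comult (icat_comonoid C)) \<cdot> x = u"
  shows "lift (comult (icat_comonoid C)) x (mk_dir E (isrc C) (isrc C) u f g) = kap E C f g"
  unfolding assms(8)[symmetric] assms(7)[symmetric] using assms(1-6)
  by (simp add: lift_def) (simp add: on_dir_icat_comonoid Let_def)

lemma comonoid_icat_icat_comonoid [simp]: "comonoid_icat (icat_comonoid C) = C"
proof (rule icat.equality)
  show t: "itgt (comonoid_icat (icat_comonoid C)) = itgt C"
    by (simp add: tgt_comonoid_icat app_icat_comonoid)
  show "icomp (comonoid_icat (icat_comonoid C)) = icomp C"
    unfolding comp_comonoid_icat t Let_def by (simp add: icat_kap_generic)
qed (simp_all add: id_comonoid_icat)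

lemma is_comonoid_icat_comonoid [simp]: "elementary_comonoid (icat_comonoid C)"
  unfolding elementary_comonoid_def comonoid_data_def using C by simp

end

end

text \<open>No information is lost in the internal category: with identity base part, the position
  map of the comultiplication is recovered from \<open>t\<close>, and every direction in question is
  a composable pair, on which the lift is \<open>kap\<close>.\<close>

lemma icat_comonoid_comonoid_icat [simp]:
  assumes "elementary_comonoid c"
  shows "icat_comonoid (comonoid_icat c) = c"
proof (rule comonoid.equality)
  have c: "comonoid_data c" and pos: "pos E (cobj c) (cobj c) \<cdot> on_pos (comult c) = Ident E (Cod E (cobj c))"
    and C: "is_icat E (comonoid_icat c)"
    using assms by (auto simp: elementary_comonoid_def)
  note [simp] = comonoid_data_simps[OF c]
  have s [simp]: "exponentiable E (isrc (comonoid_icat c))"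
    by simp
  note c_simps [simp] = comult_pos[OF c] counit_pos[OF c] counit_pos_bang[OF c]
    pos pos_comult_comp[OF c pos] app_comult[OF c pos] lift_counit[OF c pos]
    comonoid_tgt[OF c pos] comonoid_id[OF c pos] lift_comult[OF c pos] kap[OF c pos]
  note C_simps [simp] = pmor_counit_icat_comonoid[OF C s] pmor_comult_icat_comonoid[OF C s]
    on_pos_icat_comonoid_simps[OF C s, simplified isrc_comonoid_icat]
    lift_counit_icat_comonoid[OF C s, simplified isrc_comonoid_icat]
    lift_comult_icat_comonoid[OF C s, simplified isrc_comonoid_icat]
  show "counit (icat_comonoid (comonoid_icat c)) = counit c"
  proof (rule pmor_ext)
    fix x y
    assume "x \<in> Arr E" "Cod E x = Cod E (pm_dom (counit c))" "y \<in> Arr E"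
      "Cod E y = Dom E (pm_cod (counit c))" "Dom E y = Dom E x"
    \<comment> \<open>A direction of the unit polynomial is a map to the terminal object, so
      \<open>y\<close> is \<open>bang\<close> and the rule for the counit applies.\<close>
    then show "lift (counit (icat_comonoid (comonoid_icat c))) x y = lift (counit c) x y"
      using bang_eq[of y] by simp
  qed simp_all
  let ?S = "cobj c"
  show "comult (icat_comonoid (comonoid_icat c)) = comult c"
  proof (rule pmor_ext)
    show "on_pos (comult (icat_comonoid (comonoid_icat c))) = on_pos (comult c)"
      by (rule pos_ext[of ?S ?S]) simp_all
    then have n: "on_pos (comult (icat_comonoid (comonoid_icat c))) \<cdot> x = on_pos (comult c) \<cdot> x" for x
      by simp
    fix x w
    assume "x \<in> Arr E" "w \<in> Arr E" "Cod E x = Cod E (pm_dom (comult c))"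
      "Cod E w = Dom E (pm_cod (comult c))" "Dom E w = Dom E x" "pm_cod (comult c) \<cdot> w = on_pos (comult c) \<cdot> x"
    then have [simp]: "x \<in> Arr E" "w \<in> Arr E" "Cod E x = Cod E ?S" "Cod E w = Dom E (ptens E ?S ?S)"
      "Dom E w = Dom E x" "ptens E ?S ?S \<cdot> w = on_pos (comult c) \<cdot> x"
      by simp_all
    \<comment> \<open>The rules for lifting along the two comultiplications match only on
      \<open>mk_dir\<close>, so \<open>w\<close> is first split into its two components.\<close>
    have "w = mk_dir E ?S ?S (on_pos (comult c) \<cdot> x) (dir1 E ?S ?S w) (dir2 E ?S ?S w)"
      by simp
    moreover have "lift (comult (icat_comonoid (comonoid_icat c))) x
        (mk_dir E ?S ?S (on_pos (comult c) \<cdot> x) (dir1 E ?S ?S w) (dir2 E ?S ?S w)) =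
      kap E (comonoid_icat c) (dir1 E ?S ?S w) (dir2 E ?S ?S w)"
      using n[of x] by (intro lift_comult_icat_comonoid[OF C s, simplified isrc_comonoid_icat]) simp_all
    moreover have "lift (comult c) x
        (mk_dir E ?S ?S (on_pos (comult c) \<cdot> x) (dir1 E ?S ?S w) (dir2 E ?S ?S w)) =
      kap E (comonoid_icat c) (dir1 E ?S ?S w) (dir2 E ?S ?S w)"
      by (intro lift_comult[OF c pos]) simp_all
    ultimately show "lift (comult (icat_comonoid (comonoid_icat c))) x w = lift (comult c) x w"
      by metis
  qed simp_all
qed simp_all

subsection \<open>Comonoid homomorphisms and cofunctors\<close>

lemma is_cofunctor_iff:
  assumes s: "exponentiable E (isrc C)" "exponentiable E (isrc D)"
  shows "is_cofunctor E C D \<phi> \<longleftrightarrow> pmor \<phi> \<and> pm_dom \<phi> = isrc C \<and> pm_cod \<phi> = isrc D \<and>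
     (\<forall>x\<in>Arr E. Cod E x = Cod E (isrc C) \<longrightarrow> lift \<phi> x (iid D \<cdot> on_pos \<phi> \<cdot> x) = iid C \<cdot> x) \<and>
     (\<forall>x\<in>Arr E. \<forall>y\<in>Arr E. Cod E x = Cod E (isrc C) \<and> Cod E y = Dom E (isrc D) \<and> Dom E y = Dom E x \<and>
        on_pos \<phi> \<cdot> x = isrc D \<cdot> y \<longrightarrow> on_pos \<phi> \<cdot> itgt C \<cdot> lift \<phi> x y = itgt D \<cdot> y) \<and>
     (\<forall>x\<in>Arr E. \<forall>y\<in>Arr E. \<forall>z\<in>Arr E. Cod E x = Cod E (isrc C) \<and> Cod E y = Dom E (isrc D) \<and>
        Cod E z = Dom E (isrc D) \<and> Dom E y = Dom E x \<and> Dom E z = Dom E x \<and>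
        on_pos \<phi> \<cdot> x = isrc D \<cdot> y \<and> itgt D \<cdot> y = isrc D \<cdot> z \<longrightarrow>
        lift \<phi> x (kap E D y z) = kap E C (lift \<phi> x y) (lift \<phi> (itgt C \<cdot> lift \<phi> x y) z))"
proof (cases "pm_dom \<phi> = isrc C \<and> pm_cod \<phi> = isrc D")
  case True
  then have pmor: "is_pmor E (isrc C) (isrc D) \<phi> \<longleftrightarrow> pmor \<phi>"
    using s by (auto simp only: pmor_def)
  have lift: "on_dir \<phi> \<cdot> pb_pair E (on_pos \<phi>) (isrc D) x y = lift \<phi> x y" for x y
    using True by (simp only: lift_def)
  have all_hom: "(\<forall>X. \<forall>x\<in>hom E X a. P x) \<longleftrightarrow> (\<forall>x\<in>Arr E. Cod E x = a \<longrightarrow> P x)" for P a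
    by (auto simp: hom_iff)
  have all_hom2: "(\<forall>X. \<forall>x\<in>hom E X a. \<forall>y\<in>hom E X b. P x y \<longrightarrow> Q x y) \<longleftrightarrow>
    (\<forall>x\<in>Arr E. \<forall>y\<in>Arr E. Cod E x = a \<and> Cod E y = b \<and> Dom E y = Dom E x \<and> P x y \<longrightarrow> Q x y)" for P Q a b
    by (auto simp: hom_iff)
  have all_hom3: "(\<forall>X. \<forall>x\<in>hom E X a. \<forall>y\<in>hom E X b. \<forall>z\<in>hom E X b. P x y \<and> R y z \<longrightarrow> Q x y z) \<longleftrightarrow>
    (\<forall>x\<in>Arr E. \<forall>y\<in>Arr E. \<forall>z\<in>Arr E. Cod E x = a \<and> Cod E y = b \<and> Cod E z = b \<and>
       Dom E y = Dom E x \<and> Dom E z = Dom E x \<and> P x y \<and> R y z \<longrightarrow> Q x y z)" for P Q R a b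
    by (auto simp: hom_iff)
  show ?thesis
    unfolding is_cofunctor_def Let_def lift all_hom2 all_hom3 pmor unfolding all_hom
    using True by (simp only: iob_def imor_def simp_thms)
next
  case False
  then show ?thesis
    by (auto simp: is_cofunctor_def is_pmor_def)
qed

lemma cofunctorD:
  assumes phi: "is_cofunctor E C D \<phi>" and s: "exponentiable E (isrc C)" "exponentiable E (isrc D)"
  shows "pmor \<phi>" "pm_dom \<phi> = isrc C" "pm_cod \<phi> = isrc D"
    and "\<And>x. x \<in> Arr E \<Longrightarrow> Cod E x = Cod E (isrc C) \<Longrightarrow> lift \<phi> x (iid D \<cdot> on_pos \<phi> \<cdot> x) = iid C \<cdot> x"
    and "\<And>x y. \<lbrakk>x \<in> Arr E; y \<in> Arr E; Cod E x = Cod E (isrc C); Cod E y = Dom E (isrc D);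
        Dom E y = Dom E x; on_pos \<phi> \<cdot> x = isrc D \<cdot> y\<rbrakk> \<Longrightarrow>
        on_pos \<phi> \<cdot> itgt C \<cdot> lift \<phi> x y = itgt D \<cdot> y"
    and "\<And>x y z. \<lbrakk>x \<in> Arr E; y \<in> Arr E; z \<in> Arr E; Cod E x = Cod E (isrc C);
        Cod E y = Dom E (isrc D); Cod E z = Dom E (isrc D); Dom E y = Dom E x; Dom E z = Dom E x;
        on_pos \<phi> \<cdot> x = isrc D \<cdot> y; itgt D \<cdot> y = isrc D \<cdot> z\<rbrakk> \<Longrightarrow>
        lift \<phi> x (kap E D y z) = kap E C (lift \<phi> x y) (lift \<phi> (itgt C \<cdot> lift \<phi> x y) z)"
  using phi unfolding is_cofunctor_iff[OF s] by blast+

lemma cofunctor_id: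
  assumes C: "is_icat E C" and s [simp]: "exponentiable E (isrc C)"
  shows "is_cofunctor E C C (pmor_id E (isrc C))"
proof -
  note [simp] = icat_simps[OF C] icat_id_comp[OF C] icat_kap[OF C]
  show ?thesis
    unfolding is_cofunctor_iff[OF s s] by auto
qed

lemma cofunctor_comp:
  assumes C: "is_icat E C" "is_icat E C'" "is_icat E C''"
    and s [simp]: "exponentiable E (isrc C)" "exponentiable E (isrc C')" "exponentiable E (isrc C'')"
    and phi: "is_cofunctor E C C' \<phi>" and psi: "is_cofunctor E C' C'' \<psi>"
  shows "is_cofunctor E C C'' (pmor_comp E \<psi> \<phi>)"
proof -
  note [simp] = icat_simps[OF C(1)] icat_id_comp[OF C(1)] icat_kap[OF C(1)]
    icat_simps[OF C(2)] icat_id_comp[OF C(2)] icat_kap[OF C(2)]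
    icat_simps[OF C(3)] icat_id_comp[OF C(3)] icat_kap[OF C(3)]
    cofunctorD[OF phi s(1,2)] cofunctorD[OF psi s(2,3)]
  have [simp]: "on_pos \<phi> \<in> Arr E" "Dom E (on_pos \<phi>) = Cod E (isrc C)" "Cod E (on_pos \<phi>) = Cod E (isrc C')"
    "on_pos \<psi> \<in> Arr E" "Dom E (on_pos \<psi>) = Cod E (isrc C')" "Cod E (on_pos \<psi>) = Cod E (isrc C'')"
    using on_pos_arr[of \<phi>] dom_on_pos[of \<phi>] cod_on_pos[of \<phi>]
      on_pos_arr[of \<psi>] dom_on_pos[of \<psi>] cod_on_pos[of \<psi>] by simp_all
  show ?thesis
    unfolding is_cofunctor_iff[OF s(1,3)]
  proof (intro conjI ballI impI)
    show "pmor (pmor_comp E \<psi> \<phi>)" "pm_dom (pmor_comp E \<psi> \<phi>) = isrc C" "pm_cod (pmor_comp E \<psi> \<phi>) = isrc C''"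
      by simp_all
    fix x assume [simp]: "x \<in> Arr E" "Cod E x = Cod E (isrc C)"
    show "lift (pmor_comp E \<psi> \<phi>) x (iid C'' \<cdot> on_pos (pmor_comp E \<psi> \<phi>) \<cdot> x) = iid C \<cdot> x"
      by simp
  next
    fix x y
    assume [simp]: "x \<in> Arr E" "y \<in> Arr E" and "Cod E x = Cod E (isrc C) \<and> Cod E y = Dom E (isrc C'') \<and>
      Dom E y = Dom E x \<and> on_pos (pmor_comp E \<psi> \<phi>) \<cdot> x = isrc C'' \<cdot> y"
    then have [simp]: "Cod E x = Cod E (isrc C)" "Cod E y = Dom E (isrc C'')" "Dom E y = Dom E x"
      and y: "on_pos (pmor_comp E \<psi> \<phi>) \<cdot> x = isrc C'' \<cdot> y"
      by blast+
    have [simp]: "isrc C'' \<cdot> y = on_pos \<psi> \<cdot> on_pos \<phi> \<cdot> x"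
      using y by simp
    show "on_pos (pmor_comp E \<psi> \<phi>) \<cdot> itgt C \<cdot> lift (pmor_comp E \<psi> \<phi>) x y = itgt C'' \<cdot> y"
      by simp
  next
    fix x y z
    assume [simp]: "x \<in> Arr E" "y \<in> Arr E" "z \<in> Arr E" and "Cod E x = Cod E (isrc C) \<and>
      Cod E y = Dom E (isrc C'') \<and> Cod E z = Dom E (isrc C'') \<and> Dom E y = Dom E x \<and> Dom E z = Dom E x \<and>
      on_pos (pmor_comp E \<psi> \<phi>) \<cdot> x = isrc C'' \<cdot> y \<and> itgt C'' \<cdot> y = isrc C'' \<cdot> z"
    then have [simp]: "Cod E x = Cod E (isrc C)" "Cod E y = Dom E (isrc C'')" "Cod E z = Dom E (isrc C'')"
      "Dom E y = Dom E x" "Dom E z = Dom E x"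
      and y: "on_pos (pmor_comp E \<psi> \<phi>) \<cdot> x = isrc C'' \<cdot> y" and "itgt C'' \<cdot> y = isrc C'' \<cdot> z"
      by blast+
    then have [simp]: "isrc C'' \<cdot> y = on_pos \<psi> \<cdot> on_pos \<phi> \<cdot> x" "isrc C'' \<cdot> z = itgt C'' \<cdot> y"
      by simp_all
    show "lift (pmor_comp E \<psi> \<phi>) x (kap E C'' y z) =
      kap E C (lift (pmor_comp E \<psi> \<phi>) x y) (lift (pmor_comp E \<psi> \<phi>) (itgt C \<cdot> lift (pmor_comp E \<psi> \<phi>) x y) z)"
      by simp
  qed
qed

lemma pmor_comp_assoc:
  assumes [simp]: "pmor \<phi>" "pmor \<psi>" "pmor \<chi>" "pm_dom \<psi> = pm_cod \<phi>" "pm_dom \<chi> = pm_cod \<psi>"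
  shows "pmor_comp E (pmor_comp E \<chi> \<psi>) \<phi> = pmor_comp E \<chi> (pmor_comp E \<psi> \<phi>)"
  by (rule pmor_ext) simp_all

lemma pmor_comp_id [simp]:
  assumes [simp]: "pmor \<phi>" and "pm_dom \<phi> = p" "pm_cod \<phi> = q"
  shows "pmor_comp E \<phi> (pmor_id E p) = \<phi>" "pmor_comp E (pmor_id E q) \<phi> = \<phi>"
  unfolding assms(2)[symmetric] assms(3)[symmetric] by (rule pmor_ext; simp)+

text \<open>Compatibility with counits is preservation of identities. For the comultiplications, the
  two position maps over \<open>x\<close> have at \<open>y\<close> the values
  \<open>t' \<cdot> y\<close> and
  \<open>\<phi>\<^sub>1 \<cdot> t \<cdot> \<phi>\<^sup>\<sharp>(x, y)\<close>, which gives
  preservation of targets; the direction maps at \<open>(y, z)\<close> give preservation of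
  composites.\<close>

lemma comonoid_hom_iff:
  assumes c: "elementary_comonoid c" and d: "elementary_comonoid d"
  shows "is_comonoid_hom (Poly E) c d \<phi> \<longleftrightarrow> is_cofunctor E (comonoid_icat c) (comonoid_icat d) \<phi>"
proof -
  let ?S = "cobj c" and ?S' = "cobj d" and ?C = "comonoid_icat c" and ?D = "comonoid_icat d"
  have c': "comonoid_data c" "pos E ?S ?S \<cdot> on_pos (comult c) = Ident E (Cod E ?S)" "is_icat E ?C"
    using c by (auto simp: elementary_comonoid_def)
  have d': "comonoid_data d" "pos E ?S' ?S' \<cdot> on_pos (comult d) = Ident E (Cod E ?S')" "is_icat E ?D"
    using d by (auto simp: elementary_comonoid_def)
  note [simp] = comonoid_data_simps[OF c'(1)] comult_pos[OF c'(1)] counit_pos[OF c'(1)]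
    counit_pos_bang[OF c'(1)] c'(2) pos_comult_comp[OF c'(1,2)] app_comult[OF c'(1,2)]
    lift_counit[OF c'(1,2)] comonoid_tgt[OF c'(1,2)] comonoid_id[OF c'(1,2)]
    lift_comult[OF c'(1,2)] kap[OF c'(1,2)] src_id_comp[OF c'(1,2)]
  note [simp] = comonoid_data_simps[OF d'(1)] comult_pos[OF d'(1)] counit_pos[OF d'(1)]
    counit_pos_bang[OF d'(1)] d'(2) pos_comult_comp[OF d'(1,2)] app_comult[OF d'(1,2)]
    lift_counit[OF d'(1,2)] comonoid_tgt[OF d'(1,2)] comonoid_id[OF d'(1,2)]
    lift_comult[OF d'(1,2)] kap[OF d'(1,2)] src_id_comp[OF d'(1,2)]
  show ?thesis
  proof (cases "pmor \<phi> \<and> pm_dom \<phi> = ?S \<and> pm_cod \<phi> = ?S'")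
    case False
    then show ?thesis
      by (subst is_cofunctor_iff) (auto simp: is_comonoid_hom_def hom_iff)
  next
    case True
    then have phi [simp]: "pmor \<phi>" "pm_dom \<phi> = ?S" "pm_cod \<phi> = ?S'"
      by auto
    have [simp]: "on_pos \<phi> \<in> Arr E" "Dom E (on_pos \<phi>) = Cod E ?S" "Cod E (on_pos \<phi>) = Cod E ?S'"
      using on_pos_arr[of \<phi>] dom_on_pos[of \<phi>] cod_on_pos[of \<phi>] by simp_all
    let ?P1 = "\<forall>x\<in>Arr E. Cod E x = Cod E ?S \<longrightarrow> lift \<phi> x (iid ?D \<cdot> on_pos \<phi> \<cdot> x) = iid ?C \<cdot> x"
    let ?P2 = "\<forall>x\<in>Arr E. \<forall>y\<in>Arr E. Cod E x = Cod E ?S \<and> Cod E y = Dom E ?S' \<and> Dom E y = Dom E x \<and>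
        on_pos \<phi> \<cdot> x = ?S' \<cdot> y \<longrightarrow> on_pos \<phi> \<cdot> itgt ?C \<cdot> lift \<phi> x y = itgt ?D \<cdot> y"
    let ?P3 = "\<forall>x\<in>Arr E. \<forall>y\<in>Arr E. \<forall>z\<in>Arr E. Cod E x = Cod E ?S \<and> Cod E y = Dom E ?S' \<and>
        Cod E z = Dom E ?S' \<and> Dom E y = Dom E x \<and> Dom E z = Dom E x \<and>
        on_pos \<phi> \<cdot> x = ?S' \<cdot> y \<and> itgt ?D \<cdot> y = ?S' \<cdot> z \<longrightarrow>
        lift \<phi> x (kap E ?D y z) = kap E ?C (lift \<phi> x y) (lift \<phi> (itgt ?C \<cdot> lift \<phi> x y) z)"
    have counit: "pmor_comp E (counit d) \<phi> = counit c \<longleftrightarrow> ?P1"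
    proof (intro iffI ballI impI)
      fix x assume *: "pmor_comp E (counit d) \<phi> = counit c" and [simp]: "x \<in> Arr E" "Cod E x = Cod E ?S"
      have "lift (pmor_comp E (counit d) \<phi>) x (bang E (Dom E x)) = lift \<phi> x (iid ?D \<cdot> on_pos \<phi> \<cdot> x)"
        by simp
      then show "lift \<phi> x (iid ?D \<cdot> on_pos \<phi> \<cdot> x) = iid ?C \<cdot> x"
        unfolding * by simp
    next
      assume *: ?P1
      show "pmor_comp E (counit d) \<phi> = counit c"
      proof (rule pmor_ext)
        fix x y
        assume "x \<in> Arr E" "Cod E x = Cod E (pm_dom (counit c))" "y \<in> Arr E"
          "Cod E y = Dom E (pm_cod (counit c))" "Dom E y = Dom E x"
        then show "lift (pmor_comp E (counit d) \<phi>) x y = lift (counit c) x y"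
          using bang_eq[of y] * by simp
      qed simp_all
    qed
    let ?L = "pmor_comp E (comult d) \<phi>" and ?R = "pmor_comp E (ptens_mor E \<phi> \<phi>) (comult c)"
    have pos_comult: "on_pos ?L = on_pos ?R \<longleftrightarrow> ?P2"
    proof (intro iffI ballI impI)
      fix x y
      assume *: "on_pos ?L = on_pos ?R" and [simp]: "x \<in> Arr E" "y \<in> Arr E" and "Cod E x = Cod E ?S \<and>
        Cod E y = Dom E ?S' \<and> Dom E y = Dom E x \<and> on_pos \<phi> \<cdot> x = ?S' \<cdot> y"
      then have [simp]: "Cod E x = Cod E ?S" "Cod E y = Dom E ?S'" "Dom E y = Dom E x" "?S' \<cdot> y = on_pos \<phi> \<cdot> x"
        by simp_all
      have "app_pos E ?S' ?S' (on_pos ?L \<cdot> x) y = itgt ?D \<cdot> y"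
        by simp
      moreover have "app_pos E ?S' ?S' (on_pos ?R \<cdot> x) y = on_pos \<phi> \<cdot> itgt ?C \<cdot> lift \<phi> x y"
        by simp
      ultimately show "on_pos \<phi> \<cdot> itgt ?C \<cdot> lift \<phi> x y = itgt ?D \<cdot> y"
        using * by metis
    next
      assume *: ?P2
      show "on_pos ?L = on_pos ?R"
        by (rule pos_ext[of ?S' ?S']) (use * in simp_all)
    qed
    have comult: "?L = ?R \<longleftrightarrow> ?P2 \<and> ?P3"
    proof (cases "?P2")
      case False
      then show ?thesis
        unfolding pos_comult[symmetric] by metis
    next
      \<comment> \<open>Under \<open>?P2\<close> the two position maps agree, so one direction
        \<open>w\<close> can be lifted along both sides. The same equation makes \<open>z\<close>
        liftable at the target of the lift of \<open>y\<close>.\<close>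
      case P2: True
      then have "on_pos ?L = on_pos ?R"
        by (simp only: pos_comult)
      then have n [simp]: "ptens_pos E \<phi> \<phi> \<cdot> on_pos (comult c) = on_pos (comult d) \<cdot> on_pos \<phi>"
        by simp
      have n' [simp]: "ptens_pos E \<phi> \<phi> \<cdot> on_pos (comult c) \<cdot> x = on_pos (comult d) \<cdot> on_pos \<phi> \<cdot> x"
        if "x \<in> Arr E" "Cod E x = Cod E ?S" for x
        using comp_reassoc[OF n, of x] that by simp
      have lift: "lift ?L x w = lift \<phi> x (kap E ?D y z) \<and>
          lift ?R x w = kap E ?C (lift \<phi> x y) (lift \<phi> (itgt ?C \<cdot> lift \<phi> x y) z)"
        if w: "w = mk_dir E ?S' ?S' (on_pos (comult d) \<cdot> on_pos \<phi> \<cdot> x) y z"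
          and [simp]: "x \<in> Arr E" "y \<in> Arr E" "z \<in> Arr E" "Cod E x = Cod E ?S" "Cod E y = Dom E ?S'"
            "Cod E z = Dom E ?S'" "Dom E y = Dom E x" "Dom E z = Dom E x"
            "?S' \<cdot> y = on_pos \<phi> \<cdot> x" "?S' \<cdot> z = itgt ?D \<cdot> y"
        for x w y z
      proof -
        have [simp]: "on_pos \<phi> \<cdot> itgt ?C \<cdot> lift \<phi> x y = itgt ?D \<cdot> y"
          using P2 by simp
        show ?thesis unfolding w by simp
      qed
      have "?L = ?R \<longleftrightarrow> ?P3"
      proof (intro iffI ballI impI)
        fix x y z
        assume eq: "?L = ?R" and "x \<in> Arr E" "y \<in> Arr E" "z \<in> Arr E" "Cod E x = Cod E ?S \<and>
          Cod E y = Dom E ?S' \<and> Cod E z = Dom E ?S' \<and> Dom E y = Dom E x \<and> Dom E z = Dom E x \<and>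
          on_pos \<phi> \<cdot> x = ?S' \<cdot> y \<and> itgt ?D \<cdot> y = ?S' \<cdot> z"
        then show "lift \<phi> x (kap E ?D y z) = kap E ?C (lift \<phi> x y) (lift \<phi> (itgt ?C \<cdot> lift \<phi> x y) z)"
          using lift[OF refl, of x y z, unfolded eq] by metis
      next
        assume P3: ?P3
        show "?L = ?R"
        proof (rule pmor_ext)
          fix x w
          assume "x \<in> Arr E" "w \<in> Arr E" "Cod E x = Cod E (pm_dom ?R)" "Cod E w = Dom E (pm_cod ?R)"
            "Dom E w = Dom E x" "pm_cod ?R \<cdot> w = on_pos ?R \<cdot> x"
          then have [simp]: "x \<in> Arr E" "w \<in> Arr E" "Cod E x = Cod E ?S" "Cod E w = Dom E (ptens E ?S' ?S')"
            "Dom E w = Dom E x" "ptens E ?S' ?S' \<cdot> w = on_pos (comult d) \<cdot> on_pos \<phi> \<cdot> x"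
            by simp_all
          define y where "y = dir1 E ?S' ?S' w"
          define z where "z = dir2 E ?S' ?S' w"
          have y [simp]: "y \<in> Arr E" "Cod E y = Dom E ?S'" "Dom E y = Dom E x" "?S' \<cdot> y = on_pos \<phi> \<cdot> x"
            by (simp_all add: y_def)
          have z [simp]: "z \<in> Arr E" "Cod E z = Dom E ?S'" "Dom E z = Dom E x" "?S' \<cdot> z = itgt ?D \<cdot> y"
            by (simp_all add: z_def y_def[symmetric])
          have w: "w = mk_dir E ?S' ?S' (on_pos (comult d) \<cdot> on_pos \<phi> \<cdot> x) y z"
            by (simp add: y_def z_def)
          have "lift ?L x w = lift \<phi> x (kap E ?D y z) \<and>
              lift ?R x w = kap E ?C (lift \<phi> x y) (lift \<phi> (itgt ?C \<cdot> lift \<phi> x y) z)"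
            by (rule lift[OF w]) simp_all
          moreover have "lift \<phi> x (kap E ?D y z) = kap E ?C (lift \<phi> x y) (lift \<phi> (itgt ?C \<cdot> lift \<phi> x y) z)"
            using P3 by simp
          ultimately show "lift ?L x w = lift ?R x w"
            by metis
        qed simp_all
      qed
      with P2 show ?thesis by blast
    qed
    have "is_comonoid_hom (Poly E) c d \<phi> \<longleftrightarrow> pmor_comp E (counit d) \<phi> = counit c \<and> ?L = ?R"
      unfolding is_comonoid_hom_def hom_iff Poly_simps mem_Collect_eq using phi by blast
    also have "\<dots> \<longleftrightarrow> ?P1 \<and> ?P2 \<and> ?P3"
      unfolding counit comult ..
    also have "\<dots> \<longleftrightarrow> is_cofunctor E ?C ?D \<phi>"
      by (subst is_cofunctor_iff) (use phi in \<open>simp_all only: isrc_comonoid_icat comonoid_data_simps[OF c'(1)]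
        comonoid_data_simps[OF d'(1)] simp_thms\<close>)
    finally show ?thesis .
  qed
qed

section \<open>The two categories and their isomorphism\<close>

definition cofun_obj :: "'a icat \<Rightarrow> bool" where
  "cofun_obj C \<longleftrightarrow> is_icat E C \<and> exponentiable E (isrc C)"

text \<open>Both categories in the theorem are instances: objects labelled by internal categories, with
  cofunctors between the labels as arrows.\<close>

lemma category_labelled_cofunctors:
  assumes L: "\<And>a. a \<in> A \<Longrightarrow> cofun_obj (L a)"
  shows "category \<lparr>Obj = A, Arr = {(a, b, \<phi>). a \<in> A \<and> b \<in> A \<and> is_cofunctor E (L a) (L b) \<phi>},
    Dom = (\<lambda>(a, b, \<phi>). a), Cod = (\<lambda>(a, b, \<phi>). b), Ident = (\<lambda>a. (a, a, pmor_id E (isrc (L a)))),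
    Comp = (\<lambda>(b, c, \<psi>) (a, b', \<phi>). (a, c, pmor_comp E \<psi> \<phi>))\<rparr>"
proof -
  have icat: "is_icat E (L a)" and exp: "exponentiable E (isrc (L a))" if "a \<in> A" for a
    using L[OF that] by (simp_all add: cofun_obj_def)
  have pmor: "pmor \<phi>" "pm_dom \<phi> = isrc (L a)" "pm_cod \<phi> = isrc (L b)"
    if "a \<in> A" "b \<in> A" "is_cofunctor E (L a) (L b) \<phi>" for a b \<phi>
    using cofunctorD(1-3)[OF that(3)] exp that by blast+
  have comp: "is_cofunctor E (L a) (L c) (pmor_comp E \<psi> \<phi>)"
    if "a \<in> A" "b \<in> A" "c \<in> A" "is_cofunctor E (L a) (L b) \<phi>" "is_cofunctor E (L b) (L c) \<psi>" for a b c \<phi> \<psi>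
    using cofunctor_comp[OF _ _ _ _ _ _ that(4,5)] icat exp that by blast
  show ?thesis
  proof (unfold_locales, goal_cases)
    case (3 a)
    then show ?case
      by (simp add: hom_iff cofunctor_id icat exp)
  next
    case (4 f a b g c)
    then show ?case
      by (auto simp: hom_iff intro: comp)
  next
    case (5 f a b)
    then show ?case
      by (auto simp: hom_iff pmor)
  next
    case (6 f a b)
    then show ?case
      by (auto simp: hom_iff pmor)
  next
    case (7 f a b g c h d)
    then obtain \<phi> \<psi> \<chi> where m: "f = (a, b, \<phi>)" "g = (b, c, \<psi>)" "h = (c, d, \<chi>)"
      and *: "a \<in> A" "b \<in> A" "c \<in> A" "d \<in> A" "is_cofunctor E (L a) (L b) \<phi>"
        "is_cofunctor E (L b) (L c) \<psi>" "is_cofunctor E (L c) (L d) \<chi>"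
      by (auto simp: hom_iff)
    then show ?case
      using pmor_comp_assoc[OF pmor(1)[OF *(1,2,5)] pmor(1)[OF *(2,3,6)] pmor(1)[OF *(3,4,7)]]
        pmor(2,3)[OF *(1,2,5)] pmor(2,3)[OF *(2,3,6)] pmor(2,3)[OF *(3,4,7)] by simp
  qed auto
qed

lemma Cofun_alt: "Cofun E = \<lparr>Obj = Collect cofun_obj,
    Arr = {(C, D, \<phi>). C \<in> Collect cofun_obj \<and> D \<in> Collect cofun_obj \<and> is_cofunctor E C D \<phi>},
    Dom = (\<lambda>(C, D, \<phi>). C), Cod = (\<lambda>(C, D, \<phi>). D), Ident = (\<lambda>C. (C, C, pmor_id E (isrc C))),
    Comp = (\<lambda>(D, D', \<psi>) (C, C', \<phi>). (C, D', pmor_comp E \<psi> \<phi>))\<rparr>"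
  by (simp add: Cofun_def cofun_obj_def[abs_def] conj_assoc)

text \<open>Homomorphisms are cofunctors between the associated internal categories, with the same
  composition of underlying morphisms; the category laws for \<open>Comon\<close> thus reduce to
  those for cofunctors.\<close>

lemma Comon_alt: "Comon (Poly E) = \<lparr>Obj = Collect elementary_comonoid,
    Arr = {(c, d, \<phi>). c \<in> Collect elementary_comonoid \<and> d \<in> Collect elementary_comonoid \<and>
      is_cofunctor E (comonoid_icat c) (comonoid_icat d) \<phi>},
    Dom = (\<lambda>(C, D, \<phi>). C), Cod = (\<lambda>(C, D, \<phi>). D), Ident = (\<lambda>c. (c, c, pmor_id E (cobj c))),
    Comp = (\<lambda>(D, D', \<psi>) (C, C', \<phi>). (C, D', pmor_comp E \<psi> \<phi>))\<rparr>"
proof -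
  have "{(c, d, \<phi>). elementary_comonoid c \<and> elementary_comonoid d \<and> is_comonoid_hom (Poly E) c d \<phi>} =
    {(c, d, \<phi>). c \<in> Collect elementary_comonoid \<and> d \<in> Collect elementary_comonoid \<and>
      is_cofunctor E (comonoid_icat c) (comonoid_icat d) \<phi>}"
    unfolding mem_Collect_eq using comonoid_hom_iff by blast
  then show ?thesis
    unfolding Comon_def is_comonoid_iff by (simp only: Poly_simps)
qed

lemma cofun_obj_comonoid_icat: "elementary_comonoid c \<Longrightarrow> cofun_obj (comonoid_icat c)"
  unfolding elementary_comonoid_def cofun_obj_def comonoid_data_def isrc_comonoid_icat by blast

lemma category_Cofun: "category (Cofun E)"
  unfolding Cofun_alt by (rule category_labelled_cofunctors[where L = "\<lambda>C. C"]) simp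

lemma category_Comon: "category (Comon (Poly E))"
  using category_labelled_cofunctors[of "Collect elementary_comonoid" comonoid_icat]
  by (simp add: Comon_alt cofun_obj_comonoid_icat)

text \<open>Both functors leave the underlying morphism of polynomials unchanged and only relabel
  its ends, so functoriality is immediate and the inverse laws reduce to the two round trips on
  objects.\<close>

lemma isomorphic_Comon_Cofun: "isomorphic_categories (Comon (Poly E)) (Cofun E)"
proof -
  define F where "F = \<lparr>fobj = comonoid_icat,
    farr = (\<lambda>(c, d, \<phi> :: 'a pmor). (comonoid_icat c, comonoid_icat d, \<phi>))\<rparr>"
  define G where "G = \<lparr>fobj = icat_comonoid,
    farr = (\<lambda>(C, D, \<phi> :: 'a pmor). (icat_comonoid C, icat_comonoid D, \<phi>))\<rparr>"
  have GF: "icat_comonoid (comonoid_icat c) = c" if "elementary_comonoid c" for c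
    using that by simp
  have FG: "comonoid_icat (icat_comonoid C) = C" "elementary_comonoid (icat_comonoid C)" if "cofun_obj C" for C
    using that by (simp_all add: cofun_obj_def)
  have "is_functor (Comon (Poly E)) (Cofun E) F"
    unfolding is_functor_def using category_Comon category_Cofun
    by (auto simp: Comon_alt Cofun_alt F_def hom_iff cofun_obj_comonoid_icat)
  moreover have "is_functor (Cofun E) (Comon (Poly E)) G"
    unfolding is_functor_def using category_Comon category_Cofun
    by (auto simp: Comon_alt Cofun_alt G_def hom_iff FG)
  ultimately show ?thesis
    unfolding isomorphic_categories_def
    by (intro exI[of _ F] exI[of _ G]) (auto simp: Comon_alt Cofun_alt F_def G_def GF FG)
qed

end

theorem corollary5p12:
  fixes E :: "('o, 'a) cat"
  assumes "category E"
    and "has_finite_limits E"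
  shows "isomorphic_categories (Comon (Poly E)) (Cofun E)"
proof -
  interpret fin_category E
    using assms by (simp add: fin_category_def fin_category_axioms_def)
  show ?thesis
    by (rule isomorphic_Comon_Cofun)
qed

end
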